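(* Let $\nu,\mu\in\mathbb{C}$ with $\operatorname{Re}\nu<1$ and $\operatorname{Re}\mu<\min[1-\operatorname{Re}\nu,\,2+\operatorname{Re}\nu]$. Let $x>0$, let $y>0$ (so that $|\arg y|<\pi$), and let $p\in\mathbb{C}$ with $\operatorname{Re}p>0$. Then $$ \begin{aligned} &p^{-1/2}\exp\left(\tfrac12 p(y-x)\right)D_\mu\left(2^{1/2}y^{1/2}p^{1/2}\right)\left\{D_\nu\left(-2^{1/2}x^{1/2}p^{1/2}\right)-D_\nu\left(2^{1/2}x^{1/2}p^{1/2}\right)\right\}\\ &=\frac{2^{(\mu-\nu)/2}\sqrt\pi}{\Gamma\left[1+(\nu-\mu)/2\right]\Gamma[-\nu]}\int_0^x e^{-pt}\,t^{(\nu-\mu)/2}(x-t)^{-(1+\nu)/2}(y+t)^{\mu/2}\\ &\qquad\times{}_2F_1\left(-\frac{\mu}{2},\frac{1+\nu}{2};1+\frac{\nu-\mu}{2};\frac{t(x-y-t)}{(x-t)(y+t)}\right)dt\\ &\quad+\frac{2^{2+(\mu+\nu)/2}\sqrt\pi\,y^{1/2}x^{1/2}}{\Gamma[-\mu/2]\,\Gamma[-\nu/2]}\int_x^\infty e^{-pt}\,t^{(\nu-1)/2}(t-x)^{-(1+\mu+\nu)/2}(y-x+t)^{(\mu-1)/2}\\ &\qquad\times{}_2F_1\left(\frac{1-\mu}{2},\frac{1-\nu}{2};\frac32;\frac{xy}{t(y-x+t)}\right)dt . \end{aligned} $$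
   Context: $\Gamma[\cdot]$ is the gamma function, with $1/\Gamma$ taken to be $0$ at the nonpositive integers. ${}_2F_1(a,b;c;z)$ is the Gaussian hypergeometric function (principal branch, analytic on $\mathbb{C}\setminus[1,\infty)$). $D_\nu(z)$ is Whittaker's parabolic cylinder function of order $\nu$, the entire function of $z$ given by $$D_\nu(z)=2^{\nu/2}e^{-z^2/4}\left\{\frac{\Gamma[1/2]}{\Gamma[(1-\nu)/2]}\Phi\left(-\frac{\nu}{2};\frac12;\frac{z^2}{2}\right)+\frac{z}{2^{1/2}}\frac{\Gamma[-1/2]}{\Gamma[-\nu/2]}\Phi\left(\frac{1-\nu}{2};\frac32;\frac{z^2}{2}\right)\right\},$$ where $\Phi(a;b;z)=\sum_{n\ge0}\frac{(a)_n}{(b)_n}\frac{z^n}{n!}$ is Kummer's confluent hypergeometric function. All powers are principal values. *)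

theory Defs
  imports "HOL-Analysis.Analysis"
begin

definition kummer_phi :: "complex \<Rightarrow> complex \<Rightarrow> complex \<Rightarrow> complex" where
  "kummer_phi a b z = (\<Sum>n. pochhammer a n / pochhammer b n * z ^ n / fact n)"

text \<open>
  The reciprocal gamma function is \<open>rGamma\<close>, the entire function that vanishes at
  the nonpositive integers.
\<close>
definition parabolic_D :: "complex \<Rightarrow> complex \<Rightarrow> complex" where
  "parabolic_D \<nu> z =
     2 powr (\<nu> / 2) * exp (- (z\<^sup>2 / 4)) *
       (Gamma (1 / 2) * rGamma ((1 - \<nu>) / 2) * kummer_phi (- (\<nu> / 2)) (1 / 2) (z\<^sup>2 / 2)
        + z / of_real (sqrt 2) * Gamma (- (1 / 2)) * rGamma (- (\<nu> / 2))
            * kummer_phi ((1 - \<nu>) / 2) (3 / 2) (z\<^sup>2 / 2))"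

definition cut_plane :: "complex set" where
  "cut_plane = - (of_real ` {1..})"

text \<open>
  The principal branch of the Gaussian hypergeometric function: the analytic continuation of
  the Gauss series from the unit disc to the plane cut along \<open>[1, \<infinity>)\<close>. By the identity
  theorem the continuation is unique on \<^const>\<open>cut_plane\<close>, so the choice operator only
  leaves the (irrelevant) values on the cut undetermined. As usual, \<open>c\<close> must not be a
  nonpositive integer.
\<close>
definition hyp2F1 :: "complex \<Rightarrow> complex \<Rightarrow> complex \<Rightarrow> complex \<Rightarrow> complex" where
  "hyp2F1 a b c =
     (SOME F. F holomorphic_on cut_plane \<and>
        (\<forall>z\<in>ball 0 1. F z = (\<Sum>n. pochhammer a n * pochhammer b n / pochhammer c n * z ^ n / fact n)))"

end

theory Submission
  imports Defs "HOL-Complex_Analysis.Complex_Analysis" "HOL-Probability.Distributions"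
begin

text \<open>
  Write \<open>a = (1 - \<nu>) / 2\<close> and \<open>b = - \<mu> / 2\<close>. For real \<open>0 < a < 1\<close>, \<open>b > 0\<close> and \<open>p > 0\<close> both factors
  on the left are Laplace transforms of nonnegative functions, up to elementary factors: the difference
  of the \<open>D_\<nu>\<close> is a Kummer function with an Euler-type integral, and \<open>D_\<mu>\<close> is reduced to a Laplace transform by inserting Levy's formula for
  \<open>exp (- 2 s k)\<close> into its Gaussian integral. The product is the transform of a convolution whose
  integrand has four branch points and is regular at infinity; Moebius substitutions turn it into
  Euler's integral for \<open>2F1\<close>, with different normalisations for \<open>t < x\<close> and \<open>t > x\<close>. The general
  case follows by analytic continuation in \<open>a\<close>, then \<open>b\<close>, then \<open>p\<close>, which rests on bounds for \<open>2F1\<close>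
  that are locally uniform in its parameters.
\<close>

section \<open>Integrals and series depending holomorphically on a parameter\<close>

text \<open>Subtracting the two values of \<open>D_\<nu>\<close> leaves only the part odd in the
  argument, a single Kummer function with denominator parameter 3/2; hence the Euler-type integral.
  For real parameters everything is nonnegative, so Fubini and the comparison of both sides take
  place in \<open>[0, \<infinity>]\<close>, while integrability comes from the majorants. The branch
  points of the convolution integrand are \<open>0\<close>, \<open>t\<close>, \<open>x\<close>,
  \<open>y + t\<close>, with exponents adding up to -2; whether \<open>t\<close> or \<open>x\<close>
  ends the range of integration decides between the two integrals. The conditions on
  \<open>\<nu>\<close> and \<open>\<mu>\<close> read \<open>Re a > 0\<close>,
  \<open>Re (a + b) > 0\<close>, \<open>Re (3/2 - a + b) > 0\<close>. With the other parameters
  fixed they leave a strip for \<open>a\<close> and a half-plane for \<open>b\<close>, connected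
  sets as the identity theorem demands. The analytic obstacle is the point \<open>t = x\<close>: the
  argument of the first 2F1 tends to -\<infinity> there and that of the second to 1, so both kernels
  need growth bounds for 2F1 with a margin in the exponent, the first one after Pfaff's
  transformation.\<close>

lemma holomorphic_on_set_integral:
  fixes f :: "complex \<Rightarrow> 'a \<Rightarrow> complex"
  assumes "open S"
    and meas: "\<And>s. s \<in> S \<Longrightarrow> set_borel_measurable M T (f s)"
    and hol: "\<And>t. t \<in> T \<Longrightarrow> (\<lambda>s. f s t) holomorphic_on S"
    and dom: "\<And>s0. s0 \<in> S \<Longrightarrow> \<exists>e>0. \<exists>G. set_integrable M T G \<and>
               (\<forall>s\<in>ball s0 e \<inter> S. \<forall>t\<in>T. norm (f s t) \<le> (G t :: real))"
  shows "(\<lambda>s. LINT t:T|M. f s t) holomorphic_on S"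
  unfolding holomorphic_on_open[OF \<open>open S\<close>]
proof
  fix s0 assume "s0 \<in> S"
  from dom[OF this] obtain e G where e: "e > 0" and G: "set_integrable M T G"
    and fG: "\<And>s t. s \<in> ball s0 e \<Longrightarrow> s \<in> S \<Longrightarrow> t \<in> T \<Longrightarrow> norm (f s t) \<le> G t"
    by (meson IntI)
  obtain r where r: "r > 0" "cball s0 r \<subseteq> S"
    using \<open>open S\<close> \<open>s0 \<in> S\<close> open_contains_cball by blast
  \<comment> \<open>The derivative is estimated on \<open>ball s0 d\<close> from circles of radius
    \<open>d\<close>. These stay in \<open>ball s0 (2 * d)\<close>, where \<open>G\<close> is a
    majorant, and Cauchy's inequality costs the factor \<open>1 / d\<close> found in
    \<open>W\<close>.\<close>
  define d where "d = min r (e/2) / 2"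
  have d: "d > 0" and d2: "ball s0 (2*d) \<subseteq> S" "ball s0 (2*d) \<subseteq> ball s0 e" "cball s0 (2*d) \<subseteq> S"
    using r e by (auto simp: d_def subset_iff min_def split: if_splits)
  define F where "F = (\<lambda>s t. indicator T t *\<^sub>R f s t)"
  define W where "W = (\<lambda>t. indicator T t *\<^sub>R (G t / d))"
  have W: "integrable M W"
    using set_integrable_divide[OF G, of d] d by (simp add: W_def set_integrable_def)
  have holF: "(\<lambda>s. F s t) holomorphic_on S" for t
    using hol[of t] by (cases "t \<in> T") (auto simp: F_def)
  have measF: "F s \<in> borel_measurable M" if "s \<in> S" for s
    using meas[OF that] by (simp add: F_def set_borel_measurable_def)
  have bF: "norm (F s t) \<le> W t * d" if "s \<in> ball s0 (2*d)" for s t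
    using fG[OF subsetD[OF d2(2) that] subsetD[OF d2(1) that], of t] d
    by (simp add: F_def W_def split: split_indicator)
  have bF': "norm (deriv (\<lambda>s. F s t) s) \<le> W t" if "s \<in> ball s0 d" for s t
  proof -
    have sub: "cball s d \<subseteq> S" "cball s d \<subseteq> ball s0 (2*d)"
    proof -
      show "cball s d \<subseteq> ball s0 (2*d)"
      proof
        fix z assume "z \<in> cball s d"
        then show "z \<in> ball s0 (2*d)"
          using that dist_triangle[of s0 z s] by (simp add: dist_commute)
      qed
      then show "cball s d \<subseteq> S" using d2 by blast
    qed
    have "norm ((deriv ^^ 1) (\<lambda>s. F s t) s) \<le> fact 1 * (W t * d) / d ^ 1"
    proof (rule Cauchy_inequality)
      show "(\<lambda>s. F s t) holomorphic_on ball s d"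
        by (rule holomorphic_on_subset[OF holF]) (use sub ball_subset_cball in blast)
      show "continuous_on (cball s d) (\<lambda>s. F s t)"
        by (rule continuous_on_subset[OF holomorphic_on_imp_continuous_on[OF holF] sub(1)])
      show "norm (F z t) \<le> W t * d" if "norm (s - z) = d" for z
        by (rule bF) (use sub that in \<open>auto simp: dist_norm\<close>)
    qed (use d in auto)
    then show ?thesis using d by simp
  qed
  have derF: "((\<lambda>s. F s t) has_field_derivative deriv (\<lambda>s. F s t) s) (at s)" if "s \<in> S" for s t
    using holF that \<open>open S\<close> by (metis holomorphic_derivI)
  have lip: "norm ((F z t - F s0 t) / (z - s0)) \<le> W t" if "z \<in> ball s0 d" "z \<noteq> s0" for z t
  proof -
    have "norm (F z t - F s0 t) \<le> W t * norm (z - s0)"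
    proof (rule field_differentiable_bound[where S="ball s0 d" and f'="deriv (\<lambda>s. F s t)"])
      show "((\<lambda>s. F s t) has_field_derivative deriv (\<lambda>s. F s t) w) (at w within ball s0 d)"
        if "w \<in> ball s0 d" for w
        by (rule has_field_derivative_at_within[OF derF]) (use that d2 d in auto)
    qed (use bF' that d in auto)
    then show ?thesis using that by (simp add: norm_divide divide_simps)
  qed
  have s0d: "s0 \<in> ball s0 d" using d by simp
  have bd: "ball s0 d \<subseteq> S" using d2 d by (auto simp: subset_iff)
  have eqI: "(LINT t:T|M. f s t) = integral\<^sup>L M (F s)" for s
    by (simp add: set_lebesgue_integral_def F_def)
  have intF: "integrable M (F s)" if "s \<in> ball s0 d" for s
  proof (rule Bochner_Integration.integrable_bound)
    show "integrable M (\<lambda>t. W t * d)" using W by simp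
    show "AE t in M. norm (F s t) \<le> norm (W t * d)"
    proof (intro AE_I2)
      fix t
      have "s \<in> ball s0 (2 * d)" using that d by auto
      from bF[OF this, of t] show "norm (F s t) \<le> norm (W t * d)" by simp
    qed
  qed (use measF bd that in auto)
  have "((\<lambda>z. (integral\<^sup>L M (F z) - integral\<^sup>L M (F s0)) / (z - s0)) \<longlongrightarrow>
            integral\<^sup>L M (\<lambda>t. deriv (\<lambda>s. F s t) s0)) (at s0 within ball s0 d)"
    \<comment> \<open>Dominated convergence concerns sequences, so the difference quotient is tested
      along sequences tending to \<open>s0\<close>; \<open>W\<close> bounds all the
      quotients.\<close>
    unfolding tendsto_at_iff_sequentially
  proof (intro allI impI)
    fix X :: "nat \<Rightarrow> complex"
    assume X: "\<forall>i. X i \<in> ball s0 d - {s0}" and Xl: "X \<longlonglongrightarrow> s0"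
    have lim: "(\<lambda>i. (F (X i) t - F s0 t) / (X i - s0)) \<longlonglongrightarrow> deriv (\<lambda>s. F s t) s0" for t
    proof -
      have "((\<lambda>z. (F z t - F s0 t) / (z - s0)) \<longlongrightarrow> deriv (\<lambda>s. F s t) s0) (at s0)"
        using derF[OF \<open>s0 \<in> S\<close>] by (simp add: has_field_derivative_iff)
      then show ?thesis
        using X Xl unfolding tendsto_at_iff_sequentially o_def by auto
    qed
    have m: "(\<lambda>t. (F (X i) t - F s0 t) / (X i - s0)) \<in> borel_measurable M" for i
    proof -
      have "X i \<in> S" using X bd by blast
      then show ?thesis
        using measF \<open>s0 \<in> S\<close> by (intro borel_measurable_divide borel_measurable_diff) auto
    qed
    have "(\<lambda>i. integral\<^sup>L M (\<lambda>t. (F (X i) t - F s0 t) / (X i - s0))) \<longlonglongrightarrow>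
             integral\<^sup>L M (\<lambda>t. deriv (\<lambda>s. F s t) s0)"
    proof (rule integral_dominated_convergence[OF _ m W])
      show "(\<lambda>t. deriv (\<lambda>s. F s t) s0) \<in> borel_measurable M"
        by (rule borel_measurable_LIMSEQ_metric[OF m lim])
    qed (use lim lip X in auto)
    moreover have "integral\<^sup>L M (\<lambda>t. (F (X i) t - F s0 t) / (X i - s0)) =
        (integral\<^sup>L M (F (X i)) - integral\<^sup>L M (F s0)) / (X i - s0)" for i
    proof -
      have "integrable M (F (X i))" "integrable M (F s0)" using X s0d intF by auto
      then show ?thesis by (simp add: diff_divide_distrib)
    qed
    ultimately show "((\<lambda>z. (integral\<^sup>L M (F z) - integral\<^sup>L M (F s0)) / (z - s0)) \<circ> X)
        \<longlonglongrightarrow> integral\<^sup>L M (\<lambda>t. deriv (\<lambda>s. F s t) s0)"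
      by (simp only: o_def)
  qed
  then have "((\<lambda>s. LINT t:T|M. f s t) has_field_derivative
      integral\<^sup>L M (\<lambda>t. deriv (\<lambda>s. F s t) s0)) (at s0)"
    unfolding has_field_derivative_iff eqI using at_within_open[OF s0d] by simp
  then show "\<exists>f'. ((\<lambda>s. LINT t:T|M. f s t) has_field_derivative f') (at s0)" by blast
qed

section \<open>Binomial and Gauss series: coefficient bounds and dependence on the
  parameters\<close>

lemma neg_binomial_sums:
  fixes z :: complex
  assumes "norm z < 1"
  shows "(\<lambda>n. pochhammer a n * z ^ n / fact n) sums (1 - z) powr (- a)"
proof -
  have "(\<lambda>n. ((-a) gchoose n) * (-z) ^ n) sums (1 + (-z)) powr (- a)"
    by (rule gen_binomial_complex) (use assms in simp)
  moreover have "((-a) gchoose n) * (-z) ^ n = pochhammer a n * z ^ n / fact n" for n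
    by (simp add: gbinomial_pochhammer flip: power_mult_distrib)
  ultimately show ?thesis by simp
qed

lemma neg_binomial_sums_real:
  fixes x :: real
  assumes "\<bar>x\<bar> < 1"
  shows "(\<lambda>n. pochhammer a n * x ^ n / fact n) sums (1 - x) powr (- a)"
proof -
  have "(\<lambda>n. ((-a) gchoose n) * (-x) ^ n) sums (1 + (-x)) powr (- a)"
    by (rule gen_binomial_real) (use assms in simp)
  moreover have "((-a) gchoose n) * (-x) ^ n = pochhammer a n * x ^ n / fact n" for n
    by (simp add: gbinomial_pochhammer flip: power_mult_distrib)
  ultimately show ?thesis by simp
qed

text \<open>\<open>(k + Re a + d)^2\<close> exceeds \<open>(k + Re a)^2\<close> by at least
  \<open>2 * d * (k + Re a)\<close>, which for large \<open>k\<close> outweighs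
  \<open>(Im a)^2\<close>. So the modulus of \<open>a + k\<close> is its real part up to an
  arbitrarily small error, uniformly for \<open>norm a \<le> R\<close>.\<close>

lemma norm_add_of_nat_le:
  fixes a :: complex
  assumes "norm a \<le> R" "d > 0" "real k \<ge> R + R\<^sup>2 / (2 * d)"
  shows "norm (a + of_nat k) \<le> real k + Re a + d"
proof -
  have R0: "R \<ge> 0" using assms(1) norm_ge_zero order_trans by blast
  have "\<bar>Re a\<bar> \<le> R" "\<bar>Im a\<bar> \<le> R"
    using assms(1) abs_Re_le_cmod[of a] abs_Im_le_cmod[of a] by linarith+
  then have "(Im a)\<^sup>2 \<le> R\<^sup>2" using R0 by (metis abs_le_square_iff abs_of_nonneg)
  have kR: "real k + Re a \<ge> R\<^sup>2 / (2 * d)" using assms(3) \<open>\<bar>Re a\<bar> \<le> R\<close> by linarith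
  then have "R\<^sup>2 \<le> (real k + Re a) * (2 * d)" using assms(2) by (simp add: divide_simps)
  with \<open>(Im a)\<^sup>2 \<le> R\<^sup>2\<close> have "(real k + Re a)\<^sup>2 + (Im a)\<^sup>2 \<le> (real k + Re a + d)\<^sup>2"
    using zero_le_power2[of d] unfolding power2_sum[of "real k + Re a" d] by linarith
  moreover have "real k + Re a + d \<ge> 0"
  proof -
    have "R\<^sup>2 / (2 * d) \<ge> 0" using assms(2) by simp
    with kR assms(2) show ?thesis by linarith
  qed
  ultimately show ?thesis
    unfolding cmod_def by (intro real_le_lsqrt) (auto simp: add.commute)
qed

text \<open>
  From some index on, \<open>norm (a + k) * norm (b + k) \<le> (A + k) * norm (c + k)\<close>, uniformly in the parameters;
  the finitely many earlier ratios only contribute to the constant.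
\<close>

lemma gauss_coeff_bound:
  fixes R r A \<eta> :: real
  assumes "r > 0" "A > 0" "\<eta> > 0"
  shows "\<exists>C>0. \<forall>a b c :: complex. norm a \<le> R \<longrightarrow> norm b \<le> R \<longrightarrow> Re c \<ge> r \<longrightarrow>
           Re (a + b - c) \<le> A - \<eta> \<longrightarrow>
           (\<forall>n. norm (pochhammer a n * pochhammer b n / pochhammer c n) \<le> C * pochhammer A n)"
proof -
  \<comment> \<open>One half of \<open>\<eta>\<close> pays for the errors \<open>d\<close> in the
    moduli of \<open>a + k\<close> and \<open>b + k\<close>, the other half for the constant term of
    their product, which is at most \<open>k * \<eta> / 2\<close> once
    \<open>k \<ge> K\<close>.\<close>
  define d where "d = min 1 (\<eta> / 4)"
  have d: "d > 0" "d \<le> 1" "2 * d \<le> \<eta> / 2" using assms by (auto simp: d_def)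
  define R' where "R' = \<bar>R\<bar>"
  obtain K where K: "real K \<ge> max (R' + R'\<^sup>2 / (2 * d)) (2 * (R' + 1)\<^sup>2 / \<eta>)"
    using real_arch_simple by blast
  \<comment> \<open>Before index \<open>K\<close> the numerators are at most
    \<open>(R' + K)^2\<close>, while \<open>(A + k) * norm (c + k)\<close> is at least
    \<open>A * r\<close>.\<close>
  define M where "M = max 1 ((R' + real K)\<^sup>2 / (A * r))"
  show ?thesis
  proof (intro exI[of _ "M ^ K"] conjI allI impI)
    show "M ^ K > 0" by (simp add: M_def)
  next
    fix a b c :: complex and n
    assume h: "norm a \<le> R" "norm b \<le> R" "r \<le> Re c" "Re (a + b - c) \<le> A - \<eta>"
    have ab: "norm a \<le> R'" "norm b \<le> R'" using h by (auto simp: R'_def)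
    have R0: "R' \<ge> 0" by (simp add: R'_def)
    have cpos: "norm (c + of_nat k) \<ge> real k + Re c" for k
      using complex_Re_le_cmod[of "c + of_nat k"] by simp
    have cnz: "norm (c + of_nat k) > 0" for k
      by (rule less_le_trans[OF _ cpos]) (use h assms in linarith)
    have large: "norm (a + of_nat k) * norm (b + of_nat k) \<le> (A + k) * norm (c + of_nat k)"
      if "k \<ge> K" for k
    proof -
      have k: "real k \<ge> R' + R'\<^sup>2 / (2 * d)" "real k \<ge> 2 * (R' + 1)\<^sup>2 / \<eta>"
        using K that by linarith+
      have k2: "real k * \<eta> \<ge> 2 * (R' + 1)\<^sup>2" using k(2) assms by (simp add: divide_simps)
      have n1: "norm (a + of_nat k) \<le> real k + Re a + d" "norm (b + of_nat k) \<le> real k + Re b + d"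
        using norm_add_of_nat_le ab d k(1) by blast+
      have "norm (a + of_nat k) * norm (b + of_nat k) \<le> (real k + Re a + d) * (real k + Re b + d)"
        by (rule mult_mono[OF n1 order_trans[OF norm_ge_zero n1(1)] norm_ge_zero])
      also have "\<dots> = (real k)\<^sup>2 + real k * (Re a + Re b + 2*d) + (Re a + d) * (Re b + d)"
        by (simp add: algebra_simps power2_eq_square)
      also have "(Re a + d) * (Re b + d) \<le> \<bar>(Re a + d) * (Re b + d)\<bar>" by simp
      also have "\<dots> \<le> (R' + 1) * (R' + 1)"
        unfolding abs_mult using ab d abs_Re_le_cmod[of a] abs_Re_le_cmod[of b]
        by (intro mult_mono) auto
      also have "\<dots> \<le> real k * \<eta> / 2" using k2 by (simp add: power2_eq_square)
      also have "real k * (Re a + Re b + 2*d) \<le> real k * (A - \<eta> + Re c + \<eta> / 2)"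
        by (rule mult_left_mono) (use h d in auto)
      also have "(real k)\<^sup>2 + real k * (A - \<eta> + Re c + \<eta> / 2) + real k * \<eta> / 2 =
          (A + k) * (real k + Re c) - A * Re c"
        by (simp add: algebra_simps power2_eq_square)
      also have "\<dots> \<le> (A + k) * (real k + Re c)" using h assms by simp
      also have "\<dots> \<le> (A + k) * norm (c + of_nat k)"
        by (rule mult_left_mono[OF cpos]) (use assms in auto)
      finally show ?thesis by simp
    qed
    have M1: "M \<ge> 1" by (simp add: M_def)
    have small: "norm (a + of_nat k) * norm (b + of_nat k) \<le> M * (A + k) * norm (c + of_nat k)"
      if "k < K" for k
    proof -
      have "norm (a + of_nat k) \<le> R' + real K" "norm (b + of_nat k) \<le> R' + real K"
        using norm_triangle_ineq[of a "of_nat k"] norm_triangle_ineq[of b "of_nat k"] ab that by auto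
      then have "norm (a + of_nat k) * norm (b + of_nat k) \<le> (R' + real K) * (R' + real K)"
        by (intro mult_mono) (use R0 in auto)
      also have "\<dots> \<le> M * (A * r)"
      proof -
        have "(R' + real K) * (R' + real K) = (R' + real K)\<^sup>2 / (A * r) * (A * r)"
          using assms by (simp add: power2_eq_square)
        also have "\<dots> \<le> M * (A * r)"
          by (rule mult_right_mono) (use assms in \<open>auto simp: M_def\<close>)
        finally show ?thesis .
      qed
      also have "A * r \<le> (A + k) * norm (c + of_nat k)"
        using assms h by (intro mult_mono order_trans[OF _ cpos]) auto
      finally show ?thesis using M1 by (simp add: mult.assoc)
    qed
    have "norm (pochhammer a n * pochhammer b n / pochhammer c n) \<le> M ^ min n K * pochhammer A n"
    proof (induction n)
      case (Suc n)
      have "norm (pochhammer a (Suc n) * pochhammer b (Suc n) / pochhammer c (Suc n)) =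
          norm (pochhammer a n * pochhammer b n / pochhammer c n) *
            (norm (a + of_nat n) * norm (b + of_nat n) / norm (c + of_nat n))"
        by (simp add: pochhammer_Suc norm_mult norm_divide)
      also have "\<dots> \<le> (M ^ min n K * pochhammer A n) * ((if n < K then M else 1) * (A + n))"
      proof (rule mult_mono[OF Suc])
        show "norm (a + of_nat n) * norm (b + of_nat n) / norm (c + of_nat n) \<le>
            (if n < K then M else 1) * (A + n)"
          using small[of n] large[of n] cnz[of n] by (auto simp: divide_simps mult.assoc)
        show "0 \<le> M ^ min n K * pochhammer A n"
          using M1 assms by (intro mult_nonneg_nonneg pochhammer_nonneg) auto
      qed simp
      also have "\<dots> = M ^ min (Suc n) K * pochhammer A (Suc n)"
        by (cases "n < K") (simp_all add: pochhammer_Suc min_def)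
      finally show ?case .
    qed simp
    also have "\<dots> \<le> M ^ K * pochhammer A n"
      by (intro mult_right_mono power_increasing pochhammer_nonneg) (use M1 assms in auto)
    finally show "norm (pochhammer a n * pochhammer b n / pochhammer c n) \<le> M ^ K * pochhammer A n" .
  qed
qed

abbreviation gauss_term :: "complex \<Rightarrow> complex \<Rightarrow> complex \<Rightarrow> complex \<Rightarrow> nat \<Rightarrow> complex" where
  "gauss_term a b c z n \<equiv> pochhammer a n * pochhammer b n / pochhammer c n * z ^ n / fact n"

abbreviation kummer_term :: "'a \<Rightarrow> 'a \<Rightarrow> 'a \<Rightarrow> nat \<Rightarrow> 'a :: {real_normed_field, banach}" where
  "kummer_term a c z n \<equiv> pochhammer a n / pochhammer c n * z ^ n / fact n"

definition gauss_2F1 :: "complex \<Rightarrow> complex \<Rightarrow> complex \<Rightarrow> complex \<Rightarrow> complex" where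
  "gauss_2F1 a b c z = (\<Sum>n. gauss_term a b c z n)"

text \<open>The coefficients are compared with those of the binomial series of exponent
  \<open>- A\<close>, so \<open>A\<close> measures the growth at the point 1. The gap
  \<open>\<eta>\<close> above \<open>Re (a + b - c)\<close> is what allows a single \<open>C\<close>
  for the whole range of parameters.\<close>

lemma gauss_summable_bound:
  fixes R r A \<eta> :: real
  assumes "r > 0" "A > 0" "\<eta> > 0"
  obtains C where "C > 0"
    "\<And>a b c z n. \<lbrakk>norm a \<le> R; norm b \<le> R; Re c \<ge> r; Re (a + b - c) \<le> A - \<eta>\<rbrakk> \<Longrightarrow>
       norm (gauss_term a b c z n)
         \<le> C * (pochhammer A n * norm z ^ n / fact n)"
    "\<And>a b c z. \<lbrakk>norm a \<le> R; norm b \<le> R; Re c \<ge> r; Re (a + b - c) \<le> A - \<eta>; norm z < 1\<rbrakk> \<Longrightarrow>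
       norm (gauss_2F1 a b c z) \<le> C * (1 - norm z) powr (- A)"
proof -
  from gauss_coeff_bound[OF assms, of R] obtain C where C: "C > 0"
    "\<And>a b c n. \<lbrakk>norm a \<le> R; norm b \<le> R; Re c \<ge> r; Re (a + b - c) \<le> A - \<eta>\<rbrakk> \<Longrightarrow>
       norm (pochhammer a n * pochhammer b n / pochhammer c n) \<le> C * pochhammer A n"
    by metis
  have t: "norm (gauss_term a b c z n)
         \<le> C * (pochhammer A n * norm z ^ n / fact n)"
    if "norm a \<le> R" "norm b \<le> R" "Re c \<ge> r" "Re (a + b - c) \<le> A - \<eta>" for a b c z :: complex and n
  proof -
    have "norm (gauss_term a b c z n) =
      norm (pochhammer a n * pochhammer b n / pochhammer c n) * (norm z ^ n / fact n)"
      by (simp add: norm_mult norm_divide norm_power)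
    also have "\<dots> \<le> C * pochhammer A n * (norm z ^ n / fact n)"
      by (intro mult_right_mono C) (use that in auto)
    finally show ?thesis by simp
  qed
  have "norm (gauss_2F1 a b c z) \<le> C * (1 - norm z) powr (- A)"
    if "norm a \<le> R" "norm b \<le> R" "Re c \<ge> r" "Re (a + b - c) \<le> A - \<eta>" "norm z < 1"
    for a b c z :: complex
  proof -
    have s: "(\<lambda>n. C * (pochhammer A n * norm z ^ n / fact n)) sums (C * (1 - norm z) powr (- A))"
      by (intro sums_mult neg_binomial_sums_real) (use that in auto)
    have "norm (gauss_2F1 a b c z) \<le> (\<Sum>n. C * (pochhammer A n * norm z ^ n / fact n))"
      unfolding gauss_2F1_def using t[OF that(1-4)] s
      by (intro norm_suminf_le) (auto simp: sums_iff norm_mult norm_divide norm_power)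
    then show ?thesis using s by (simp add: sums_iff)
  qed
  with C(1) t show thesis by (rule that)
qed

lemma gauss_2F1_sums:
  assumes "Re c > 0" "norm z < 1"
  shows "(\<lambda>n. gauss_term a b c z n) sums gauss_2F1 a b c z"
    and "summable (\<lambda>n. norm (gauss_term a b c z n))"
proof -
  define R where "R = max (norm a) (norm b)"
  define A where "A = \<bar>Re (a + b - c)\<bar> + 1"
  obtain C where C: "\<And>a b c' z n. \<lbrakk>norm a \<le> R; norm b \<le> R; Re c' \<ge> Re c; Re (a + b - c') \<le> A - 1\<rbrakk> \<Longrightarrow>
       norm (gauss_term a b c' z n)
         \<le> C * (pochhammer A n * norm z ^ n / fact n)"
    by (rule gauss_summable_bound[of "Re c" A 1 R]) (use assms in \<open>auto simp: A_def\<close>)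
  have "summable (\<lambda>n. C * (pochhammer A n * norm z ^ n / fact n))"
    using sums_mult[OF neg_binomial_sums_real[of "norm z" A]] assms by (auto simp: sums_iff)
  then show s: "summable (\<lambda>n. norm (gauss_term a b c z n))"
    by (rule summable_comparison_test'[where N=0]) (use C[of a b c _ z] in \<open>auto simp: R_def A_def\<close>)
  from summable_norm_cancel[OF s] show
    "(\<lambda>n. gauss_term a b c z n) sums gauss_2F1 a b c z"
    unfolding gauss_2F1_def by (rule summable_sums)
qed

lemma holomorphic_suminf_majorant:
  fixes f :: "nat \<Rightarrow> complex \<Rightarrow> complex"
  assumes "open S" and hol: "\<And>n. f n holomorphic_on S"
    and dom: "\<And>s0. s0 \<in> S \<Longrightarrow> \<exists>d>0. \<exists>M. summable M \<and> cball s0 d \<subseteq> S \<and>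
               (\<forall>s\<in>cball s0 d. \<forall>n. norm (f n s) \<le> M n)"
  shows "(\<lambda>s. \<Sum>n. f n s) holomorphic_on S"
proof (rule holomorphic_uniform_sequence[OF \<open>open S\<close>, where f="\<lambda>n s. \<Sum>i<n. f i s"])
  show "(\<lambda>s. \<Sum>i<n. f i s) holomorphic_on S" for n
    by (intro holomorphic_intros hol)
  fix s0 assume "s0 \<in> S"
  from dom[OF this] obtain d M where d: "d > 0" "summable M" "cball s0 d \<subseteq> S"
    and b: "\<And>s n. s \<in> cball s0 d \<Longrightarrow> norm (f n s) \<le> M n" by blast
  have "uniform_limit (cball s0 d) (\<lambda>n s. \<Sum>i<n. f i s) (\<lambda>s. \<Sum>n. f n s) sequentially"
    by (rule Weierstrass_m_test[OF b d(2)])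
  with d show "\<exists>d>0. cball s0 d \<subseteq> S \<and>
      uniform_limit (cball s0 d) (\<lambda>n s. \<Sum>i<n. f i s) (\<lambda>s. \<Sum>n. f n s) sequentially" by blast
qed

lemma holomorphic_local_bounds:
  fixes f :: "complex \<Rightarrow> complex"
  assumes "open S" "f holomorphic_on S" "s0 \<in> S" "e > 0"
  shows "\<exists>d>0. cball s0 d \<subseteq> S \<and> (\<forall>s\<in>cball s0 d. norm (f s - f s0) \<le> e)"
proof -
  have "continuous_on S f" using assms holomorphic_on_imp_continuous_on by blast
  then obtain d1 where d1: "d1 > 0" "\<And>s. s \<in> S \<Longrightarrow> dist s s0 < d1 \<Longrightarrow> dist (f s) (f s0) < e"
    using assms unfolding continuous_on_iff by metis
  obtain d2 where d2: "d2 > 0" "cball s0 d2 \<subseteq> S"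
    using assms open_contains_cball by blast
  show ?thesis
  proof (intro exI[of _ "min d2 (d1 / 2)"] conjI ballI)
    show "cball s0 (min d2 (d1 / 2)) \<subseteq> S" using d2 by (auto simp: subset_iff)
    fix s assume s: "s \<in> cball s0 (min d2 (d1 / 2))"
    with d2 d1 have "s \<in> S" "dist s s0 < d1" by (auto simp: subset_iff dist_commute)
    from d1(2)[OF this] show "norm (f s - f s0) \<le> e" by (simp add: dist_norm)
  qed (use d1 d2 in auto)
qed

lemma Re_diff_le_norm: "norm (w - z) \<le> e \<Longrightarrow> \<bar>Re w - Re z\<bar> \<le> e"
  using abs_Re_le_cmod[of "w - z"] by simp

lemma norm_le_norm_add: "norm (w - z) \<le> e \<Longrightarrow> norm w \<le> norm z + (e :: real)"
  for w z :: complex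
  using norm_triangle_sub[of w z] by linarith

lemma holomorphic_on_gauss_2F1:
  assumes "open S" "a holomorphic_on S" "b holomorphic_on S" "c holomorphic_on S" "z holomorphic_on S"
    and pos: "\<And>s. s \<in> S \<Longrightarrow> Re (c s) > 0" and z1: "\<And>s. s \<in> S \<Longrightarrow> norm (z s) < 1"
  shows "(\<lambda>s. gauss_2F1 (a s) (b s) (c s) (z s)) holomorphic_on S"
  unfolding gauss_2F1_def
proof (rule holomorphic_suminf_majorant[OF \<open>open S\<close>])
  have nz: "pochhammer (c s) n \<noteq> 0" if "s \<in> S" for s n
  proof
    assume "pochhammer (c s) n = 0"
    then obtain k where "c s = - of_nat k" by (auto simp: pochhammer_eq_0_iff)
    with pos[OF that] show False by simp
  qed
  show "(\<lambda>s. gauss_term (a s) (b s) (c s) (z s) n)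
      holomorphic_on S" for n
    using nz by (auto simp: pochhammer_prod intro!: holomorphic_intros assms)
  fix s0 assume s0: "s0 \<in> S"
  \<comment> \<open>Half of each distance to the boundary: \<open>Re (c s)\<close> keeps half its
    value at \<open>s0\<close>, and \<open>norm (z s)\<close> stays below \<open>q\<close>, the
    midpoint between \<open>norm (z s0)\<close> and 1.\<close>
  define e where "e = min (Re (c s0) / 2) ((1 - norm (z s0)) / 2)"
  have e: "e > 0" "e \<le> Re (c s0) / 2" "e \<le> (1 - norm (z s0)) / 2"
    using pos[OF s0] z1[OF s0] unfolding e_def by (linarith | simp)+
  obtain d1 where d1: "d1 > 0" "cball s0 d1 \<subseteq> S" "\<And>s. s\<in>cball s0 d1 \<Longrightarrow> norm (a s - a s0) \<le> e"
    using holomorphic_local_bounds[OF assms(1,2) s0 e(1)] by blast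
  obtain d2 where d2: "d2 > 0" "cball s0 d2 \<subseteq> S" "\<And>s. s\<in>cball s0 d2 \<Longrightarrow> norm (b s - b s0) \<le> e"
    using holomorphic_local_bounds[OF assms(1,3) s0 e(1)] by blast
  obtain d3 where d3: "d3 > 0" "cball s0 d3 \<subseteq> S" "\<And>s. s\<in>cball s0 d3 \<Longrightarrow> norm (c s - c s0) \<le> e"
    using holomorphic_local_bounds[OF assms(1,4) s0 e(1)] by blast
  obtain d4 where d4: "d4 > 0" "cball s0 d4 \<subseteq> S" "\<And>s. s\<in>cball s0 d4 \<Longrightarrow> norm (z s - z s0) \<le> e"
    using holomorphic_local_bounds[OF assms(1,5) s0 e(1)] by blast
  define d where "d = min (min d1 d2) (min d3 d4)"
  define R where "R = max (norm (a s0)) (norm (b s0)) + e"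
  \<comment> \<open>\<open>3 * e\<close> covers the displacement of \<open>a + b - c\<close>, and 1
    is the gap required above it.\<close>
  define A where "A = \<bar>Re (a s0 + b s0 - c s0)\<bar> + 3 * e + 1"
  define q where "q = (1 + norm (z s0)) / 2"
  have q: "0 \<le> q" "q < 1" using z1[OF s0] by (auto simp: q_def add_nonneg_nonneg)
  obtain C where C: "C > 0" "\<And>a b c' z n. \<lbrakk>norm a \<le> R; norm b \<le> R; Re c' \<ge> Re (c s0) / 2; Re (a + b - c') \<le> A - 1\<rbrakk> \<Longrightarrow>
       norm (gauss_term a b c' z n)
         \<le> C * (pochhammer A n * norm z ^ n / fact n)"

    by (rule gauss_summable_bound[of "Re (c s0) / 2" A 1 R]) (use pos[OF s0] e in \<open>auto simp: A_def\<close>)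
  show "\<exists>d>0. \<exists>M. summable M \<and> cball s0 d \<subseteq> S \<and> (\<forall>s\<in>cball s0 d. \<forall>n.
    norm (gauss_term (a s) (b s) (c s) (z s) n) \<le> M n)"
  proof (intro exI[of _ d] exI[of _ "\<lambda>n. C * (pochhammer A n * q ^ n / fact n)"] conjI ballI allI)
    show "d > 0" using d1 d2 d3 d4 by (simp add: d_def)
    show "summable (\<lambda>n. C * (pochhammer A n * q ^ n / fact n))"
      using sums_mult[OF neg_binomial_sums_real[of q A]] q by (auto simp: sums_iff)
    show "cball s0 d \<subseteq> S" using d1(2) by (auto simp: d_def subset_iff)
    fix s n assume s: "s \<in> cball s0 d"
    have na: "norm (a s - a s0) \<le> e" by (rule d1(3)) (use s in \<open>simp add: d_def\<close>)
    have nb: "norm (b s - b s0) \<le> e" by (rule d2(3)) (use s in \<open>simp add: d_def\<close>)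
    have nc: "norm (c s - c s0) \<le> e" by (rule d3(3)) (use s in \<open>simp add: d_def\<close>)
    have nz: "norm (z s - z s0) \<le> e" by (rule d4(3)) (use s in \<open>simp add: d_def\<close>)
    have zq: "norm (z s) \<le> q" using norm_le_norm_add[OF nz] e(3) by (simp add: q_def field_simps)
    have "norm (gauss_term (a s) (b s) (c s) (z s) n)
       \<le> C * (pochhammer A n * norm (z s) ^ n / fact n)"
    proof (rule C(2))
      show "norm (a s) \<le> R" "norm (b s) \<le> R"
        using norm_le_norm_add[OF na] norm_le_norm_add[OF nb] by (auto simp: R_def)
      show "Re (c s) \<ge> Re (c s0) / 2" using Re_diff_le_norm[OF nc] e(2) by linarith
      show "Re (a s + b s - c s) \<le> A - 1"
        using Re_diff_le_norm[OF na] Re_diff_le_norm[OF nb] Re_diff_le_norm[OF nc]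
        by (simp add: A_def)
    qed
    also have "\<dots> \<le> C * (pochhammer A n * q ^ n / fact n)"
      using C(1) zq e(1) by (intro mult_left_mono divide_right_mono power_mono pochhammer_nonneg)
        (auto simp: A_def)
    finally show "norm (gauss_term (a s) (b s) (c s) (z s) n)
       \<le> C * (pochhammer A n * q ^ n / fact n)" .
  qed
qed

section \<open>Kummer's series: convergence and dependence on the parameters\<close>

lemma kummer_phi_term_bound:
  fixes a b z :: complex
  assumes "Re b > 0" "norm a \<le> R" "norm z \<le> Q"
  shows "norm (kummer_term a b z n) \<le> ((R / Re b + 1) * Q) ^ n / fact n"
proof -
  have R0: "R \<ge> 0" "Q \<ge> 0" using assms norm_ge_zero order_trans by blast+
  \<comment> \<open>Each new factor \<open>(a + n) / (b + n)\<close> has modulus at most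
    \<open>R / Re b + 1\<close>, so the quotient of Pochhammer symbols grows at most geometrically
    and an exponential series is a majorant.\<close>
  have "norm (pochhammer a n / pochhammer b n) \<le> (R / Re b + 1) ^ n"
  proof (induction n)
    case (Suc n)
    have "norm (a + of_nat n) \<le> R + n" using norm_triangle_ineq[of a "of_nat n"] assms by simp
    also have "\<dots> \<le> (R / Re b + 1) * (Re b + n)"
      using assms R0 by (simp add: field_simps)
    also have "\<dots> \<le> (R / Re b + 1) * norm (b + of_nat n)"
      using complex_Re_le_cmod[of "b + of_nat n"] R0 assms by (intro mult_left_mono) auto
    finally have *: "norm (a + of_nat n) \<le> (R / Re b + 1) * norm (b + of_nat n)" .
    have "norm (b + of_nat n) > 0"
      using complex_Re_le_cmod[of "b + of_nat n"] assms by auto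
    with * have "norm (a + of_nat n) / norm (b + of_nat n) \<le> R / Re b + 1"
      by (simp add: pos_divide_le_eq)
    with Suc have "norm (pochhammer a n / pochhammer b n) * (norm (a + of_nat n) / norm (b + of_nat n))
        \<le> (R / Re b + 1) ^ n * (R / Re b + 1)"
      using R0 assms by (intro mult_mono) auto
    then show ?case by (simp add: pochhammer_Suc norm_mult norm_divide mult.commute)
  qed simp
  then have "norm (pochhammer a n / pochhammer b n) * norm z ^ n \<le> (R / Re b + 1) ^ n * Q ^ n"
    using R0 assms by (intro mult_mono power_mono) auto
  then have "norm (pochhammer a n / pochhammer b n) * norm z ^ n / fact n \<le> (R / Re b + 1) ^ n * Q ^ n / fact n"
    by (rule divide_right_mono) simp
  then show ?thesis
    by (simp add: norm_mult norm_divide norm_power power_mult_distrib)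
qed

lemma summable_power_over_fact: "summable (\<lambda>n. (x :: real) ^ n / fact n)"
  using summable_exp[of x] by (simp add: field_simps)

lemma kummer_phi_sums:
  assumes "Re b > 0"
  shows "(\<lambda>n. kummer_term a b z n) sums kummer_phi a b z"
  unfolding kummer_phi_def
  by (rule summable_sums, rule summable_comparison_test'[where N=0, OF summable_power_over_fact
        kummer_phi_term_bound[OF assms order_refl order_refl]])

lemma holomorphic_on_kummer_phi:
  assumes "open S" "a holomorphic_on S" "z holomorphic_on S" "Re b > 0"
  shows "(\<lambda>s. kummer_phi (a s) b (z s)) holomorphic_on S"
  unfolding kummer_phi_def
proof (rule holomorphic_suminf_majorant[OF \<open>open S\<close>])
  have "pochhammer b n \<noteq> 0" for n
  proof
    assume "pochhammer b n = 0"
    then obtain k where "b = - of_nat k" by (auto simp: pochhammer_eq_0_iff)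
    with assms(4) show False by simp
  qed
  then show "(\<lambda>s. kummer_term (a s) b (z s) n) holomorphic_on S" for n
    by (auto simp: pochhammer_prod intro!: holomorphic_intros assms)
  fix s0 assume s0: "s0 \<in> S"
  obtain d1 where d1: "d1 > 0" "cball s0 d1 \<subseteq> S" "\<And>s. s\<in>cball s0 d1 \<Longrightarrow> norm (a s - a s0) \<le> 1"
    using holomorphic_local_bounds[OF assms(1,2) s0 zero_less_one] by blast
  obtain d2 where d2: "d2 > 0" "cball s0 d2 \<subseteq> S" "\<And>s. s\<in>cball s0 d2 \<Longrightarrow> norm (z s - z s0) \<le> 1"
    using holomorphic_local_bounds[OF assms(1,3) s0 zero_less_one] by blast
  show "\<exists>d>0. \<exists>M. summable M \<and> cball s0 d \<subseteq> S \<and> (\<forall>s\<in>cball s0 d. \<forall>n.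
      norm (kummer_term (a s) b (z s) n) \<le> M n)"
  proof (intro exI[of _ "min d1 d2"] conjI ballI allI
      exI[of _ "\<lambda>n. (((norm (a s0) + 1) / Re b + 1) * (norm (z s0) + 1)) ^ n / fact n"])
    fix s n assume "s \<in> cball s0 (min d1 d2)"
    then have "norm (a s - a s0) \<le> 1" "norm (z s - z s0) \<le> 1" using d1 d2 by auto
    then show "norm (kummer_term (a s) b (z s) n) \<le>
        (((norm (a s0) + 1) / Re b + 1) * (norm (z s0) + 1)) ^ n / fact n"
      by (intro kummer_phi_term_bound assms norm_le_norm_add)
  qed (use d1 d2 summable_power_over_fact in \<open>auto simp: subset_iff\<close>)
qed

section \<open>Euler's integral and the continuation of the Gauss series\<close>

text \<open>Provides the accumulation point for the identity theorem whenever two holomorphic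
  functions are known to agree on a real segment only.\<close>

lemma of_real_islimpt_interval:
  fixes x l u :: real
  assumes "l < x" "x < u"
  shows "(of_real x :: complex) islimpt (of_real ` {l<..<u})"
  unfolding islimpt_approachable
proof (intro allI impI)
  fix e :: real assume e: "e > 0"
  define d where "d = min (e / 2) ((u - x) / 2)"
  have d: "d > 0" "d \<le> e / 2" "d \<le> (u - x) / 2" using e assms unfolding d_def by (linarith | simp)+
  have "dist (of_real (x + d) :: complex) (of_real x) = d"
    using d by (simp add: dist_norm flip: of_real_diff)
  moreover have "x + d \<in> {l<..<u}" using d assms by (auto simp: field_simps)
  ultimately show "\<exists>x'\<in>of_real ` {l<..<u}. x' \<noteq> (of_real x :: complex) \<and> dist x' (of_real x) < e"
    using d e by (intro bexI[OF _ imageI[of "x + d"]]) auto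
qed

section \<open>The beta integral with complex exponents\<close>

lemma norm_of_real_powr:
  "t \<ge> 0 \<Longrightarrow> norm (of_real t powr (z :: complex)) = t powr Re z"
  by (simp add: norm_powr_real_powr)

lemma set_borel_measurable_lborel_continuous:
  fixes f :: "real \<Rightarrow> complex"
  assumes "S \<in> sets borel" "continuous_on S f"
  shows "set_borel_measurable lborel S f"
  using borel_measurable_continuous_on_indicator[OF assms(1,2)]
  by (simp add: set_borel_measurable_def)

lemma continuous_on_of_real_powr:
  assumes "continuous_on S f" "\<And>t. t \<in> S \<Longrightarrow> f t > (0 :: real)"
  shows "continuous_on S (\<lambda>t. of_real (f t) powr (z :: complex))"
  by (intro continuous_on_powr_complex continuous_intros assms)
     (use assms in \<open>force simp: less_imp_le\<close>)+

lemma continuous_on_powr_slit: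
  fixes w :: complex
  assumes "continuous_on S f" "\<And>s. s \<in> S \<Longrightarrow> f s \<notin> \<real>\<^sub>\<le>\<^sub>0"
  shows "continuous_on S (\<lambda>s. f s powr w)"
proof -
  have "continuous_on (- \<real>\<^sub>\<le>\<^sub>0) (\<lambda>u. u powr w)"
    by (intro holomorphic_on_imp_continuous_on holomorphic_intros) auto
  then show ?thesis by (rule continuous_on_compose2[OF _ assms(1)]) (use assms(2) in auto)
qed

abbreviation beta_kernel :: "complex \<Rightarrow> complex \<Rightarrow> real \<Rightarrow> complex" where
  "beta_kernel a b t \<equiv> of_real t powr (a - 1) * of_real (1 - t) powr (b - 1)"

abbreviation euler_kernel :: "complex \<Rightarrow> complex \<Rightarrow> complex \<Rightarrow> complex \<Rightarrow> real \<Rightarrow> complex" where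
  "euler_kernel a b d z s \<equiv> beta_kernel b d s * (1 - z * of_real s) powr (- a)"

lemma beta_kernel_le:
  assumes "t \<in> {0<..<1}" "u \<le> Re a" "v \<le> Re b"
  shows "norm (beta_kernel a b t)
           \<le> t powr (u - 1) * (1 - t) powr (v - 1)"
proof -
  have "t powr (Re a - 1) \<le> t powr (u - 1)" "(1 - t) powr (Re b - 1) \<le> (1 - t) powr (v - 1)"
    using assms by (auto intro!: powr_mono')
  then show ?thesis
    using assms by (simp add: norm_mult norm_of_real_powr mult_mono del: of_real_diff)
qed

lemma beta_kernel_integrable_real:
  assumes "u > 0" "v > (0 :: real)"
  shows "set_integrable lborel {0<..<1} (\<lambda>t. t powr (u - 1) * (1 - t) powr (v - 1))"
  by (rule set_integrable_subset[OF integrable_Beta[OF assms]]) auto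

lemma beta_kernel_integral_real:
  assumes "u > 0" "v > (0 :: real)"
  shows "(LINT t:{0<..<1}|lborel. t powr (u - 1) * (1 - t) powr (v - 1)) = Beta u v"
proof -
  have "(LINT t:{0<..<1}|lborel. t powr (u - 1) * (1 - t) powr (v - 1)) =
        (LINT t:{0..1}|lborel. t powr (u - 1) * (1 - t) powr (v - 1))"
    unfolding set_lebesgue_integral_def
    by (rule integral_cong_AE) (use AE_lborel_singleton[of 0] AE_lborel_singleton[of 1] in
          \<open>auto split: split_indicator\<close>)
  also have "\<dots> = Beta u v"
    using set_borel_integral_eq_integral(2)[OF integrable_Beta[OF assms]]
      integral_unique[OF has_integral_Beta_real[OF assms]] by simp
  finally show ?thesis .
qed

lemma beta_kernel_measurable:
  fixes a b :: complex
  shows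
  "set_borel_measurable lborel {0<..<1}
     (\<lambda>t. beta_kernel a b t)"
  by (intro set_borel_measurable_lborel_continuous continuous_on_mult continuous_on_of_real_powr
      continuous_intros) auto

lemma beta_kernel_integrable:
  assumes "Re a > 0" "Re b > 0"
  shows "set_integrable lborel {0<..<1} (\<lambda>t. beta_kernel a b t)"
proof (rule set_integrable_bound[OF beta_kernel_integrable_real[OF assms] beta_kernel_measurable])
  show "AE t in lborel. t \<in> {0<..<1} \<longrightarrow>
      norm (beta_kernel a b t)
        \<le> norm (t powr (Re a - 1) * (1 - t) powr (Re b - 1))"
    using beta_kernel_le[OF _ order_refl order_refl] by (intro AE_I2) (simp add: abs_mult)
qed

lemma holomorphic_on_beta_integral:
  assumes "open S" "a holomorphic_on S" "b holomorphic_on S"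
    and pos: "\<And>s. s \<in> S \<Longrightarrow> Re (a s) > 0" "\<And>s. s \<in> S \<Longrightarrow> Re (b s) > 0"
  shows "(\<lambda>s. LINT t:{0<..<1}|lborel. beta_kernel (a s) (b s) t)
           holomorphic_on S"
proof (rule holomorphic_on_set_integral[OF \<open>open S\<close> beta_kernel_measurable])
  show "(\<lambda>s. beta_kernel (a s) (b s) t) holomorphic_on S"
    if "t \<in> {0<..<1}" for t
    using that unfolding powr_def by (auto intro!: holomorphic_intros assms simp del: of_real_diff)
  fix s0 assume s0: "s0 \<in> S"
  define e where "e = min (Re (a s0)) (Re (b s0)) / 2"
  have e: "e > 0" "e \<le> Re (a s0) / 2" "e \<le> Re (b s0) / 2" using pos[OF s0] by (auto simp: e_def)
  obtain d1 where d1: "d1 > 0" "\<And>s. s\<in>cball s0 d1 \<Longrightarrow> norm (a s - a s0) \<le> e"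
    using holomorphic_local_bounds[OF assms(1,2) s0 e(1)] by blast
  obtain d2 where d2: "d2 > 0" "\<And>s. s\<in>cball s0 d2 \<Longrightarrow> norm (b s - b s0) \<le> e"
    using holomorphic_local_bounds[OF assms(1,3) s0 e(1)] by blast
  show "\<exists>d>0. \<exists>G. set_integrable lborel {0<..<1} G \<and> (\<forall>s\<in>ball s0 d \<inter> S. \<forall>t\<in>{0<..<1}.
     norm (beta_kernel (a s) (b s) t) \<le> (G t :: real))"
  proof (intro exI[of _ "min d1 d2"] exI conjI ballI)
    show "set_integrable lborel {0<..<1} (\<lambda>t. t powr (e - 1) * (1 - t) powr (e - 1))"
      by (rule beta_kernel_integrable_real[OF e(1) e(1)])
    fix s t assume s: "s \<in> ball s0 (min d1 d2) \<inter> S" and t: "t \<in> {0<..<1::real}"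
    have "norm (a s - a s0) \<le> e" "norm (b s - b s0) \<le> e" using s d1 d2 by auto
    then have "e \<le> Re (a s)" "e \<le> Re (b s)"
      using e Re_diff_le_norm[of "a s" "a s0" e] Re_diff_le_norm[of "b s" "b s0" e] by auto
    then show "norm (beta_kernel (a s) (b s) t)
        \<le> t powr (e - 1) * (1 - t) powr (e - 1)"
      by (rule beta_kernel_le[OF t])
  qed (use d1 d2 in auto)
qed

lemma Re_pos_not_nonpos_Int: "Re z > 0 \<Longrightarrow> z \<notin> \<int>\<^sub>\<le>\<^sub>0"
  by (auto elim!: nonpos_Ints_cases)

lemma holomorphic_on_Beta':
  assumes "a holomorphic_on S" "b holomorphic_on S"
    and "\<And>s. s \<in> S \<Longrightarrow> Re (a s) > 0" "\<And>s. s \<in> S \<Longrightarrow> Re (b s) > 0"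
  shows "(\<lambda>s. Beta (a s) (b s)) holomorphic_on S"
  by (rule holomorphic_Beta) (use assms Re_pos_not_nonpos_Int in auto)

lemma open_Re_gt_0: "open {z. Re z > 0}" and connected_Re_gt_0: "connected {z. Re z > 0}"
  by (auto simp: open_halfspace_Re_gt convex_connected convex_halfspace_Re_gt)

lemma holomorphic_eq_halfplane:
  assumes "f holomorphic_on {z. Re z > 0}" "g holomorphic_on {z. Re z > 0}"
    and "\<And>x. x > l \<Longrightarrow> f (of_real x) = g (of_real x)" "l \<ge> 0" and "Re z > 0"
  shows "f z = g z"
proof -
  have "f z - g z = 0"
  proof (rule analytic_continuation[of "\<lambda>z. f z - g z", OF _ open_Re_gt_0 connected_Re_gt_0 _ _
        of_real_islimpt_interval[of l "l + 1" "l + 2"]])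
    show "(\<lambda>z. f z - g z) holomorphic_on {z. Re z > 0}"
      by (intro holomorphic_intros assms)
  qed (use assms in auto)
  then show ?thesis by simp
qed

text \<open>The real case is carried over by the identity theorem in the right half-plane, first in
  \<open>a\<close> with \<open>b\<close> real, then in \<open>b\<close> with \<open>a\<close>
  complex.\<close>

lemma beta_kernel_integral:
  assumes "Re a > 0" "Re b > 0"
  shows "(LINT t:{0<..<1}|lborel. beta_kernel a b t) = Beta a b"
proof -
  have base: "(LINT t:{0<..<1}|lborel. beta_kernel (of_real u) (of_real v) t)
     = (Beta (of_real u) (of_real v) :: complex)" if "u > 0" "v > 0" for u v :: real
  proof -
    have p: "complex_of_real t powr (of_real u - 1) = of_real (t powr (u - 1))" if "t \<ge> 0" for t u :: real
      using powr_of_real[OF that, of "u - 1"] by simp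
    have "(LINT t:{0<..<1}|lborel. beta_kernel (of_real u) (of_real v) t) =
        (LINT t:{0<..<1}|lborel. complex_of_real (t powr (u - 1) * (1 - t) powr (v - 1)))"
      by (intro set_lebesgue_integral_cong)
        (simp_all add: p del: of_real_diff)
    also have "\<dots> = of_real (LINT t:{0<..<1}|lborel. t powr (u - 1) * (1 - t) powr (v - 1))"
      by (rule set_integral_complex_of_real)
    also have "\<dots> = Beta (of_real u) (of_real v)"
      using that by (simp add: beta_kernel_integral_real Beta_def Gamma_complex_of_real
          flip: of_real_add)
    finally show ?thesis .
  qed
  have base2: "(LINT t:{0<..<1}|lborel. beta_kernel a (of_real v) t)
     = Beta a (of_real v)" if "v > 0" for v :: real
  proof (rule holomorphic_eq_halfplane[where l=0 and z=a and
        f="\<lambda>a. LINT t:{0<..<1}|lborel. beta_kernel a (of_real v) t"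
        and g="\<lambda>a. Beta a (of_real v)"])
    show "(\<lambda>a. LINT t:{0<..<1}|lborel. beta_kernel a (of_real v) t)
        holomorphic_on {z. Re z > 0}"
      by (rule holomorphic_on_beta_integral[OF open_Re_gt_0, where a="\<lambda>a. a" and b="\<lambda>_. of_real v"])
         (use that in \<open>auto intro!: holomorphic_intros\<close>)
    show "(\<lambda>a. Beta a (of_real v)) holomorphic_on {z. Re z > 0}"
      by (rule holomorphic_on_Beta') (use that in \<open>auto intro!: holomorphic_intros\<close>)
  qed (use base[OF _ that] assms(1) in auto)
  show ?thesis
  proof (rule holomorphic_eq_halfplane[where l=0 and z=b and
        f="\<lambda>b. LINT t:{0<..<1}|lborel. beta_kernel a b t"
        and g="\<lambda>b. Beta a b"])
    show "(\<lambda>b. LINT t:{0<..<1}|lborel. beta_kernel a b t)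
        holomorphic_on {z. Re z > 0}"
      by (rule holomorphic_on_beta_integral[OF open_Re_gt_0, where a="\<lambda>_. a" and b="\<lambda>b. b"])
         (use assms in \<open>auto intro!: holomorphic_intros\<close>)
    show "(\<lambda>b. Beta a b) holomorphic_on {z. Re z > 0}"
      by (rule holomorphic_on_Beta') (use assms in \<open>auto intro!: holomorphic_intros\<close>)
  qed (use base2 assms(2) in auto)
qed

lemma Beta_add_of_nat:
  assumes "Re a > 0" "Re b > 0"
  shows "Beta (a + of_nat n) b = Beta a b * pochhammer a n / pochhammer (a + b) n"
proof -
  have "Re (a + b) > 0" using assms by simp
  with assms show ?thesis
    by (simp add: pochhammer_Gamma Re_pos_not_nonpos_Int Gamma_eq_zero_iff Beta_def add_ac)
qed

text \<open>For \<open>b = c = 1\<close> the Gauss series is the binomial series, so its absolute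
  convergence is a special case.\<close>

lemma summable_norm_neg_binomial:
  fixes z :: complex
  assumes "norm z < 1"
  shows "summable (\<lambda>n. norm (pochhammer a n * z ^ n / fact n))"
proof -
  have "pochhammer (1::complex) n \<noteq> 0" for n by (simp add: pochhammer_fact[symmetric])
  then show ?thesis using gauss_2F1_sums(2)[of 1 z a 1] assms by simp
qed

text \<open>The binomial series of \<open>(1 - z * s) powr (- a)\<close> is integrated termwise; the
  n-th moment of the beta kernel is \<open>Beta (b + n) d\<close>. Since
  \<open>s ^ n \<le> 1\<close>, the integrals of the absolute values are dominated by a fixed
  multiple of the summable \<open>norm (c n)\<close>.\<close>

lemma euler_integral_series:
  assumes b: "Re b > 0" and d: "Re d > 0" and z: "norm z < 1"
  shows "(LINT s:{0<..<1}|lborel. euler_kernel a b d z s) = Beta b d * gauss_2F1 a b (b + d) z"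
proof -
  define k where "k = (\<lambda>s::real. beta_kernel b d s :: complex)"
  define c where "c = (\<lambda>n. pochhammer a n * z ^ n / fact n)"
  have kn: "k s * of_real s ^ n = of_real s powr ((b + of_nat n) - 1) * of_real (1 - s) powr (d - 1)"
    if "s \<in> {0<..<1}" for s n
    using that by (simp add: k_def powr_add powr_nat add_diff_eq[symmetric] powr_diff)
  have kint: "set_integrable lborel {0<..<1} (\<lambda>s. k s * of_real s ^ n)" for n
    using beta_kernel_integrable[of "b + of_nat n" d] b d
    by (subst set_integrable_cong[OF refl refl kn]) auto
  have kval: "(LINT s:{0<..<1}|lborel. k s * of_real s ^ n) = Beta (b + of_nat n) d" for n
    using beta_kernel_integral[of "b + of_nat n" d] b d
    by (subst set_lebesgue_integral_cong[of _ lborel, OF _ allI[OF impI[OF kn]]]) auto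
  have sc: "summable (\<lambda>n. norm (c n))" unfolding c_def by (rule summable_norm_neg_binomial[OF z])
  define f where "f = (\<lambda>n s. indicator {0<..<1} s *\<^sub>R (c n * (k s * of_real s ^ n)))"
  have fint: "integrable lborel (f n)" for n
    using set_integrable_mult_right[OF kint[of n], of "c n"] by (simp add: f_def set_integrable_def)
  have k0: "integrable lborel (\<lambda>s. norm (indicator {0<..<1} s *\<^sub>R k s))"
    by (rule integrable_norm) (use kint[of 0] in \<open>simp add: set_integrable_def\<close>)
  have nf: "norm (f n s) \<le> norm (c n) * norm (indicator {0<..<1} s *\<^sub>R k s)" for n s
  proof -
    have "norm (k s) * s ^ n \<le> norm (k s) * 1" if "s \<in> {0<..<1}"
      using that by (intro mult_left_mono power_le_one) auto
    then show ?thesis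
      by (auto simp: f_def norm_mult norm_power mult_left_mono split: split_indicator)
  qed
  have "(\<lambda>n. integral\<^sup>L lborel (f n)) sums (\<integral>s. (\<Sum>n. f n s) \<partial>lborel)"
  proof (rule sums_integral[OF fint])
    show "AE s in lborel. summable (\<lambda>n. norm (f n s))"
      by (intro AE_I2 summable_comparison_test'[where N=0, OF summable_mult2[OF sc]])
        (use nf in auto)
    show "summable (\<lambda>n. \<integral>s. norm (f n s) \<partial>lborel)"
    proof (rule summable_comparison_test'[where N=0, OF summable_mult2[OF sc]])
      show "norm (\<integral>s. norm (f n s) \<partial>lborel) \<le> norm (c n) *
          (\<integral>s. norm (indicator {0<..<1} s *\<^sub>R k s) \<partial>lborel)" for n
        using integral_mono[OF integrable_norm[OF fint] integrable_mult_right[OF k0, of "norm (c n)"] nf]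
        by simp
    qed
  qed
  moreover have "integral\<^sup>L lborel (f n) = Beta b d * (gauss_term a b (b + d) z n)" for n
  proof -
    have "integral\<^sup>L lborel (f n) = c n * Beta (b + of_nat n) d"
    proof -
      have "integral\<^sup>L lborel (f n) = (LINT s:{0<..<1}|lborel. c n * (k s * of_real s ^ n))"
        by (simp only: f_def set_lebesgue_integral_def)
      also have "\<dots> = c n * (LINT s:{0<..<1}|lborel. k s * of_real s ^ n)"
        by (rule set_integral_mult_right)
      finally show ?thesis by (simp only: kval)
    qed
    then show ?thesis using b d by (simp add: Beta_add_of_nat c_def mult_ac)
  qed
  moreover have "(\<integral>s. (\<Sum>n. f n s) \<partial>lborel) =
     (LINT s:{0<..<1}|lborel. euler_kernel a b d z s)"
    unfolding set_lebesgue_integral_def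
  proof (rule Bochner_Integration.integral_cong[OF refl])
    fix s :: real
    show "(\<Sum>n. f n s) = indicat_real {0<..<1} s *\<^sub>R (euler_kernel a b d z s)"
    proof (cases "s \<in> {0<..<1}")
      case True
      have "norm z * s \<le> norm z * 1" using True by (intro mult_left_mono) auto
      then have "norm (z * of_real s) < 1" using z True by (simp add: norm_mult)
      from neg_binomial_sums[OF this, of a]
      have "(\<lambda>n. k s * (pochhammer a n * (z * of_real s) ^ n / fact n)) sums (k s * (1 - z * of_real s) powr (- a))"
        by (rule sums_mult)
      moreover have "f n s = k s * (pochhammer a n * (z * of_real s) ^ n / fact n)" for n
        using True by (simp add: f_def c_def power_mult_distrib)
      ultimately show ?thesis using True by (simp add: sums_iff k_def)
    qed (simp add: f_def)
  qed
  ultimately have "(\<lambda>n. Beta b d * (gauss_term a b (b + d) z n))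
      sums (LINT s:{0<..<1}|lborel. euler_kernel a b d z s)" by simp
  moreover have "(\<lambda>n. Beta b d * (gauss_term a b (b + d) z n))
      sums (Beta b d * gauss_2F1 a b (b + d) z)"
    by (intro sums_mult gauss_2F1_sums) (use b d z in auto)
  ultimately show ?thesis by (rule sums_unique2)
qed

section \<open>Existence of the continuation to the cut plane\<close>

lemma open_cut_plane: "open cut_plane"
proof -
  have "closed ((of_real :: real \<Rightarrow> complex) ` {1..})"
  proof -
    have "(of_real :: real \<Rightarrow> complex) ` {1..} = {z. Im z = 0} \<inter> {z. Re z \<ge> 1}"
      by (auto simp: complex_eq_iff image_iff)
    moreover have "closed {z. Im z = 0}" by (intro closed_Collect_eq continuous_intros)
    ultimately show ?thesis by (simp add: closed_Int closed_halfspace_Re_ge)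
  qed
  then show ?thesis by (simp add: cut_plane_def open_Compl)
qed

text \<open>A nonpositive value \<open>r\<close> would make \<open>z\<close> equal to
  \<open>(1 - r) / s \<ge> 1\<close>, a point of the cut. Hence the principal power in Euler's
  integrand is holomorphic in \<open>z\<close> on the entire cut plane.\<close>

lemma cut_plane_one_minus:
  assumes "z \<in> cut_plane" "0 \<le> s" "s \<le> (1::real)"
  shows "1 - z * of_real s \<notin> \<real>\<^sub>\<le>\<^sub>0"
proof
  assume "1 - z * of_real s \<in> \<real>\<^sub>\<le>\<^sub>0"
  then obtain r where r: "r \<le> 0" "1 - z * of_real s = of_real r" by (auto elim!: nonpos_Reals_cases)
  then have zs: "z * of_real s = of_real (1 - r)" by (simp add: algebra_simps)
  then have s: "s > 0" using assms r(1) by (cases "s = 0") auto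
  then have "z = of_real ((1 - r) / s)" using zs by (simp add: field_simps)
  moreover have "(1 - r) / s \<ge> 1" using s assms r(1) by (simp add: field_simps)
  ultimately have "z \<in> of_real ` {1..}" by blast
  then show False using assms(1) by (simp add: cut_plane_def)
qed

lemma ball_subset_cut_plane: "ball 0 1 \<subseteq> cut_plane"
  by (auto simp: cut_plane_def)

lemma holomorphic_on_euler_integral:
  assumes "Re b > 0" "Re d > 0"
  shows "(\<lambda>z. LINT s:{0<..<1}|lborel. euler_kernel a b d z s) holomorphic_on cut_plane"
proof (rule holomorphic_on_set_integral[OF open_cut_plane])
  show "set_borel_measurable lborel {0<..<1} (\<lambda>s. euler_kernel a b d z s)" if z: "z \<in> cut_plane" for z
  proof (intro set_borel_measurable_lborel_continuous continuous_on_mult)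
    show "continuous_on {0<..<1} (\<lambda>s. (1 - z * of_real s) powr (- a))"
      by (rule continuous_on_powr_slit) (use cut_plane_one_minus[OF z] in \<open>auto intro!: continuous_intros\<close>)
  qed (auto intro!: continuous_on_of_real_powr continuous_intros)
  show "(\<lambda>z. euler_kernel a b d z s)
      holomorphic_on cut_plane" if s: "s \<in> {0<..<1}" for s
  proof (intro holomorphic_on_mult holomorphic_on_const holomorphic_on_powr)
    show "1 - z * of_real s \<notin> \<real>\<^sub>\<le>\<^sub>0" if "z \<in> cut_plane" for z
      using cut_plane_one_minus[OF that] s by auto
  qed (auto intro!: holomorphic_intros)
  fix z0 assume "z0 \<in> cut_plane"
  then obtain e where e: "e > 0" "cball z0 e \<subseteq> cut_plane"
    using open_cut_plane open_contains_cball by blast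
  \<comment> \<open>With the closed interval the domain is compact, so this factor is bounded
    uniformly up to the endpoints, and the beta kernel alone carries the endpoint
    singularities.\<close>
  have "continuous_on (cball z0 e \<times> {0..1::real}) (\<lambda>x. (1 - fst x * of_real (snd x)) powr (- a))"
  proof (rule continuous_on_powr_slit)
    show "continuous_on (cball z0 e \<times> {0..1::real}) (\<lambda>x. 1 - fst x * of_real (snd x))"
      by (intro continuous_intros)
    show "1 - fst x * of_real (snd x) \<notin> \<real>\<^sub>\<le>\<^sub>0" if "x \<in> cball z0 e \<times> {0..1::real}" for x
      using that e(2) by (intro cut_plane_one_minus) auto
  qed
  then have "bounded ((\<lambda>x. (1 - fst x * of_real (snd x)) powr (- a)) ` (cball z0 e \<times> {0..1::real}))"
    by (intro compact_imp_bounded compact_continuous_image compact_Times) auto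
  then obtain B where B: "\<And>z s. z \<in> cball z0 e \<Longrightarrow> s \<in> {0..1::real} \<Longrightarrow> norm ((1 - z * of_real s) powr (- a)) \<le> B"
    unfolding bounded_iff by force
  have B0: "B \<ge> 0" using B[of z0 0] e(1) norm_ge_zero order_trans by fastforce
  show "\<exists>e>0. \<exists>G. set_integrable lborel {0<..<1} G \<and> (\<forall>z\<in>ball z0 e \<inter> cut_plane. \<forall>s\<in>{0<..<1}.
     norm (euler_kernel a b d z s) \<le> (G s :: real))"
  proof (intro exI[of _ e] exI[of _ "\<lambda>s. s powr (Re b - 1) * (1 - s) powr (Re d - 1) * B"] conjI ballI)
    show "set_integrable lborel {0<..<1} (\<lambda>s. s powr (Re b - 1) * (1 - s) powr (Re d - 1) * B)"
      by (intro set_integrable_mult_left beta_kernel_integrable_real assms)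
    fix z s assume zs: "z \<in> ball z0 e \<inter> cut_plane" "s \<in> {0<..<1::real}"
    show "norm (euler_kernel a b d z s)
        \<le> s powr (Re b - 1) * (1 - s) powr (Re d - 1) * B"
      unfolding norm_mult[of _ "(1 - z * of_real s) powr (- a)"]
      using zs by (intro mult_mono beta_kernel_le B) auto
  qed (use e in auto)
qed

text \<open>The property by which the choice operator selects \<open>hyp2F1\<close>; exhibiting any
  one witness transfers it to the chosen function.\<close>

definition continues_2F1 :: "complex \<Rightarrow> complex \<Rightarrow> complex \<Rightarrow> (complex \<Rightarrow> complex) \<Rightarrow> bool" where
  "continues_2F1 a b c F \<longleftrightarrow> F holomorphic_on cut_plane \<and> (\<forall>z\<in>ball 0 1. F z = gauss_2F1 a b c z)"

lemma continues_2F1_euler: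
  assumes "Re b > 0" "Re c > Re b"
  shows "\<exists>F. continues_2F1 a b c F"
proof -
  define F where "F = (\<lambda>z. LINT s:{0<..<1}|lborel. of_real s powr (b - 1) * of_real (1 - s) powr ((c - b) - 1) *
            (1 - z * of_real s) powr (- a))"
  have B: "Beta b (c - b) \<noteq> 0"
    using assms by (simp add: Beta_def Gamma_eq_zero_iff Re_pos_not_nonpos_Int)
  have "continues_2F1 a b c (\<lambda>z. F z / Beta b (c - b))"
    unfolding continues_2F1_def
  proof (intro conjI ballI)
    show "(\<lambda>z. F z / Beta b (c - b)) holomorphic_on cut_plane"
      unfolding F_def using assms B by (intro holomorphic_intros holomorphic_on_euler_integral) auto
    show "F z / Beta b (c - b) = gauss_2F1 a b c z" if "z \<in> ball 0 1" for z
      unfolding F_def using euler_integral_series[of b "c - b" z a] assms B that by simp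
  qed
  then show ?thesis by blast
qed

lemma pochhammer_neq_0: "Re c > 0 \<Longrightarrow> pochhammer c n \<noteq> 0" for c :: complex
  by (auto simp: pochhammer_eq_0_iff)

text \<open>Applying \<open>z * d/dz\<close> multiplies the n-th coefficient by \<open>n\<close>, so
  differential relations between continuations reduce to identities between coefficients, checked in
  the unit disc.\<close>

lemma continues_2F1_theta:
  assumes F: "continues_2F1 a b c F" and c: "Re c > 0" and z: "z \<in> ball 0 1"
  shows "(\<lambda>n. pochhammer a n * pochhammer b n / pochhammer c n / fact n * z ^ n) sums F z"
    and "(\<lambda>n. of_nat n * (pochhammer a n * pochhammer b n / pochhammer c n / fact n) * z ^ n) sums (z * deriv F z)"
proof -
  define k where "k = (\<lambda>n. pochhammer a n * pochhammer b n / pochhammer c n / fact n)"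
  have s: "(\<lambda>n. k n * w ^ n) sums F w" if "norm w < 1" for w
    using gauss_2F1_sums(1)[OF c that, of a b] F that by (simp add: continues_2F1_def k_def mult.commute)
  then show "(\<lambda>n. pochhammer a n * pochhammer b n / pochhammer c n / fact n * z ^ n) sums F z"
    using z by (simp add: k_def)
  have "(F has_field_derivative deriv F z) (at z)"
    using F z ball_subset_cut_plane open_cut_plane by (metis continues_2F1_def holomorphic_derivI subsetD)
  then have "(\<lambda>n. diffs k n * z ^ n) sums deriv F z"
    using z by (intro termdiffs_sums_strong[where K=1, OF s]) auto
  then have "(\<lambda>n. z * (diffs k n * z ^ n)) sums (z * deriv F z)" by (rule sums_mult)
  moreover have "z * (diffs k n * z ^ n) = of_nat (Suc n) * k (Suc n) * z ^ Suc n" for n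
    by (simp add: diffs_def)
  ultimately have "(\<lambda>n. of_nat (Suc n) * k (Suc n) * z ^ Suc n) sums (z * deriv F z)" by simp
  then have "(\<lambda>n. of_nat n * k n * z ^ n) sums (z * deriv F z)"
    by (subst (asm) sums_Suc_iff) simp
  then show "(\<lambda>n. of_nat n * (pochhammer a n * pochhammer b n / pochhammer c n / fact n) * z ^ n) sums (z * deriv F z)"
    by (simp add: k_def)
qed

text \<open>
  Euler's integral needs \<open>0 < Re b < Re c\<close>. The two differential relations below lower \<open>c\<close> and \<open>b\<close>
  by one, so the remaining parameters are reached from large \<open>b\<close> and \<open>c\<close>.
\<close>

lemma continues_2F1_lower_c:
  assumes F: "continues_2F1 a b (c + 1) F" and c: "Re c > 0"
  shows "continues_2F1 a b c (\<lambda>z. F z + z * deriv F z / c)"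
  unfolding continues_2F1_def
proof (intro conjI ballI)
  show "(\<lambda>z. F z + z * deriv F z / c) holomorphic_on cut_plane"
    using F c open_cut_plane unfolding continues_2F1_def by (intro holomorphic_intros) auto
  fix z :: complex assume z: "z \<in> ball 0 1"
  have c1: "Re (c + 1) > 0" using c by simp
  have c0: "c \<noteq> 0" and cn: "c + of_nat n \<noteq> 0" for n using c by (auto simp: complex_eq_iff)
  have "(\<lambda>n. pochhammer a n * pochhammer b n / pochhammer (c+1) n / fact n * z ^ n +
       of_nat n * (pochhammer a n * pochhammer b n / pochhammer (c+1) n / fact n) * z ^ n / c)
      sums (F z + z * deriv F z / c)"
    by (intro sums_add sums_divide continues_2F1_theta[OF F c1 z])
  moreover have "pochhammer a n * pochhammer b n / pochhammer (c+1) n / fact n * z ^ n +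
       of_nat n * (pochhammer a n * pochhammer b n / pochhammer (c+1) n / fact n) * z ^ n / c =
       gauss_term a b c z n" for n
  proof -
    \<comment> \<open>Splitting off either the first or the last factor of
      \<open>pochhammer c (n + 1)\<close>. As a result \<open>1 + n / c\<close> turns
      \<open>1 / pochhammer (c + 1) n\<close> into \<open>1 / pochhammer c n\<close>.\<close>
    have p: "pochhammer (c + 1) n = pochhammer c n * (c + of_nat n) / c"
      using c0 by (metis nonzero_mult_div_cancel_left pochhammer_Suc pochhammer_rec)
    show ?thesis using c0 cn[of n] pochhammer_neq_0[OF c, of n]
      unfolding p by (simp add: divide_simps) (simp add: algebra_simps)
  qed
  ultimately show "F z + z * deriv F z / c = gauss_2F1 a b c z"
    by (simp add: sums_iff gauss_2F1_def)
qed

lemma continues_2F1_lower_b: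
  assumes F: "continues_2F1 a b c F" and c: "Re c > 0" and bc: "c \<noteq> b"
  shows "continues_2F1 a (b - 1) c (\<lambda>z. (z * deriv F z - z * (z * deriv F z + a * F z) + (c - b) * F z) / (c - b))"
  unfolding continues_2F1_def
proof (intro conjI ballI)
  show "(\<lambda>z. (z * deriv F z - z * (z * deriv F z + a * F z) + (c - b) * F z) / (c - b)) holomorphic_on cut_plane"
    using F bc open_cut_plane unfolding continues_2F1_def by (intro holomorphic_intros) auto
  fix z :: complex assume z: "z \<in> ball 0 1"
  \<comment> \<open>The function is Gauss's contiguous relation
    \<open>(c - b) F(b - 1) = z (1 - z) F' + (c - b - a z) F\<close>, arranged so that
    \<open>F\<close>, \<open>z F'\<close> and \<open>z (z F' + a F)\<close> each have a known power
    series.\<close>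
  define k where "k = (\<lambda>n. pochhammer a n * pochhammer b n / pochhammer c n / fact n)"
  have s1: "(\<lambda>n. k n * z ^ n) sums F z" and s2: "(\<lambda>n. of_nat n * k n * z ^ n) sums (z * deriv F z)"
    using continues_2F1_theta[OF F c z] by (simp_all add: k_def)
  have "(\<lambda>n. z * (of_nat n * k n * z ^ n + a * (k n * z ^ n))) sums (z * (z * deriv F z + a * F z))"
    by (intro sums_mult sums_add s1 s2)
  moreover have "z * (of_nat n * k n * z ^ n + a * (k n * z ^ n)) = (of_nat n + a) * k n * z ^ Suc n" for n
    by (simp add: algebra_simps)
  ultimately have s3: "(\<lambda>n. (of_nat n + a) * k n * z ^ Suc n) sums (z * (z * deriv F z + a * F z))" by simp
  \<comment> \<open>The coefficients after multiplication by \<open>z\<close>: shifted by one, with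
    constant term 0.\<close>
  define d where "d = (\<lambda>n. case n of 0 \<Rightarrow> 0 | Suc m \<Rightarrow> (of_nat m + a) * k m)"
  have s4: "(\<lambda>n. d n * z ^ n) sums (z * (z * deriv F z + a * F z))"
    using s3 sums_Suc_iff[of "\<lambda>n. d n * z ^ n" "z * (z * deriv F z + a * F z)"] by (simp add: d_def)
  have "(\<lambda>n. (of_nat n * k n * z ^ n - d n * z ^ n + (c - b) * (k n * z ^ n)) / (c - b)) sums
      ((z * deriv F z - z * (z * deriv F z + a * F z) + (c - b) * F z) / (c - b))"
    by (intro sums_divide sums_add sums_diff sums_mult s1 s2 s4)
  moreover have "(of_nat n * k n * z ^ n - d n * z ^ n + (c - b) * (k n * z ^ n)) / (c - b) =
      gauss_term a (b - 1) c z n" for n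
  proof (cases n)
    case 0
    then show ?thesis using bc by (simp add: k_def d_def)
  next
    case (Suc m)
    have cm: "c + of_nat m \<noteq> 0" using c by (auto simp: complex_eq_iff)
    have m1: "(of_nat (Suc m) :: complex) \<noteq> 0" by (rule of_nat_neq_0)
    \<comment> \<open>Once \<open>(c + m) (m + 1)\<close> is cleared, the recurrence rests on the
      polynomial identity
      \<open>(m + 1 + c - b) (b + m) - (c + m) (m + 1) = (c - b) (b - 1)\<close>.\<close>
    have k1: "k (Suc m) * ((c + of_nat m) * of_nat (Suc m)) = k m * ((a + of_nat m) * (b + of_nat m))"
      unfolding k_def pochhammer_Suc fact_Suc using cm m1 pochhammer_neq_0[OF c, of m]
      by (simp add: divide_simps del: of_nat_Suc)
    have k2: "pochhammer a (Suc m) * pochhammer (b - 1) (Suc m) / pochhammer c (Suc m) / fact (Suc m) * ((c + of_nat m) * of_nat (Suc m))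
       = k m * ((a + of_nat m) * (b - 1))"
      unfolding k_def pochhammer_Suc[of a] pochhammer_Suc[of c] pochhammer_rec[of "b - 1"] fact_Suc
      using cm m1 pochhammer_neq_0[OF c, of m]
      by (simp add: divide_simps del: of_nat_Suc)
    have "((of_nat (Suc m) + (c - b)) * k (Suc m) - (of_nat m + a) * k m) * ((c + of_nat m) * of_nat (Suc m))
      = (of_nat (Suc m) + (c - b)) * (k m * ((a + of_nat m) * (b + of_nat m))) - (of_nat m + a) * k m * ((c + of_nat m) * of_nat (Suc m))"
      unfolding k1[symmetric] by (simp add: algebra_simps)
    also have "\<dots> = (c - b) * (k m * ((a + of_nat m) * (b - 1)))"
      by (simp add: algebra_simps)
    also have "\<dots> = ((c - b) * (pochhammer a (Suc m) * pochhammer (b - 1) (Suc m) / pochhammer c (Suc m) / fact (Suc m))) * ((c + of_nat m) * of_nat (Suc m))"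
      unfolding k2[symmetric] by (simp only: mult.assoc)
    finally have "(of_nat (Suc m) + (c - b)) * k (Suc m) - (of_nat m + a) * k m =
       (c - b) * (pochhammer a (Suc m) * pochhammer (b - 1) (Suc m) / pochhammer c (Suc m) / fact (Suc m))"
      using cm m1 by (metis mult_cancel_right mult_eq_0_iff)
    then have "((of_nat (Suc m) + (c - b)) * k (Suc m) - (of_nat m + a) * k m) * z ^ Suc m / (c - b) =
       pochhammer a (Suc m) * pochhammer (b - 1) (Suc m) / pochhammer c (Suc m) / fact (Suc m) * z ^ Suc m"
      using bc by simp
    moreover have "(of_nat n * k n * z ^ n - d n * z ^ n + (c - b) * (k n * z ^ n)) / (c - b) =
      ((of_nat (Suc m) + (c - b)) * k (Suc m) - (of_nat m + a) * k m) * z ^ Suc m / (c - b)"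
      using Suc by (simp add: d_def ring_distribs add_ac mult_ac)
    ultimately show ?thesis using Suc by (simp only:) (simp add: mult_ac)
  qed
  ultimately show "(z * deriv F z - z * (z * deriv F z + a * F z) + (c - b) * F z) / (c - b) = gauss_2F1 a (b - 1) c z"
    by (simp add: sums_iff gauss_2F1_def)
qed

text \<open>Both parameters are raised until Euler's integral applies. Then \<open>b\<close> is
  lowered before \<open>c\<close>: as long as \<open>Re c\<close> exceeds \<open>Re b\<close>, the
  divisor \<open>c - b\<close> of that relation cannot vanish, and lowering \<open>c\<close>
  afterwards only asks for \<open>Re c > 0\<close>.\<close>

lemma continues_2F1_exists:
  assumes "Re c > 0"
  shows "\<exists>F. continues_2F1 a b c F"
proof -
  have lower_b: "\<exists>F. continues_2F1 a b c F"
    if "\<exists>F. continues_2F1 a (b + of_nat n) c F" "Re c > Re b + of_nat n" "Re c > 0" for a b c n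
    using that
  proof (induction n arbitrary: b)
    case (Suc n)
    then obtain F where F: "continues_2F1 a (b + of_nat (Suc n)) c F" by blast
    have "c \<noteq> b + of_nat (Suc n)" using Suc.prems(2) by (auto simp: complex_eq_iff)
    from continues_2F1_lower_b[OF F Suc.prems(3) this]
    have "\<exists>F. continues_2F1 a (b + of_nat n) c F" by (auto simp: algebra_simps)
    with Suc.IH Suc.prems show ?case by simp
  qed simp
  have lower_c: "\<exists>F. continues_2F1 a b c F"
    if "\<exists>F. continues_2F1 a b (c + of_nat n) F" "Re c > 0" for a b c n
    using that
  proof (induction n arbitrary: c)
    case (Suc n)
    then obtain F where F: "continues_2F1 a b ((c + of_nat n) + 1) F" by (auto simp: add_ac)
    have "Re (c + of_nat n) > 0" using Suc.prems(2) by simp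
    from continues_2F1_lower_c[OF F this] Suc.IH Suc.prems show ?case by blast
  qed simp
  obtain n :: nat where "- Re b < n" using reals_Archimedean2 by blast
  then have n: "Re b + n > 0" by simp
  obtain m :: nat where "Re b + n - Re c < m" using reals_Archimedean2 by blast
  then have m: "Re c + m > Re b + n" by simp
  have "\<exists>F. continues_2F1 a (b + of_nat n) (c + of_nat m) F"
    by (rule continues_2F1_euler) (use n m in auto)
  from lower_b[OF this] have "\<exists>F. continues_2F1 a b (c + of_nat m) F" using m assms by simp
  from lower_c[OF this assms] show ?thesis .
qed

lemma continues_2F1_hyp2F1: "Re c > 0 \<Longrightarrow> continues_2F1 a b c (hyp2F1 a b c)"
  using someI_ex[OF continues_2F1_exists[of c a b]]
  by (simp add: hyp2F1_def continues_2F1_def gauss_2F1_def)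

lemma hyp2F1_eq_gauss: "Re c > 0 \<Longrightarrow> norm z < 1 \<Longrightarrow> hyp2F1 a b c z = gauss_2F1 a b c z"
  using continues_2F1_hyp2F1[of c a b] by (simp add: continues_2F1_def)

lemma holomorphic_on_hyp2F1: "Re c > 0 \<Longrightarrow> hyp2F1 a b c holomorphic_on cut_plane"
  using continues_2F1_hyp2F1[of c a b] by (simp add: continues_2F1_def)

section \<open>Pfaff's transformation\<close>

lemma set_integral_reflect_unit:
  fixes g :: "real \<Rightarrow> complex"
  shows "(LINT s:{0<..<1}|lborel. g s) = (LINT s:{0<..<1}|lborel. g (1 - s))"
proof -
  have "indicat_real {0<..<1} (1 - s) = indicat_real {0<..<1} s" for s :: real
    by (auto simp: indicator_def)
  then show ?thesis
    using lborel_integral_real_affine[of "-1" "\<lambda>s. indicat_real {0<..<1} s *\<^sub>R g s" 1]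
    by (simp add: set_lebesgue_integral_def)
qed

lemma abs_pfaff_arg:
  fixes x :: real
  assumes "x < 1/2"
  shows "\<bar>x / (x - 1)\<bar> < 1"
proof -
  have "\<bar>x\<bar> < \<bar>x - 1\<bar>" using assms by linarith
  moreover have "\<bar>x - 1\<bar> > 0" using assms by simp
  ultimately show ?thesis unfolding abs_divide by (subst divide_less_eq_1_pos)
qed

text \<open>Reflecting \<open>s\<close> to \<open>1 - s\<close> exchanges \<open>b\<close> and
  \<open>d\<close> in Euler's integral, and \<open>1 - x * (1 - s)\<close> factors as
  \<open>(1 - x) * (1 - w * s)\<close> with \<open>w = x / (x - 1)\<close>. Both \<open>x\<close>
  and \<open>w\<close> lie in the unit disc, so both integrals are Gauss series.\<close>

lemma gauss_2F1_pfaff_strip: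
  fixes x :: real
  assumes b: "Re b > 0" and d: "Re d > 0" and x: "-1/2 < x" "x < 1/2"
  shows "gauss_2F1 a b (b + d) (of_real x) =
     of_real (1 - x) powr (- a) * gauss_2F1 a d (b + d) (of_real (x / (x - 1)))"
proof -
  define w where "w = x / (x - 1)"
  have w: "\<bar>w\<bar> < 1" unfolding w_def by (rule abs_pfaff_arg[OF x(2)])
  have B: "Beta b d \<noteq> 0"
    using assms by (simp add: Beta_def Gamma_eq_zero_iff Re_pos_not_nonpos_Int)
  have "Beta b d * gauss_2F1 a b (b + d) (of_real x) =
    (LINT s:{0<..<1}|lborel. beta_kernel b d s * (1 - of_real x * of_real s) powr (- a))"
    using euler_integral_series[OF b d, of "of_real x" a] x by simp
  also have "\<dots> = (LINT s:{0<..<1}|lborel. of_real (1 - x) powr (- a) *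
     (beta_kernel d b s * (1 - of_real w * of_real s) powr (- a)))"
    unfolding set_integral_reflect_unit[of "\<lambda>s. beta_kernel b d s *
      (1 - of_real x * of_real s) powr (- a)"]
  proof (rule set_lebesgue_integral_cong, simp, intro allI impI)
    fix s :: real assume s: "s \<in> {0<..<1}"
    have xw: "(1 - x) * w = - x" using x by (simp add: w_def divide_simps) (simp add: algebra_simps)
    have "(1 - x) * (1 - w * s) = (1 - x) - ((1 - x) * w) * s" by (simp add: algebra_simps)
    then have e: "1 - x * (1 - s) = (1 - x) * (1 - w * s)" unfolding xw by (simp add: algebra_simps)
    have "\<bar>w * s\<bar> \<le> \<bar>w\<bar> * 1" unfolding abs_mult using s by (intro mult_left_mono) auto
    then have p: "1 - w * s > 0" using w by linarith
    have "(1 - of_real x * of_real (1 - s)) powr (- a) = complex_of_real ((1 - x) * (1 - w * s)) powr (- a)"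
      unfolding e[symmetric] by simp
    also have "\<dots> = of_real (1 - x) powr (- a) * of_real (1 - w * s) powr (- a)"
      unfolding of_real_mult by (rule powr_times_real) (use p x in auto)
    finally have "(1 - of_real x * of_real (1 - s)) powr (- a) =
        of_real (1 - x) powr (- a) * (1 - of_real w * of_real s) powr (- a)" by simp
    then show "of_real (1 - s) powr (b - 1) * of_real (1 - (1 - s)) powr (d - 1) *
        (1 - of_real x * of_real (1 - s)) powr (- a) = of_real (1 - x) powr (- a) *
     (beta_kernel d b s * (1 - of_real w * of_real s) powr (- a))"
      by (simp del: of_real_diff)
  qed
  also have "\<dots> = of_real (1 - x) powr (- a) * (Beta d b * gauss_2F1 a d (d + b) (of_real w))"
    using euler_integral_series[OF d b, of "of_real w" a] w by simp
  finally show ?thesis using B by (simp add: Beta_commute[of d b] w_def add.commute)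
qed

text \<open>For fixed \<open>x\<close> both sides are entire in \<open>b\<close>, so agreement on
  the strip \<open>0 < Re b < Re c\<close> of Euler's integral implies agreement everywhere.\<close>

lemma gauss_2F1_pfaff:
  fixes x :: real
  assumes c: "Re c > 0" and x: "-1/2 < x" "x < 1/2"
  shows "gauss_2F1 a b c (of_real x) =
     of_real (1 - x) powr (- a) * gauss_2F1 a (c - b) c (of_real (x / (x - 1)))"
proof -
  have w: "\<bar>x / (x - 1)\<bar> < 1" by (rule abs_pfaff_arg[OF x(2)])
  define D where "D = (\<lambda>b. gauss_2F1 a b c (of_real x) -
     of_real (1 - x) powr (- a) * gauss_2F1 a (c - b) c (of_real (x / (x - 1))))"
  define U where "U = {b. 0 < Re b} \<inter> {b. Re b < Re c}"
  have U: "open U" unfolding U_def by (intro open_Int open_halfspace_Re_gt open_halfspace_Re_lt)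
  have "D b = 0"
  proof (rule analytic_continuation[of D UNIV U "c / 2"])
    show "D holomorphic_on UNIV"
      unfolding D_def using c w x
      by (intro holomorphic_intros holomorphic_on_gauss_2F1) (auto simp del: of_real_divide of_real_diff)
    have "c / 2 \<in> U" using c by (simp add: U_def)
    then show "c / 2 islimpt U" using U by (simp add: interior_limit_point interior_open)
    show "D z = 0" if "z \<in> U" for z
      using gauss_2F1_pfaff_strip[of z "c - z" x a] that x by (simp add: D_def U_def)
  qed auto
  then show ?thesis by (simp add: D_def)
qed

text \<open>\<open>z / (z - 1)\<close> lies in the unit disc when \<open>z\<close> is nearer to 0
  than to 1, that is for \<open>Re z < 1/2\<close>. A single convergent series thus represents the
  continued function on this half-plane, including the whole negative axis.\<close>

lemma hyp2F1_pfaff: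
  fixes x :: real
  assumes c: "Re c > 0" and x: "x < 1/2"
  shows "hyp2F1 a b c (of_real x) =
     of_real (1 - x) powr (- a) * gauss_2F1 a (c - b) c (of_real (x / (x - 1)))"
proof -
  define D where "D = (\<lambda>z. hyp2F1 a b c z - (1 - z) powr (- a) * gauss_2F1 a (c - b) c (z / (z - 1)))"
  define S where "S = {z. Re z < 1/2}"
  have S: "open S" "connected S" unfolding S_def
    by (rule open_halfspace_Re_lt, rule convex_connected[OF convex_halfspace_Re_lt])
  have sub: "S \<subseteq> cut_plane" by (auto simp: S_def cut_plane_def)
  have n1: "norm (z / (z - 1)) < 1" if "z \<in> S" for z
  proof -
    have "(norm z)\<^sup>2 < (norm (z - 1))\<^sup>2"
      unfolding cmod_power2 using that by (simp add: S_def power2_eq_square algebra_simps)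
    then have "norm z < norm (z - 1)" by (rule power_less_imp_less_base) simp
    then show ?thesis by (simp add: norm_divide divide_less_eq)
  qed
  have "D (of_real x) = 0"
  proof (rule analytic_continuation[of D, OF _ S _ _ of_real_islimpt_interval[of "-1/2" "-1/4" 0]])
    have z1: "z - 1 \<noteq> 0" "1 - z \<notin> \<real>\<^sub>\<le>\<^sub>0" if "z \<in> S" for z
      using that by (auto simp: S_def complex_nonpos_Reals_iff)
    show "D holomorphic_on S" unfolding D_def
      by (intro holomorphic_intros holomorphic_on_gauss_2F1 S n1
          holomorphic_on_subset[OF holomorphic_on_hyp2F1[OF c] sub]) (use z1 c in auto)
    show "D z = 0" if "z \<in> of_real ` {-1/2<..<0}" for z
    proof -
      from that obtain y where y: "z = of_real y" "-1/2 < y" "y < 0" by auto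
      have "norm z < 1" using y by simp
      then show ?thesis
        using gauss_2F1_pfaff[OF c, of y a b] y by (simp add: D_def hyp2F1_eq_gauss[OF c])
    qed
  qed (use x in \<open>auto simp: S_def\<close>)
  then show ?thesis by (simp add: D_def)
qed

section \<open>The two kernels and their locally uniform majorants\<close>

lemma powr_bound_const:
  fixes K s R :: real
  assumes "K > 0" "\<bar>s\<bar> \<le> R"
  shows "K powr s \<le> (max K (1 / K)) powr R"
proof -
  have R: "R \<ge> 0" using assms by linarith
  have m1: "max K (1 / K) \<ge> 1" 
  proof -
    have "K \<ge> 1 \<or> 1 / K \<ge> 1" using assms by auto
    then show ?thesis by (simp only: le_max_iff_disj)
  qed
  have "K powr s \<le> (max K (1 / K)) powr \<bar>s\<bar>"
  proof (cases "s \<ge> 0")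
    case True
    then show ?thesis using assms by (simp add: powr_mono2)
  next
    case False
    have "K powr s = (1 / K) powr (- s)" using assms by (simp add: powr_divide powr_minus_divide)
    also have "\<dots> \<le> (max K (1 / K)) powr (- s)" using False assms by (intro powr_mono2) auto
    finally show ?thesis using False by simp
  qed
  also have "\<dots> \<le> (max K (1 / K)) powr R" using m1 assms by (intro powr_mono) auto
  finally show ?thesis .
qed

text \<open>A varying exponent is traded for its fixed lower bound \<open>u\<close>: on a bounded
  range the surplus power \<open>t powr (s - u)\<close> is at most \<open>X powr R\<close>.\<close>

lemma powr_bound_near_0:
  fixes t X s u R :: real
  assumes "0 < t" "t \<le> X" "X \<ge> 1" "u \<le> s" "s - u \<le> R"
  shows "t powr (s - 1) \<le> X powr R * t powr (u - 1)"
proof -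
  have "t powr (s - 1) = t powr (s - u) * t powr (u - 1)" by (simp flip: powr_add)
  also have "t powr (s - u) \<le> X powr (s - u)" using assms by (intro powr_mono2) auto
  also have "\<dots> \<le> X powr R" using assms by (intro powr_mono) auto
  finally show ?thesis by (simp add: mult_right_mono)
qed

text \<open>For \<open>z < 0\<close> Pfaff's transformation applies with
  \<open>1 - w = 1 / (1 - z)\<close>: the series in \<open>w\<close> is bounded by a multiple of
  \<open>(1 - w) powr (- A) = (1 - z) powr A\<close>, and the prefactor contributes the exponent
  \<open>- Re a\<close>. The transformed parameters satisfy \<open>a + (c - b) - c = a - b\<close>,
  whence the condition on \<open>Re (a - b)\<close>. On \<open>[0, 1 - \<delta>]\<close> the
  function is bounded, and the claimed majorant is bounded below.\<close>

lemma hyp2F1_uniform_bound: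
  fixes R r A \<eta> \<delta> :: real
  assumes "r > 0" "A > 0" "\<eta> > 0" "0 < \<delta>" "\<delta> \<le> 1" "R \<ge> 0"
  obtains C where "C > 0"
    "\<And>a b c (z::real). \<lbrakk>norm a \<le> R; norm b \<le> R; norm c \<le> R; Re c \<ge> r; Re (a - b) \<le> A - \<eta>; z \<le> 1 - \<delta>\<rbrakk> \<Longrightarrow>
       norm (hyp2F1 a b c (of_real z)) \<le> C * (1 - z) powr (A - Re a)"
proof -
  obtain C1 where C1: "C1 > 0"
    "\<And>a b c z. \<lbrakk>norm a \<le> 2 * R; norm b \<le> 2 * R; Re c \<ge> r; Re (a + b - c) \<le> A - \<eta>; norm z < 1\<rbrakk> \<Longrightarrow>
       norm (gauss_2F1 a b c z) \<le> C1 * (1 - norm z) powr (- A)"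
    by (rule gauss_summable_bound[OF assms(1-3), of "2 * R"]) blast
  \<comment> \<open>Exceeds any \<open>Re (a + b - c)\<close> with parameters of norm at most
    \<open>R\<close> by at least 1.\<close>
  define A' where "A' = 3 * R + 1"
  obtain C2 where C2: "C2 > 0"
    "\<And>a b c z. \<lbrakk>norm a \<le> R; norm b \<le> R; Re c \<ge> r; Re (a + b - c) \<le> A' - 1; norm z < 1\<rbrakk> \<Longrightarrow>
       norm (gauss_2F1 a b c z) \<le> C2 * (1 - norm z) powr (- A')"
    by (rule gauss_summable_bound[of r A' 1 R]) (use assms in \<open>auto simp: A'_def\<close>)
  \<comment> \<open>The second entry rescales the constant bound for \<open>0 \<le> z\<close> by
    \<open>\<delta> powr (A + R)\<close>, a lower bound of \<open>(1 - z) powr (A - Re a)\<close>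
    there.\<close>
  define C where "C = max C1 (C2 * \<delta> powr (- A') / \<delta> powr (A + R))"
  show thesis
  proof (rule that[of C])
    show "C > 0" using C1(1) by (simp add: C_def)
    fix a b c :: complex and z :: real
    assume h: "norm a \<le> R" "norm b \<le> R" "norm c \<le> R" "Re c \<ge> r" "Re (a - b) \<le> A - \<eta>" "z \<le> 1 - \<delta>"
    have c: "Re c > 0" using h assms by linarith
    show "norm (hyp2F1 a b c (of_real z)) \<le> C * (1 - z) powr (A - Re a)"
    proof (cases "z < 0")
      case True
      define w where "w = z / (z - 1)"
      have w: "0 \<le> w" "w < 1" "1 - w = 1 / (1 - z)"
        using True by (auto simp: w_def divide_simps)
      have "norm (gauss_2F1 a (c - b) c (of_real w)) \<le> C1 * (1 - norm (of_real w :: complex)) powr (- A)"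
      proof (rule C1(2))
        show "norm (c - b) \<le> 2 * R" using norm_triangle_ineq4[of c b] h by linarith
      qed (use h w assms(6) in auto)
      also have "(1 - norm (of_real w :: complex)) powr (- A) = (1 - z) powr A"
        using w True by (simp add: powr_divide powr_minus_divide)
      finally have "norm (gauss_2F1 a (c - b) c (of_real w)) \<le> C1 * (1 - z) powr A" .
      then have "(1 - z) powr (- Re a) * norm (gauss_2F1 a (c - b) c (of_real w)) \<le>
          (1 - z) powr (- Re a) * (C1 * (1 - z) powr A)" by (rule mult_left_mono) simp
      also have "\<dots> = C1 * (1 - z) powr (A - Re a)"
        using True by (simp add: powr_diff powr_minus divide_inverse)
      also have "\<dots> \<le> C * (1 - z) powr (A - Re a)" by (intro mult_right_mono) (auto simp: C_def)
      finally show ?thesis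
        using True hyp2F1_pfaff[OF c, of z a b]
        by (simp add: norm_mult norm_of_real_powr w_def del: of_real_diff of_real_divide)
    next
      case False
      have z1: "z < 1" "1 - z \<le> 1" "1 - z \<ge> \<delta>" using h assms False by linarith+
      have re: "Re (a + b - c) \<le> A' - 1"
        using abs_Re_le_cmod[of a] abs_Re_le_cmod[of b] abs_Re_le_cmod[of c] h by (simp add: A'_def)
      have "norm (hyp2F1 a b c (of_real z)) = norm (gauss_2F1 a b c (of_real z))"
        using False z1 by (subst hyp2F1_eq_gauss[OF c]) auto
      also have "\<dots> \<le> C2 * (1 - z) powr (- A')"
        using C2(2)[OF h(1,2,4) re, of "of_real z"] z1 False by simp
      also have "\<dots> \<le> C2 * \<delta> powr (- A')"
        using C2(1) z1 assms by (intro mult_left_mono powr_mono2') (auto simp: A'_def)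
      also have "\<dots> = C2 * \<delta> powr (- A') / \<delta> powr (A + R) * \<delta> powr (A + R)" using assms by simp
      also have "\<dots> \<le> C * \<delta> powr (A + R)" by (intro mult_right_mono) (auto simp: C_def)
      also have "\<dots> \<le> C * (1 - z) powr (A - Re a)"
      proof (rule mult_left_mono)
        have "\<delta> powr (A + R) \<le> (1 - z) powr (A + R)" using assms z1 by (intro powr_mono2) auto
        also have "\<dots> \<le> (1 - z) powr (A - Re a)"
          using z1 abs_Re_le_cmod[of a] h by (intro powr_mono') auto
        finally show "\<delta> powr (A + R) \<le> (1 - z) powr (A - Re a)" .
      qed (use C1(1) in \<open>simp add: C_def\<close>)
      finally show ?thesis .
    qed
  qed
qed

text \<open>\<open>hyp2F1\<close> is chosen separately for every parameter triple, so its definition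
  says nothing about dependence on the parameters. At a fixed real point below 1 its value is a
  Gauss series, directly or after Pfaff's transformation, and that series is holomorphic in all its
  arguments.\<close>

lemma holomorphic_on_hyp2F1_params:
  fixes x :: real
  assumes "open S" "a holomorphic_on S" "b holomorphic_on S" "c holomorphic_on S"
    and pos: "\<And>s. s \<in> S \<Longrightarrow> Re (c s) > 0" and x: "x < 1"
  shows "(\<lambda>s. hyp2F1 (a s) (b s) (c s) (of_real x)) holomorphic_on S"
proof (cases "x < 1/2")
  case True
  have "(\<lambda>s. of_real (1 - x) powr (- a s) * gauss_2F1 (a s) (c s - b s) (c s) (of_real (x / (x - 1))))
      holomorphic_on S"
    by (intro holomorphic_intros holomorphic_on_gauss_2F1 assms)
      (use abs_pfaff_arg[OF True] pos in \<open>auto simp del: of_real_divide of_real_diff\<close>)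
  then show ?thesis
    by (rule holomorphic_transform) (use hyp2F1_pfaff[OF pos True] in simp)
next
  case False
  have "(\<lambda>s. gauss_2F1 (a s) (b s) (c s) (of_real x)) holomorphic_on S"
    by (intro holomorphic_intros holomorphic_on_gauss_2F1 assms) (use False x in auto)
  then show ?thesis
    by (rule holomorphic_transform) (use hyp2F1_eq_gauss[OF pos] x False in simp)
qed

definition inner_kernel :: "complex \<Rightarrow> complex \<Rightarrow> complex \<Rightarrow> real \<Rightarrow> real \<Rightarrow> real \<Rightarrow> complex" where
  "inner_kernel a b p x y t =
     exp (- p * of_real t) * of_real t powr (1 / 2 - a + b) * of_real (x - t) powr (a - 1) *
     of_real (y + t) powr (- b) *
     hyp2F1 b (1 - a) (3 / 2 - a + b) (of_real (t * (x - y - t) / ((x - t) * (y + t))))"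

definition outer_kernel :: "complex \<Rightarrow> complex \<Rightarrow> complex \<Rightarrow> real \<Rightarrow> real \<Rightarrow> real \<Rightarrow> complex" where
  "outer_kernel a b p x y t =
     exp (- p * of_real t) * of_real t powr (- a) * of_real (t - x) powr (a + b - 1) *
     of_real (y - x + t) powr (- b - 1 / 2) *
     hyp2F1 (1 / 2 + b) a (3 / 2) (of_real (x * y / (t * (y - x + t))))"

text \<open>The condition on \<open>a + b\<close> governs integrability of both kernels at
  \<open>t = x\<close>. The one on \<open>3/2 - a + b\<close> governs the inner kernel at
  \<open>t = 0\<close> and puts its third hypergeometric parameter in the right half-plane.
  \<open>Re p > 0\<close> gives decay at infinity, and \<open>Re a > 0\<close> translates
  \<open>Re \<nu> < 1\<close>.\<close>

definition admissible :: "complex \<Rightarrow> complex \<Rightarrow> complex \<Rightarrow> bool" where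
  "admissible a b p \<longleftrightarrow> Re a > 0 \<and> Re (a + b) > 0 \<and> Re (3 / 2 - a + b) > 0 \<and> Re p > 0"

section \<open>The arguments of 2F1 on either side of \<open>t = x\<close>, and measurability of the
  kernels\<close>

lemma one_minus_divide: "w \<noteq> 0 \<Longrightarrow> 1 - u / w = (w - u) / (w :: real)"
  by (simp add: diff_divide_distrib)

text \<open>The bounds on 2F1 involve \<open>1 - z\<close>, whose numerator collapses to
  \<open>x * y\<close>. It tends to infinity with \<open>t\<close> tending to \<open>x\<close>, so
  the argument runs to -\<infinity>.\<close>

lemma inner_arg:
  fixes t x y :: real
  assumes "0 < t" "t < x" "0 < y"
  shows "1 - t * (x - y - t) / ((x - t) * (y + t)) = x * y / ((x - t) * (y + t))"
proof -
  have "(x - t) * (y + t) \<noteq> 0" using assms by auto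
  then have "1 - t * (x - y - t) / ((x - t) * (y + t)) =
      ((x - t) * (y + t) - t * (x - y - t)) / ((x - t) * (y + t))" by (rule one_minus_divide)
  also have "(x - t) * (y + t) - t * (x - y - t) = x * y" by (simp add: algebra_simps)
  finally show ?thesis .
qed

text \<open>Here \<open>1 - z\<close> vanishes to first order at \<open>t = x\<close>: the argument
  approaches the branch point 1 from below.\<close>

lemma outer_arg:
  fixes t x y :: real
  assumes "0 < x" "x < t" "0 < y"
  shows "1 - x * y / (t * (y - x + t)) = (t - x) * (t + y) / (t * (y - x + t))"
proof -
  have "t * (y - x + t) \<noteq> 0" using assms by auto
  then have "1 - x * y / (t * (y - x + t)) = (t * (y - x + t) - x * y) / (t * (y - x + t))"
    by (rule one_minus_divide)
  also have "t * (y - x + t) - x * y = (t - x) * (t + y)" by (simp add: algebra_simps)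
  finally show ?thesis .
qed

text \<open>As \<open>(x - t) * (y + t) \<le> x * (x + y)\<close>, the argument keeps a distance
  from the branch point that does not depend on \<open>t\<close>.\<close>

lemma inner_arg_le:
  fixes t x y :: real
  assumes "0 < t" "t < x" "0 < y"
  shows "t * (x - y - t) / ((x - t) * (y + t)) \<le> 1 - y / (x + y)"
proof -
  have "(x - t) * (y + t) \<le> x * (x + y)" using assms by (intro mult_mono) auto
  then have "x * y / (x * (x + y)) \<le> x * y / ((x - t) * (y + t))"
    using assms by (intro divide_left_mono) auto
  then have "y / (x + y) \<le> x * y / ((x - t) * (y + t))" using assms by simp
  with inner_arg[OF assms] show ?thesis by linarith
qed

lemma outer_arg_bounds:
  fixes t x y :: real
  assumes "0 < x" "x < t" "0 < y"
  shows "0 < x * y / (t * (y - x + t))" "x * y / (t * (y - x + t)) < 1"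
proof -
  have "0 < t * (y - x + t)" using assms by simp
  then show "0 < x * y / (t * (y - x + t))" using assms by simp
  have "0 < (t - x) * (t + y) / (t * (y - x + t))" using assms by simp
  with outer_arg[OF assms] show "x * y / (t * (y - x + t)) < 1" by linarith
qed

lemma of_real_in_cut_plane: "of_real z \<in> cut_plane \<longleftrightarrow> z < (1::real)"
  by (auto simp: cut_plane_def)

lemma continuous_on_hyp2F1_real:
  assumes "continuous_on S f" "\<And>t. t \<in> S \<Longrightarrow> f t < (1 :: real)" "Re c > 0"
  shows "continuous_on S (\<lambda>t. hyp2F1 a b c (of_real (f t)))"
  by (rule continuous_on_compose2[OF holomorphic_on_imp_continuous_on[OF holomorphic_on_hyp2F1[OF assms(3)]]])
     (use assms in \<open>auto intro!: continuous_intros simp: of_real_in_cut_plane\<close>)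

lemma inner_kernel_measurable:
  assumes "Re (3 / 2 - a + b) > 0" "y > 0"
  shows "set_borel_measurable lborel {0<..<x} (inner_kernel a b p x y)"
  unfolding inner_kernel_def[abs_def]
proof (intro set_borel_measurable_lborel_continuous continuous_on_mult)
  show "continuous_on {0<..<x} (\<lambda>t. hyp2F1 b (1 - a) (3 / 2 - a + b) (of_real (t * (x - y - t) / ((x - t) * (y + t)))))"
  proof (rule continuous_on_hyp2F1_real)
    show "continuous_on {0<..<x} (\<lambda>t. t * (x - y - t) / ((x - t) * (y + t)))"
      by (intro continuous_intros) (use assms in auto)
    fix t assume t: "t \<in> {0<..<x}"
    then have "y / (x + y) > 0" using assms by auto
    moreover have "t * (x - y - t) / ((x - t) * (y + t)) \<le> 1 - y / (x + y)"
      using t assms by (intro inner_arg_le) auto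
    ultimately show "t * (x - y - t) / ((x - t) * (y + t)) < 1" by linarith
  qed (use assms in auto)
  show "continuous_on {0<..<x} (\<lambda>t. of_real (y + t) powr (- b))"
    by (rule continuous_on_of_real_powr) (use assms in \<open>auto intro!: continuous_intros\<close>)
qed (auto intro!: continuous_on_of_real_powr continuous_intros)

lemma outer_kernel_measurable:
  assumes "x > 0" "y > 0"
  shows "set_borel_measurable lborel {x<..} (outer_kernel a b p x y)"
  unfolding outer_kernel_def[abs_def]
proof (intro set_borel_measurable_lborel_continuous continuous_on_mult)
  show "continuous_on {x<..} (\<lambda>t. hyp2F1 (1 / 2 + b) a (3 / 2) (of_real (x * y / (t * (y - x + t)))))"
  proof (rule continuous_on_hyp2F1_real)
    show "continuous_on {x<..} (\<lambda>t. x * y / (t * (y - x + t)))"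
      by (intro continuous_intros) (use assms in auto)
  qed (use outer_arg_bounds assms in auto)
  show "continuous_on {x<..} (\<lambda>t. of_real (y - x + t) powr (- b - 1 / 2))"
    by (rule continuous_on_of_real_powr) (use assms in \<open>auto intro!: continuous_intros\<close>)
qed (use assms in \<open>auto intro!: continuous_on_of_real_powr continuous_intros\<close>)

section \<open>Integrable weights and elementary estimates for the majorants\<close>

lemma inner_weight_integrable:
  fixes u v x :: real
  assumes "u > 0" "v > 0" "x > 0"
  shows "set_integrable lborel {0<..<x} (\<lambda>t. t powr (u - 1) * (x - t) powr (v - 1))"
proof -
  have "integrable lborel (\<lambda>t. indicator {0<..<1} t *\<^sub>R (t powr (u - 1) * (1 - t) powr (v - 1)))"
    using beta_kernel_integrable_real[OF assms(1,2)] by (simp add: set_integrable_def)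
  from lborel_integrable_real_affine[OF this, of "1 / x" 0] assms
  have "integrable lborel (\<lambda>t. indicator {0<..<1} (t / x) *\<^sub>R ((t / x) powr (u - 1) * (1 - t / x) powr (v - 1)))"
    by simp
  from integrable_mult_right[OF this, of "x powr (u - 1) * x powr (v - 1)"]
  show ?thesis unfolding set_integrable_def
  proof (rule Bochner_Integration.integrable_cong[OF refl, THEN iffD1, rotated])
    fix t :: real
    have "x powr (v - 1) * (1 - t / x) powr (v - 1) = (x - t) powr (v - 1)" if "0 < t" "t < x"
    proof -
      have "x * (1 - t / x) = x - t" using assms by (simp add: field_simps)
      then show ?thesis using that assms by (simp flip: powr_mult)
    qed
    moreover have "x powr (u - 1) * (t / x) powr (u - 1) = t powr (u - 1)" if "0 < t"
      using that assms by (simp flip: powr_mult)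
    ultimately show "x powr (u - 1) * x powr (v - 1) * (indicator {0<..<1} (t / x) *\<^sub>R ((t / x) powr (u - 1) * (1 - t / x) powr (v - 1)))
       = indicator {0<..<x} t *\<^sub>R (t powr (u - 1) * (x - t) powr (v - 1))"
      using assms by (auto simp: indicator_def divide_simps mult_ac split: if_splits)
        (metis mult.assoc mult.commute)+
  qed
qed

lemma outer_weight_integrable:
  fixes v q x :: real
  assumes "v > 0" "q > 0"
  shows "set_integrable lborel {x<..} (\<lambda>t. (t - x) powr (v - 1) * exp (- q * t))"
proof -
  have "set_integrable lebesgue {0<..} (\<lambda>t. complex_of_real t powr (of_real v - 1) / of_real (exp (q * t)))"
    using absolutely_integrable_Gamma_integral[of "of_real v" q] assms by simp
  from integrable_norm[OF this[unfolded set_integrable_def]]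
  have "set_integrable lebesgue {0<..} (\<lambda>t. norm (complex_of_real t powr (of_real v - 1) / of_real (exp (q * t))))"
    by (simp add: set_integrable_def)
  also have "?this \<longleftrightarrow> set_integrable lebesgue {0<..} (\<lambda>t. t powr (v - 1) * exp (- q * t))"
    by (rule set_integrable_cong[OF refl refl]) (simp add: norm_mult norm_inverse norm_of_real_powr exp_minus divide_inverse)
  finally have "integrable lborel (\<lambda>t. indicator {0<..} t *\<^sub>R (t powr (v - 1) * exp (- q * t)))"
    unfolding set_integrable_def by (subst (asm) integrable_completion) auto
  from integrable_mult_right[OF lborel_integrable_real_affine[OF this, of 1 "- x"], of "exp (- q * x)"]
  show ?thesis unfolding set_integrable_def
    by (rule Bochner_Integration.integrable_cong[OF refl, THEN iffD1, rotated])
       (auto simp: indicator_def algebra_simps simp flip: exp_add)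
qed

text \<open>Multiplying \<open>ln u \<le> u - 1\<close> at \<open>u = q / S * (1 + t)\<close> by
  \<open>S\<close> bounds \<open>S * ln (1 + t)\<close> by \<open>q * t\<close> plus a constant; the
  exponential of that constant is \<open>K\<close>.\<close>

lemma exp_dominates_powr:
  fixes q S :: real
  assumes "q > 0" "S > 0"
  obtains K where "K > 0" "\<And>t. t \<ge> 0 \<Longrightarrow> (1 + t) powr S * exp (- (2 * q) * t) \<le> K * exp (- q * t)"
proof (rule that[of "exp (q - S - S * ln (q / S))"])
  fix t :: real assume t: "t \<ge> 0"
  have "ln (q / S * (1 + t)) \<le> q / S * (1 + t) - 1" using assms t by (intro ln_le_minus_one) auto
  then have "ln (1 + t) \<le> q / S * (1 + t) - 1 - ln (q / S)" using assms t ln_mult_pos[of "q / S" "1 + t"] by simp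
  then have "S * ln (1 + t) \<le> S * (q / S * (1 + t) - 1 - ln (q / S))" using assms by (intro mult_left_mono) auto
  also have "\<dots> = q - S - S * ln (q / S) + q * t" using assms by (simp add: field_simps)
  finally have "S * ln (1 + t) + - (2 * q) * t \<le> q - S - S * ln (q / S) + - q * t" by simp
  then show "(1 + t) powr S * exp (- (2 * q) * t) \<le> exp (q - S - S * ln (q / S)) * exp (- q * t)"
    using t by (simp add: powr_def flip: exp_add)
qed simp

lemma powr_quotient:
  fixes k u w s :: real
  assumes "k > 0" "u > 0" "w > 0"
  shows "(k / (u * w)) powr s = k powr s * (u powr (- s) * w powr (- s))"
  using assms by (simp add: powr_divide powr_mult powr_minus_divide)

text \<open>
  The exponent \<open>A\<close> has to exceed \<open>Re (a + b) - 1\<close>, to control \<open>2F1\<close> near \<open>t = x\<close>, and to stay below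
  \<open>Re (a + b)\<close>, to keep the majorants integrable there.
\<close>

definition kernel_margin :: "real \<Rightarrow> real \<Rightarrow> real \<Rightarrow> real \<Rightarrow> real \<Rightarrow> real \<Rightarrow> complex \<Rightarrow> complex \<Rightarrow> complex \<Rightarrow> bool" where
  "kernel_margin e A u v q R a b p \<longleftrightarrow>
     norm a + 2 \<le> R \<and> norm b + 2 \<le> R \<and> norm (1 - a) \<le> R \<and> norm (1 / 2 + b) \<le> R \<and>
     norm (3 / 2 - a + b) \<le> R \<and> A + \<bar>Re b\<bar> + 1 \<le> R \<and> A + \<bar>Re a\<bar> \<le> R \<and>
     Re (a + b) - 1 \<le> A - e \<and>
     u \<le> Re (3 / 2 - a + b) \<and> Re (3 / 2 - a + b) - u \<le> R \<and>
     v \<le> Re (a + b) - A \<and> Re (a + b) - A - v \<le> R \<and> 2 * q \<le> Re p"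

lemma admissible_margin:
  assumes "admissible a0 b0 p0"
  obtains e A u v q R where "e > 0" "A > 0" "u > 0" "v > 0" "q > 0" "R > 0"
    "\<And>a b p. \<lbrakk>norm (a - a0) \<le> e; norm (b - b0) \<le> e; norm (p - p0) \<le> e\<rbrakk> \<Longrightarrow>
       kernel_margin e A u v q R a b p"
proof -
  define \<sigma> where "\<sigma> = Re (a0 + b0)"
  define \<gamma> where "\<gamma> = Re (3 / 2 - a0 + b0)"
  have pos: "\<sigma> > 0" "\<gamma> > 0" "Re p0 > 0" using assms by (auto simp: admissible_def \<sigma>_def \<gamma>_def)
  \<comment> \<open>The real parts of \<open>a + b\<close> and \<open>3/2 - a + b\<close> move by at
    most \<open>2 * e\<close>, so a sixteenth of the smallest slack leaves ample room in every
    inequality.\<close>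
  define e where "e = min (min 1 \<sigma>) (min \<gamma> (Re p0)) / 16"
  have e: "e > 0" "e \<le> 1/16" "e \<le> \<sigma> / 16" "e \<le> \<gamma> / 16" "e \<le> Re p0 / 16"
    using pos by (auto simp: e_def)
  \<comment> \<open>Both candidates lie below \<open>\<sigma>\<close>; the first exceeds
    \<open>\<sigma> - 1\<close> and the second is positive. Their maximum therefore lies in the
    required window and is positive as well.\<close>
  define A where "A = max (\<sigma> - 1 / 2) (\<sigma> / 2)"
  have A: "A > 0" "A \<ge> \<sigma> - 1/2" "A \<le> \<sigma> - 4 * e" "A \<le> \<sigma>"
    using pos e by (auto simp: A_def)
  define R where "R = norm a0 + norm b0 + A + 20"
  \<comment> \<open>\<open>v = e\<close> is possible because \<open>A \<le> \<sigma> - 4 * e\<close>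
    while \<open>Re (a + b)\<close> moves by at most \<open>2 * e\<close>; \<open>2 * q\<close> is
    half of \<open>Re p0\<close>.\<close>
  have "kernel_margin e A (\<gamma> / 2) e (Re p0 / 4) R a b p"
    if h: "norm (a - a0) \<le> e" "norm (b - b0) \<le> e" "norm (p - p0) \<le> e" for a b p
  proof -
    have ra: "\<bar>Re a - Re a0\<bar> \<le> e" and rb: "\<bar>Re b - Re b0\<bar> \<le> e" and rp: "\<bar>Re p - Re p0\<bar> \<le> e"
      using Re_diff_le_norm h by blast+
    have na: "norm a \<le> norm a0 + 1" using norm_le_norm_add[OF h(1)] e by linarith
    have nb: "norm b \<le> norm b0 + 1" using norm_le_norm_add[OF h(2)] e by linarith
    have rr: "\<bar>Re a\<bar> \<le> norm a" "\<bar>Re b\<bar> \<le> norm b" by (rule abs_Re_le_cmod)+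
    have n0: "norm a0 \<ge> 0" "norm b0 \<ge> 0" by auto
    have n1: "norm (1 - a) \<le> 1 + norm a" using norm_triangle_ineq4[of 1 a] by simp
    have n2: "norm (1 / 2 + b) \<le> 1 + norm b" using norm_triangle_ineq[of "1/2" b] by simp
    have n3: "norm (3 / 2 - a + b) \<le> 3 / 2 + norm a + norm b"
      using norm_triangle_ineq[of "3/2 - a" b] norm_triangle_ineq4[of "3/2" a] by simp
    have c: "Re (3 / 2 - a + b) = 3 / 2 - Re a + Re b" "\<gamma> = 3 / 2 - Re a0 + Re b0"
      "\<sigma> = Re a0 + Re b0" "Re (a + b) = Re a + Re b" by (simp_all add: \<gamma>_def \<sigma>_def)
    have bounds: "Re a \<le> Re a0 + e" "Re a0 - e \<le> Re a" "Re b \<le> Re b0 + e" "Re b0 - e \<le> Re b"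
      "Re p0 - e \<le> Re p" using ra rb rp by (simp_all add: abs_le_iff)
    have rr': "Re a0 \<le> norm a0" "- Re a0 \<le> norm a0" "Re b0 \<le> norm b0" "- Re b0 \<le> norm b0"
      using abs_Re_le_cmod[of a0] abs_Re_le_cmod[of b0] by (simp_all add: abs_le_iff)
    have 1: "norm a + 2 \<le> R \<and> norm b + 2 \<le> R \<and> norm (1 - a) \<le> R \<and> norm (1 / 2 + b) \<le> R \<and>
        norm (3 / 2 - a + b) \<le> R"
      unfolding R_def using na nb n0 n1 n2 n3 A(1) by (intro conjI; linarith)
    have 2: "A + \<bar>Re b\<bar> + 1 \<le> R" "A + \<bar>Re a\<bar> \<le> R"
    proof -
      show "A + \<bar>Re b\<bar> + 1 \<le> R" using rr(2) nb n0 unfolding R_def by linarith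
      show "A + \<bar>Re a\<bar> \<le> R" using rr(1) na n0 unfolding R_def by linarith
    qed
    have 3: "Re (a + b) - 1 \<le> A - e" "e \<le> Re (a + b) - A"
      using bounds A e c(3) unfolding c(4) by linarith+
    have 4: "\<gamma> / 2 \<le> Re (3 / 2 - a + b)" "2 * (Re p0 / 4) \<le> Re p"
      using bounds e c(2) pos unfolding c(1) by linarith+
    have 5: "Re (3 / 2 - a + b) - \<gamma> / 2 \<le> R" "Re (a + b) - A - e \<le> R"
      using bounds rr' e pos A(1) c(2) unfolding c(1,4) R_def by linarith+
    from 1 2 3 4 5 show ?thesis unfolding kernel_margin_def by blast
  qed
  with e(1) A(1) pos show thesis
    by (intro that[of e A "\<gamma> / 2" e "Re p0 / 4" R]) (simp_all add: R_def add_nonneg_pos)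
qed

text \<open>By \<open>inner_arg\<close>, the growth \<open>(1 - z) powr (A - Re b)\<close> of 2F1
  contributes \<open>(x - t) powr (Re b - A)\<close>. Together with
  \<open>(x - t) powr (Re a - 1)\<close> the exponent at \<open>t = x\<close> is
  \<open>Re (a + b) - A - 1\<close>, at least \<open>v - 1\<close>; at \<open>t = 0\<close> it is at
  least \<open>u - 1\<close>.\<close>

lemma inner_kernel_dominated:
  assumes adm: "admissible a0 b0 p0" and x: "x > 0" and y: "y > 0"
  obtains e G where "e > 0" "set_integrable lborel {0<..<x} G"
    "\<And>a b p t. \<lbrakk>norm (a - a0) \<le> e; norm (b - b0) \<le> e; norm (p - p0) \<le> e; t \<in> {0<..<x}\<rbrakk> \<Longrightarrow>
       norm (inner_kernel a b p x y t) \<le> (G t :: real)"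
proof -
  obtain e A u v q R where pos: "e > 0" "A > 0" "u > 0" "v > 0" "q > 0" "R > 0"
    and m: "\<And>a b p. \<lbrakk>norm (a - a0) \<le> e; norm (b - b0) \<le> e; norm (p - p0) \<le> e\<rbrakk> \<Longrightarrow>
       kernel_margin e A u v q R a b p"
    using admissible_margin[OF adm] by blast
  define \<delta> where "\<delta> = y / (x + y)"
  have \<delta>: "0 < \<delta>" "\<delta> \<le> 1" using x y by (auto simp: \<delta>_def)
  obtain C where C: "C > 0"
    "\<And>a b c (z::real). \<lbrakk>norm a \<le> R; norm b \<le> R; norm c \<le> R; Re c \<ge> u; Re (a - b) \<le> A - e; z \<le> 1 - \<delta>\<rbrakk> \<Longrightarrow>
       norm (hyp2F1 a b c (of_real z)) \<le> C * (1 - z) powr (A - Re a)"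
    using hyp2F1_uniform_bound[OF pos(3,2,1) \<delta>, of R] pos(6) by (metis less_imp_le)
  define X where "X = max 1 x"
  define K where "K = C * max (x * y) (1 / (x * y)) powr R * y powr (- A) * X powr R * X powr R"
  show thesis
  proof (rule that[OF pos(1)])
    show "set_integrable lborel {0<..<x} (\<lambda>t. K * (t powr (u - 1) * (x - t) powr (v - 1)))"
      by (intro set_integrable_mult_right inner_weight_integrable pos x)
    fix a b p t
    assume h: "norm (a - a0) \<le> e" "norm (b - b0) \<le> e" "norm (p - p0) \<le> e" and t: "t \<in> {0<..<x}"
    define c where "c = 3 / 2 - a + b"
    define z where "z = t * (x - y - t) / ((x - t) * (y + t))"
    note mm = m[OF h, unfolded kernel_margin_def]
    have t': "0 < t" "t < x" using t by auto
    have z1: "1 - z = x * y / ((x - t) * (y + t))" unfolding z_def by (rule inner_arg[OF t' y])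
    have z2: "z \<le> 1 - \<delta>" unfolding z_def \<delta>_def by (rule inner_arg_le[OF t' y])
    have reb: "\<bar>A - Re b\<bar> \<le> R" using mm pos by auto
    have "norm (hyp2F1 b (1 - a) c (of_real z)) \<le> C * (1 - z) powr (A - Re b)"
      by (rule C(2)) (use mm z2 in \<open>auto simp: c_def\<close>)
    also have "(1 - z) powr (A - Re b) = (x * y) powr (A - Re b) * ((x - t) powr (Re b - A) * (y + t) powr (Re b - A))"
      using t' x y unfolding z1 by (subst powr_quotient) auto
    finally have F: "norm (hyp2F1 b (1 - a) c (of_real z)) \<le>
        C * ((x * y) powr (A - Re b) * ((x - t) powr (Re b - A) * (y + t) powr (Re b - A)))" .
    have "norm (inner_kernel a b p x y t) = exp (- Re p * t) * t powr (Re c - 1) * (x - t) powr (Re a - 1) *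
        (y + t) powr (- Re b) * norm (hyp2F1 b (1 - a) c (of_real z))"
    proof -
      have rc: "Re c - 1 = Re (1 / 2 - a + b)" by (simp add: c_def)
      show ?thesis using t' y unfolding rc
      by (simp add: inner_kernel_def norm_mult norm_of_real_powr c_def z_def
          del: of_real_diff of_real_add of_real_divide of_real_mult)
    qed
    also have "\<dots> \<le> 1 * t powr (Re c - 1) * (x - t) powr (Re a - 1) *
        (y + t) powr (- Re b) * (C * ((x * y) powr (A - Re b) * ((x - t) powr (Re b - A) * (y + t) powr (Re b - A))))"
      using mm pos t' by (intro mult_mono F) (auto intro!: mult_nonneg_nonneg)
    also have "\<dots> = C * (x * y) powr (A - Re b) * ((y + t) powr (- Re b) * (y + t) powr (Re b - A)) *
         t powr (Re c - 1) * ((x - t) powr (Re a - 1) * (x - t) powr (Re b - A))"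
      by (simp add: mult_ac)
    also have "\<dots> = C * (x * y) powr (A - Re b) * (y + t) powr (- A) *
         t powr (Re c - 1) * (x - t) powr ((Re (a + b) - A) - 1)"
      by (simp add: algebra_simps flip: powr_add)
    also have "\<dots> \<le> C * max (x * y) (1 / (x * y)) powr R * y powr (- A) * (X powr R * t powr (u - 1)) * (X powr R * (x - t) powr (v - 1))"
    proof (intro mult_mono)
      show "(x * y) powr (A - Re b) \<le> max (x * y) (1 / (x * y)) powr R"
        by (rule powr_bound_const) (use x y reb in auto)
      show "(y + t) powr (- A) \<le> y powr (- A)" using t' y pos by (intro powr_mono2') auto
      show "t powr (Re c - 1) \<le> X powr R * t powr (u - 1)"
        by (rule powr_bound_near_0) (use t' mm in \<open>auto simp: X_def c_def\<close>)
      show "(x - t) powr (Re (a + b) - A - 1) \<le> X powr R * (x - t) powr (v - 1)"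
        by (rule powr_bound_near_0) (use t' mm in \<open>auto simp: X_def\<close>)
    qed (use C(1) in \<open>auto intro!: mult_nonneg_nonneg\<close>)
    finally show "norm (inner_kernel a b p x y t) \<le> K * (t powr (u - 1) * (x - t) powr (v - 1))"
      by (simp add: K_def mult_ac)
  qed
qed

text \<open>The argument lies between 0 and 1, so the series bound applies and by
  \<open>outer_arg\<close> contributes the singularity \<open>(t - x) powr (- A)\<close>. The
  remaining factors grow at most polynomially, which is paid for by halving the decay rate from
  \<open>2 * q\<close> to \<open>q\<close>.\<close>

lemma outer_kernel_dominated:
  assumes adm: "admissible a0 b0 p0" and x: "x > 0" and y: "y > 0"
  obtains e G where "e > 0" "set_integrable lborel {x<..} G"
    "\<And>a b p t. \<lbrakk>norm (a - a0) \<le> e; norm (b - b0) \<le> e; norm (p - p0) \<le> e; t \<in> {x<..}\<rbrakk> \<Longrightarrow>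
       norm (outer_kernel a b p x y t) \<le> (G t :: real)"
proof -
  obtain e A u v q R where pos: "e > 0" "A > 0" "u > 0" "v > 0" "q > 0" "R > 0"
    and m: "\<And>a b p. \<lbrakk>norm (a - a0) \<le> e; norm (b - b0) \<le> e; norm (p - p0) \<le> e\<rbrakk> \<Longrightarrow>
       kernel_margin e A u v q R a b p"
    using admissible_margin[OF adm] by blast
  obtain C where C: "C > 0"
    "\<And>a b c z. \<lbrakk>norm a \<le> R; norm b \<le> R; Re c \<ge> 3 / 2; Re (a + b - c) \<le> A - e; norm z < 1\<rbrakk> \<Longrightarrow>
       norm (gauss_2F1 a b c z) \<le> C * (1 - norm z) powr (- A)"
    by (rule gauss_summable_bound[of "3/2" A e R]) (use pos in auto)
  \<comment> \<open>Gives \<open>w \<le> N * (1 + t)\<close> and \<open>1 / w \<le> N\<close> for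
    both \<open>w = t\<close> and \<open>w = y - x + t\<close>, so powers with exponents of either
    sign obey one bound.\<close>
  define N where "N = 1 + y + 1 / x + 1 / y"
  have N: "N \<ge> 1" "N \<ge> 1 + y" "N \<ge> 1 / x" "N \<ge> 1 / y" using x y by (auto simp: N_def add_nonneg_nonneg)
  \<comment> \<open>\<open>3 * R\<close> because three factors are each bounded through
    \<open>(N * (1 + t)) powr R\<close>: the powers of \<open>t\<close> and
    \<open>y - x + t\<close>, and the surplus power of \<open>t - x\<close>.\<close>
  obtain K where K: "K > 0" "\<And>t. t \<ge> 0 \<Longrightarrow> (1 + t) powr (3 * R) * exp (- (2 * q) * t) \<le> K * exp (- q * t)"
    using exp_dominates_powr[of q "3 * R"] pos by auto
  have poly: "w powr s \<le> (N * (1 + t)) powr R"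
    if "\<bar>s\<bar> \<le> R" "t > x" "w \<le> t + y" "w \<ge> x \<or> w \<ge> y" for w s t
  proof -
    have w0: "w > 0" using that x y by auto
    have "w powr s \<le> max w (1 / w) powr R" by (rule powr_bound_const[OF w0 that(1)])
    also have "\<dots> \<le> (N * (1 + t)) powr R"
    proof (rule powr_mono2)
      have "1 / w \<le> 1 / x \<or> 1 / w \<le> 1 / y" using that(4) x y by (auto intro!: divide_left_mono mult_pos_pos w0)
      then have a1: "1 / w \<le> N" using N by linarith
      have "t + y \<le> (1 + y) * (1 + t)" using that x y by (simp add: algebra_simps)
      also have "\<dots> \<le> N * (1 + t)" using N that x by (intro mult_right_mono) auto
      finally have a2: "w \<le> N * (1 + t)" using that by linarith
      have "N * 1 \<le> N * (1 + t)" using N that x by (intro mult_left_mono) auto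
      with a1 a2 show "max w (1 / w) \<le> N * (1 + t)" by simp
    qed (use pos w0 in \<open>auto simp: max_def\<close>)
    finally show ?thesis .
  qed
  show thesis
  proof (rule that[OF pos(1)])
    show "set_integrable lborel {x<..} (\<lambda>t. C * N powr (3 * R) * y powr (- A) * K * ((t - x) powr (v - 1) * exp (- q * t)))"
      by (intro set_integrable_mult_right outer_weight_integrable pos)
    fix a b p t
    assume h: "norm (a - a0) \<le> e" "norm (b - b0) \<le> e" "norm (p - p0) \<le> e" and t: "t \<in> {x<..}"
    note mm = m[OF h, unfolded kernel_margin_def]
    define z where "z = x * y / (t * (y - x + t))"
    have t': "x < t" "0 < t" using t x by auto
    have z1: "1 - z = (t - x) * (t + y) / (t * (y - x + t))" unfolding z_def by (rule outer_arg[OF x t'(1) y])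
    have z2: "0 < z" "z < 1" unfolding z_def using outer_arg_bounds[OF x t'(1) y] by auto
    have re: "Re (1 / 2 + b + a - 3 / 2) \<le> A - e" using mm by (simp add: algebra_simps)
    have "norm (hyp2F1 (1 / 2 + b) a (3 / 2) (of_real z)) = norm (gauss_2F1 (1 / 2 + b) a (3 / 2) (of_real z))"
      using z2 by (subst hyp2F1_eq_gauss) auto
    also have "\<dots> \<le> C * (1 - norm (of_real z :: complex)) powr (- A)"
      by (rule C(2)) (use mm re z2 in auto)
    also have "1 - norm (of_real z :: complex) = 1 - z" using z2 by simp
    also have "(1 - z) powr (- A) = (t - x) powr (- A) * (t + y) powr (- A) * (t powr A * (y - x + t) powr A)"
      using t' x y unfolding z1 by (subst powr_quotient) (auto simp: powr_mult)
    finally have F: "norm (hyp2F1 (1 / 2 + b) a (3 / 2) (of_real z)) \<le>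
        C * ((t - x) powr (- A) * (t + y) powr (- A) * (t powr A * (y - x + t) powr A))" .
    have "norm (outer_kernel a b p x y t) = exp (- Re p * t) * t powr (- Re a) * (t - x) powr (Re (a + b) - 1) *
        (y - x + t) powr (- Re b - 1 / 2) * norm (hyp2F1 (1 / 2 + b) a (3 / 2) (of_real z))"
      using t' y
      by (simp add: outer_kernel_def norm_mult norm_of_real_powr z_def
          del: of_real_diff of_real_add of_real_divide of_real_mult)
    also have "\<dots> \<le> exp (- (2 * q) * t) * t powr (- Re a) * (t - x) powr (Re (a + b) - 1) *
        (y - x + t) powr (- Re b - 1 / 2) * (C * ((t - x) powr (- A) * (t + y) powr (- A) * (t powr A * (y - x + t) powr A)))"
      using mm pos t' by (intro mult_mono F) (auto intro!: mult_nonneg_nonneg)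
    also have "\<dots> = C * exp (- (2 * q) * t) * (t + y) powr (- A) * ((t powr (- Re a) * t powr A) *
        ((y - x + t) powr (- Re b - 1 / 2) * (y - x + t) powr A) * ((t - x) powr (Re (a + b) - 1) * (t - x) powr (- A)))"
      by (simp add: mult_ac)
    also have "\<dots> = C * exp (- (2 * q) * t) * (t + y) powr (- A) * (t powr (A - Re a) *
        (y - x + t) powr (A - Re b - 1 / 2) * (t - x) powr ((Re (a + b) - A) - 1))"
      by (simp add: algebra_simps flip: powr_add)
    also have "\<dots> \<le> C * exp (- (2 * q) * t) * y powr (- A) * ((N * (1 + t)) powr R *
        (N * (1 + t)) powr R * ((N * (1 + t)) powr R * (t - x) powr (v - 1)))"
    proof (intro mult_mono)
      show "(t + y) powr (- A) \<le> y powr (- A)" using t' y pos by (intro powr_mono2') auto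
      show "t powr (A - Re a) \<le> (N * (1 + t)) powr R" by (rule poly) (use t' mm pos y in auto)
      show "(y - x + t) powr (A - Re b - 1 / 2) \<le> (N * (1 + t)) powr R"
        by (rule poly) (use t' mm pos x in auto)
      have "1 * (1 + t) \<le> N * (1 + t)" using N t' by (intro mult_right_mono) auto
      from order_trans[OF _ this, of "t - x"] order_trans[OF _ this, of 1] t' x
      have "t - x \<le> N * (1 + t)" "1 \<le> N * (1 + t)" by auto
      then show "(t - x) powr (Re (a + b) - A - 1) \<le> (N * (1 + t)) powr R * (t - x) powr (v - 1)"
        using mm t' by (intro powr_bound_near_0) linarith+
    qed (use C(1) in \<open>auto intro!: mult_nonneg_nonneg\<close>)
    also have "\<dots> = C * y powr (- A) * (t - x) powr (v - 1) * exp (- (2 * q) * t) *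
       ((N * (1 + t)) powr R * (N * (1 + t)) powr R * (N * (1 + t)) powr R)"
      by (simp add: mult_ac)
    also have "(N * (1 + t)) powr R * (N * (1 + t)) powr R * (N * (1 + t)) powr R = N powr (3 * R) * (1 + t) powr (3 * R)"
    proof -
      have "(N * (1 + t)) powr R * (N * (1 + t)) powr R * (N * (1 + t)) powr R = (N * (1 + t)) powr (3 * R)"
        by (simp flip: powr_add)
      also have "\<dots> = N powr (3 * R) * (1 + t) powr (3 * R)" by (rule powr_mult)
      finally show ?thesis .
    qed
    also have "C * y powr (- A) * (t - x) powr (v - 1) * exp (- (2 * q) * t) * (N powr (3 * R) * (1 + t) powr (3 * R)) =
       C * y powr (- A) * (t - x) powr (v - 1) * N powr (3 * R) * ((1 + t) powr (3 * R) * exp (- (2 * q) * t))"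
      by (simp add: mult_ac)
    also have "\<dots> \<le> C * y powr (- A) * (t - x) powr (v - 1) * N powr (3 * R) * (K * exp (- q * t))"
      by (rule mult_left_mono[OF K(2)]) (use t' C(1) in auto)
    finally show "norm (outer_kernel a b p x y t) \<le> C * N powr (3 * R) * y powr (- A) * K * ((t - x) powr (v - 1) * exp (- q * t))"
      by (simp add: mult_ac)
  qed
qed

section \<open>Integrability of the kernels and holomorphy of their integrals\<close>

lemma admissible_Re: "admissible a b p \<Longrightarrow> Re (3 / 2 - a + b) > 0"
  by (simp add: admissible_def)

lemma inner_kernel_integrable:
  assumes "admissible a b p" "x > 0" "y > 0"
  shows "set_integrable lborel {0<..<x} (inner_kernel a b p x y)"
proof -
  obtain e G where e: "e > 0" and G: "set_integrable lborel {0<..<x} G"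
    and b: "\<And>a' b' p' t. \<lbrakk>norm (a' - a) \<le> e; norm (b' - b) \<le> e; norm (p' - p) \<le> e; t \<in> {0<..<x}\<rbrakk> \<Longrightarrow>
       norm (inner_kernel a' b' p' x y t) \<le> (G t :: real)"
    using inner_kernel_dominated[OF assms] by blast
  show ?thesis
  proof (rule set_integrable_bound[OF G inner_kernel_measurable[OF admissible_Re[OF assms(1)] assms(3)]])
    have "norm (inner_kernel a b p x y t) \<le> norm (G t)" if "t \<in> {0<..<x}" for t
      using b[of a b p t] that e abs_ge_self[of "G t"] by simp
    then show "AE t in lborel. t \<in> {0<..<x} \<longrightarrow> norm (inner_kernel a b p x y t) \<le> norm (G t)" by simp
  qed
qed

lemma outer_kernel_integrable:
  assumes "admissible a b p" "x > 0" "y > 0"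
  shows "set_integrable lborel {x<..} (outer_kernel a b p x y)"
proof -
  obtain e G where e: "e > 0" and G: "set_integrable lborel {x<..} G"
    and b: "\<And>a' b' p' t. \<lbrakk>norm (a' - a) \<le> e; norm (b' - b) \<le> e; norm (p' - p) \<le> e; t \<in> {x<..}\<rbrakk> \<Longrightarrow>
       norm (outer_kernel a' b' p' x y t) \<le> (G t :: real)"
    using outer_kernel_dominated[OF assms] by blast
  show ?thesis
  proof (rule set_integrable_bound[OF G outer_kernel_measurable[OF assms(2,3)]])
    have "norm (outer_kernel a b p x y t) \<le> norm (G t)" if "t \<in> {x<..}" for t
      using b[of a b p t] that e abs_ge_self[of "G t"] by simp
    then show "AE t in lborel. t \<in> {x<..} \<longrightarrow> norm (outer_kernel a b p x y t) \<le> norm (G t)" by simp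
  qed
qed

lemma holomorphic_locally_close:
  assumes "open S" "a holomorphic_on S" "b holomorphic_on S" "p holomorphic_on S" "s0 \<in> S" "e > 0"
  obtains d :: real where "d > 0" "\<And>s. s \<in> ball s0 d \<inter> S \<Longrightarrow>
    norm (a s - a s0) \<le> e \<and> norm (b s - b s0) \<le> e \<and> norm (p s - p s0) \<le> e"
proof -
  obtain d1 where d1: "d1 > 0" "\<And>s. s\<in>cball s0 d1 \<Longrightarrow> norm (a s - a s0) \<le> e"
    using holomorphic_local_bounds[OF assms(1,2,5,6)] by blast
  obtain d2 where d2: "d2 > 0" "\<And>s. s\<in>cball s0 d2 \<Longrightarrow> norm (b s - b s0) \<le> e"
    using holomorphic_local_bounds[OF assms(1,3,5,6)] by blast
  obtain d3 where d3: "d3 > 0" "\<And>s. s\<in>cball s0 d3 \<Longrightarrow> norm (p s - p s0) \<le> e"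
    using holomorphic_local_bounds[OF assms(1,4,5,6)] by blast
  show thesis
    by (rule that[of "min d1 (min d2 d3)"]) (use d1 d2 d3 in auto)
qed

lemma holomorphic_on_inner_integral:
  assumes "open S" "a holomorphic_on S" "b holomorphic_on S" "p holomorphic_on S"
    and adm: "\<And>s. s \<in> S \<Longrightarrow> admissible (a s) (b s) (p s)" and x: "x > 0" and y: "y > 0"
  shows "(\<lambda>s. LINT t:{0<..<x}|lborel. inner_kernel (a s) (b s) (p s) x y t) holomorphic_on S"
proof (rule holomorphic_on_set_integral[OF assms(1)])
  show "set_borel_measurable lborel {0<..<x} (inner_kernel (a s) (b s) (p s) x y)" if "s \<in> S" for s
    by (rule inner_kernel_measurable[OF admissible_Re[OF adm[OF that]] y])
  show "(\<lambda>s. inner_kernel (a s) (b s) (p s) x y t) holomorphic_on S" if t: "t \<in> {0<..<x}" for t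
  proof -
    have "t * (x - y - t) / ((x - t) * (y + t)) \<le> 1 - y / (x + y)" by (rule inner_arg_le) (use t y in auto)
    moreover have "y / (x + y) > 0" using x y by simp
    ultimately have z: "t * (x - y - t) / ((x - t) * (y + t)) < 1" by linarith
    show ?thesis unfolding inner_kernel_def
      by (intro holomorphic_intros holomorphic_on_hyp2F1_params assms z) (use adm admissible_Re in auto)
  qed
  fix s0 assume s0: "s0 \<in> S"
  obtain e G where e: "e > 0" and G: "set_integrable lborel {0<..<x} G"
    and bd: "\<And>a' b' p' t. \<lbrakk>norm (a' - a s0) \<le> e; norm (b' - b s0) \<le> e; norm (p' - p s0) \<le> e; t \<in> {0<..<x}\<rbrakk> \<Longrightarrow>
       norm (inner_kernel a' b' p' x y t) \<le> (G t :: real)"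
    using inner_kernel_dominated[OF adm[OF s0] x y] by blast
  obtain d :: real where "d > 0" "\<And>s. s \<in> ball s0 d \<inter> S \<Longrightarrow>
    norm (a s - a s0) \<le> e \<and> norm (b s - b s0) \<le> e \<and> norm (p s - p s0) \<le> e"
    using holomorphic_locally_close[OF assms(1-4) s0 e] by blast
  with G bd show "\<exists>d>0. \<exists>G. set_integrable lborel {0<..<x} G \<and> (\<forall>s\<in>ball s0 d \<inter> S. \<forall>t\<in>{0<..<x}.
      norm (inner_kernel (a s) (b s) (p s) x y t) \<le> (G t :: real))" by blast
qed

lemma holomorphic_on_outer_integral:
  assumes "open S" "a holomorphic_on S" "b holomorphic_on S" "p holomorphic_on S"
    and adm: "\<And>s. s \<in> S \<Longrightarrow> admissible (a s) (b s) (p s)" and x: "x > 0" and y: "y > 0"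
  shows "(\<lambda>s. LINT t:{x<..}|lborel. outer_kernel (a s) (b s) (p s) x y t) holomorphic_on S"
proof (rule holomorphic_on_set_integral[OF assms(1)])
  show "set_borel_measurable lborel {x<..} (outer_kernel (a s) (b s) (p s) x y)" if "s \<in> S" for s
    by (rule outer_kernel_measurable[OF x y])
  show "(\<lambda>s. outer_kernel (a s) (b s) (p s) x y t) holomorphic_on S" if t: "t \<in> {x<..}" for t
  proof -
    have z: "x * y / (t * (y - x + t)) < 1" by (rule outer_arg_bounds) (use t x y in auto)
    show ?thesis unfolding outer_kernel_def
      by (intro holomorphic_intros holomorphic_on_hyp2F1_params assms z) auto
  qed
  fix s0 assume s0: "s0 \<in> S"
  obtain e G where e: "e > 0" and G: "set_integrable lborel {x<..} G"
    and bd: "\<And>a' b' p' t. \<lbrakk>norm (a' - a s0) \<le> e; norm (b' - b s0) \<le> e; norm (p' - p s0) \<le> e; t \<in> {x<..}\<rbrakk> \<Longrightarrow>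
       norm (outer_kernel a' b' p' x y t) \<le> (G t :: real)"
    using outer_kernel_dominated[OF adm[OF s0] x y] by blast
  obtain d :: real where "d > 0" "\<And>s. s \<in> ball s0 d \<inter> S \<Longrightarrow>
    norm (a s - a s0) \<le> e \<and> norm (b s - b s0) \<le> e \<and> norm (p s - p s0) \<le> e"
    using holomorphic_locally_close[OF assms(1-4) s0 e] by blast
  with G bd show "\<exists>d>0. \<exists>G. set_integrable lborel {x<..} G \<and> (\<forall>s\<in>ball s0 d \<inter> S. \<forall>t\<in>{x<..}.
      norm (outer_kernel (a s) (b s) (p s) x y t) \<le> (G t :: real))" by blast
qed

section \<open>Levy's formula and Laplace transforms\<close>

lemma gaussian_integral:
  "(\<lambda>u::real. exp (- u\<^sup>2)) absolutely_integrable_on UNIV \<and> integral UNIV (\<lambda>u::real. exp (- u\<^sup>2)) = sqrt pi"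
proof -
  have "has_bochner_integral lborel (\<lambda>u::real. exp (- u\<^sup>2)) (2 *\<^sub>R (sqrt pi / 2))"
    by (rule has_bochner_integral_even_function[OF gaussian_moment_0]) simp
  then have i: "integrable lborel (\<lambda>u::real. exp (- u\<^sup>2))" "(\<integral>u. exp (- u\<^sup>2) \<partial>lborel) = sqrt pi"
    by (auto simp: has_bochner_integral_iff)
  have s: "set_integrable lborel UNIV (\<lambda>u::real. exp (- u\<^sup>2))"
    using i by (simp add: set_integrable_def)
  have "set_integrable lebesgue UNIV (\<lambda>u::real. exp (- u\<^sup>2))"
    using i by (simp add: set_integrable_def integrable_completion)
  with set_borel_integral_eq_integral(2)[OF s] i show ?thesis
    by (simp add: set_lebesgue_integral_def)
qed

lemma powr_neg_half:
  fixes w :: real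
  assumes "w > 0"
  shows "w powr - (1/2) = 1 / sqrt w"
  using assms by (simp only: powr_minus powr_half_sqrt inverse_eq_divide less_imp_le)

text \<open>\<open>h w = s * sqrt w - k / sqrt w\<close> maps the half-line bijectively onto the
  real line, and \<open>(h w)^2 = s^2 * w + k^2 / w - 2 * s * k\<close>. The Gaussian integral
  therefore evaluates the integral of \<open>h' * E\<close>. Twice this integrand is
  \<open>f1 + f2\<close>, and an involution shows that both parts have the same integral, so that of
  \<open>f2\<close>, the wanted one up to a factor, is \<open>sqrt pi\<close>.\<close>

lemma levy_integral:
  fixes s k :: real
  assumes s: "s > 0" and k: "k > 0"
  shows "(\<integral>\<^sup>+w. ennreal (indicator {0<..} w * (w powr (-3/2) * exp (- (s\<^sup>2 * w) - k\<^sup>2 / w))) \<partial>lborel) =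
     ennreal (sqrt pi / k * exp (- 2 * s * k))"
proof -
  define h where "h = (\<lambda>w. s * w powr (1/2) - k * w powr (-1/2))"
  define h' where "h' = (\<lambda>w. (s * w powr (-1/2) + k * w powr (-3/2)) / 2)"
  define E where "E = (\<lambda>w. exp (- (h w)\<^sup>2))"
  have der: "(h has_field_derivative h' w) (at w within {0<..})" if "w \<in> {0<..}" for w
    unfolding h_def h'_def
    by (rule has_field_derivative_at_within)
      (use that in \<open>auto intro!: derivative_eq_intros simp: field_simps\<close>)
  have mono: "h v < h w" if "0 < v" "v < w" for v w
  proof -
    have "s * v powr (1/2) < s * w powr (1/2)" using that s by (simp add: powr_less_mono2)
    moreover have "k * v powr (-1/2) > k * w powr (-1/2)" using that k by (simp add: powr_less_mono2_neg)
    ultimately show ?thesis by (simp add: h_def)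
  qed
  then have inj: "inj_on h {0<..}"
    by (intro linorder_inj_onI') (metis greaterThan_iff less_irrefl)
  have im: "h ` {0<..} = UNIV"
  proof (intro equalityI subset_UNIV subsetI)
    fix u :: real
    \<comment> \<open>The positive root of \<open>s * z^2 - u * z - k = 0\<close>, so that
      \<open>w = z^2\<close> solves \<open>h w = u\<close>.\<close>
    define z where "z = (u + sqrt (u\<^sup>2 + 4 * s * k)) / (2 * s)"
    have "sqrt (u\<^sup>2) < sqrt (u\<^sup>2 + 4 * s * k)" using s k by (intro real_sqrt_less_mono) simp
    then have "u + sqrt (u\<^sup>2 + 4 * s * k) > 0" by simp
    then have z: "z > 0" using s by (simp add: z_def)
    have "(2 * s * z - u)\<^sup>2 = u\<^sup>2 + 4 * s * k" using s k by (simp add: z_def)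
    then have "s * (s * z * z - u * z - k) = 0" by (simp add: power2_eq_square algebra_simps)
    then have "s * z * z - k = u * z" using s by simp
    then have "s * z - k / z = u" using z by (simp add: field_simps)
    moreover have "(z\<^sup>2) powr (1/2) = z" using z by (simp add: powr_half_sqrt)
    moreover have "(z\<^sup>2) powr (-1/2) = 1 / z" using z by (simp add: powr_neg_half)
    ultimately have "u = h (z\<^sup>2)" by (simp add: h_def)
    then show "u \<in> h ` {0<..}" using z by (intro image_eqI[of _ _ "z\<^sup>2"]) auto
  qed
  have h'pos: "h' w \<ge> 0" for w using s k by (simp add: h'_def)
  have 1: "(\<lambda>w. h' w * E w) absolutely_integrable_on {0<..} \<and> integral {0<..} (\<lambda>w. h' w * E w) = sqrt pi"
    using has_absolute_integral_change_of_variables_1'[of "{0<..}" h h' "\<lambda>u. exp (- u\<^sup>2)" "sqrt pi", OF _ der inj]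
      gaussian_integral h'pos by (simp add: im E_def)
  define f1 where "f1 = (\<lambda>w. s * w powr (-1/2) * E w)"
  define f2 where "f2 = (\<lambda>w. k * w powr (-3/2) * E w)"
  have sum: "2 * (h' w * E w) = f1 w + f2 w" for w by (simp add: h'_def f1_def f2_def algebra_simps)
  have f0: "f1 w \<ge> 0" "f2 w \<ge> 0" for w using s k by (auto simp: f1_def f2_def E_def)
  have meas: "f1 \<in> borel_measurable borel" "f2 \<in> borel_measurable borel"
    unfolding f1_def f2_def E_def h_def by measurable
  have big: "set_integrable lebesgue {0<..} (\<lambda>w. 2 * (h' w * E w))"
    using 1 by (intro set_integrable_mult_right) auto
  have part: "set_integrable lebesgue {0<..} f" if "f \<in> borel_measurable borel" "\<And>w. 0 \<le> f w \<and> f w \<le> 2 * (h' w * E w)" for f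
  proof (rule set_integrable_bound[OF big])
    have "(\<lambda>w. indicator {0<..} w *\<^sub>R f w) \<in> borel_measurable borel" using that(1) by measurable
    then show "set_borel_measurable lebesgue {0<..} f"
      unfolding set_borel_measurable_def by (intro measurable_completion) simp
    show "AE w in lebesgue. w \<in> {0<..} \<longrightarrow> norm (f w) \<le> norm (2 * (h' w * E w))"
      using that(2) by (intro AE_I2) (smt (verit) real_norm_def)
  qed
  have i1: "set_integrable lebesgue {0<..} f1" by (rule part[OF meas(1)]) (use sum f0 in simp)
  have i2: "set_integrable lebesgue {0<..} f2" by (rule part[OF meas(2)]) (use sum f0 in simp)
  \<comment> \<open>\<open>sqrt c = k / s\<close> is the zero of \<open>h\<close>. The involution
    taking \<open>w\<close> to \<open>c / w\<close> fixes it, turns \<open>h\<close> into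
    \<open>- h\<close>, and with its Jacobian exchanges \<open>f1\<close> and
    \<open>f2\<close>.\<close>
  define c where "c = (k / s)\<^sup>2"
  have c: "c > 0" using s k by (simp add: c_def)
  have "integral {0<..} f1 = integral {0<..} f2"
  proof -
    have img: "(\<lambda>w. c / w) ` {0<..} = {0<..}"
    proof (intro equalityI subsetI)
      fix u :: real assume "u \<in> {0<..}"
      then show "u \<in> (\<lambda>w. c / w) ` {0<..}" using c by (intro image_eqI[of _ _ "c / u"]) auto
    qed (use c in auto)
    have "(\<lambda>w. \<bar>- c / w\<^sup>2\<bar> * f1 (c / w)) absolutely_integrable_on {0<..} \<and>
        integral {0<..} (\<lambda>w. \<bar>- c / w\<^sup>2\<bar> * f1 (c / w)) = integral {0<..} f1"
    proof (subst has_absolute_integral_change_of_variables_1'[where g="\<lambda>w. c / w"])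
      show "((\<lambda>w. c / w) has_real_derivative - c / w\<^sup>2) (at w within {0<..})" if "w \<in> {0<..}" for w
        using that by (auto intro!: derivative_eq_intros simp: power2_eq_square)
      show "inj_on (\<lambda>w. c / w) {0<..}" using c by (auto simp: inj_on_def)
    qed (use i1 img in auto)
    moreover have "\<bar>- c / w\<^sup>2\<bar> * f1 (c / w) = f2 w" if "w \<in> {0<..}" for w
    proof -
      define z where "z = sqrt w"
      have z: "z > 0" "w = z * z" using that by (auto simp: z_def)
      have p1: "w powr (1/2) = z" using that by (simp add: z_def powr_half_sqrt)
      have p2: "w powr (-1/2) = 1 / z" using that powr_neg_half[of w] by (simp add: z_def)
      have p3: "w powr (-3/2) = 1 / (z * z * z)"
      proof -
        have "w powr (-3/2) = w powr (-1/2 + - 1)" by simp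
        also have "\<dots> = w powr (-1/2) * w powr (- 1)" by (rule powr_add)
        also have "w powr (- 1) = 1 / w" using that by (simp add: powr_minus_divide)
        finally show ?thesis using p2 z by simp
      qed
      have q1: "(c / w) powr (1/2) = k / (s * z)"
      proof -
        have "(c / w) powr (1/2) = sqrt (c / w)" using c that by (intro powr_half_sqrt) simp
        also have "\<dots> = sqrt c / sqrt w" by (rule real_sqrt_divide)
        also have "sqrt c = k / s" using s k by (simp add: c_def)
        also have "sqrt w = z" by (rule z_def[symmetric])
        finally show ?thesis by simp
      qed
      have q2: "(c / w) powr (-1/2) = s * z / k"
      proof -
        have "c / w > 0" using c that by simp
        then have "(c / w) powr (-1/2) = 1 / (c / w) powr (1/2)"
          by (simp add: powr_neg_half powr_half_sqrt)
        then show ?thesis unfolding q1 by simp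
      qed
      have "h (c / w) = - h w" unfolding h_def p1 p2 q1 q2 using s k z by (simp add: field_simps)
      then have "E (c / w) = E w" by (simp add: E_def)
      then show ?thesis unfolding f1_def f2_def p3 q2 using s k z
        by (simp add: c_def power2_eq_square abs_mult divide_simps)
    qed
    ultimately show ?thesis using integral_cong[of "{0<..}" "\<lambda>w. \<bar>- c / w\<^sup>2\<bar> * f1 (c / w)" f2] by metis
  qed
  moreover have "integral {0<..} f1 + integral {0<..} f2 = 2 * sqrt pi"
  proof -
    have "integral {0<..} f1 + integral {0<..} f2 = integral {0<..} (\<lambda>w. f1 w + f2 w)"
      by (rule Henstock_Kurzweil_Integration.integral_add[symmetric])
        (use i1 i2 set_lebesgue_integral_eq_integral(1) in auto)
    also have "\<dots> = 2 * integral {0<..} (\<lambda>w. h' w * E w)" unfolding sum[symmetric] by simp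
    finally show ?thesis using 1 by simp
  qed
  ultimately have "integral {0<..} f2 = sqrt pi" by simp
  moreover have "f2 integrable_on {0<..}" using i2 by (rule set_lebesgue_integral_eq_integral(1))
  ultimately have "(f2 has_integral sqrt pi) {0<..}" by (metis integrable_integral)
  from has_integral_mult_right[OF this, of "exp (- 2 * s * k) / k"]
  have "((\<lambda>w. w powr (-3/2) * exp (- (s\<^sup>2 * w) - k\<^sup>2 / w)) has_integral (exp (- 2 * s * k) / k * sqrt pi)) {0<..}"
  proof (rule has_integral_eq[rotated])
    fix w :: real assume w: "w \<in> {0<..}"
    have p: "(w powr (1/2))\<^sup>2 = w" "(w powr (-1/2))\<^sup>2 = 1 / w" "w powr (1/2) * w powr (-1/2) = 1"
      using w by (simp_all add: powr_neg_half powr_half_sqrt power_divide)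
    have "(h w)\<^sup>2 = s\<^sup>2 * (w powr (1/2))\<^sup>2 + k\<^sup>2 * (w powr (-1/2))\<^sup>2 - 2 * s * k * (w powr (1/2) * w powr (-1/2))"
      unfolding h_def by (simp only: power2_eq_square) (simp add: algebra_simps)
    then have hw: "(h w)\<^sup>2 = s\<^sup>2 * w + k\<^sup>2 / w - 2 * s * k" unfolding p by simp
    have "exp (- 2 * s * k) * E w = exp (- (s\<^sup>2 * w) - k\<^sup>2 / w)"
      unfolding E_def hw by (simp flip: exp_add)
    then have "exp (- 2 * s * k) / k * f2 w = (k / k) * w powr (-3/2) * exp (- (s\<^sup>2 * w) - k\<^sup>2 / w)"
      by (simp add: f2_def)
    then show "exp (- 2 * s * k) / k * f2 w = w powr (-3/2) * exp (- (s\<^sup>2 * w) - k\<^sup>2 / w)" using k by simp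
  qed
  from nn_integral_has_integral_lebesgue[OF _ this] show ?thesis
    by (simp add: mult.commute)
qed

lemma gamma_integral_scaled:
  fixes s l :: real
  assumes s: "s > 0" and l: "l > 0"
  shows "(\<integral>\<^sup>+r. ennreal (indicator {0<..} r * (r powr (s - 1) * exp (- (l * r)))) \<partial>lborel) =
     ennreal (Gamma s * l powr (- s))"
proof -
  let ?k = "\<lambda>r. ennreal (indicator {0<..} r * (r powr (s - 1) * exp (- (l * r))))"
  define g where "g = (\<lambda>r::real. ennreal (indicator {0<..} r * (r powr (s - 1) * exp (- r))))"
  have "ennreal (Gamma s) = (\<integral>\<^sup>+r. ennreal (indicator {0..} r * r powr (s - 1) / exp r) \<partial>lborel)"
    by (rule Gamma_conv_nn_integral_real[OF s])
  also have "\<dots> = (\<integral>\<^sup>+r. g r \<partial>lborel)"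
    by (rule nn_integral_cong) (auto simp: g_def indicator_def exp_minus divide_inverse)
  also have "\<dots> = \<bar>l\<bar> * (\<integral>\<^sup>+r. g (0 + l * r) \<partial>lborel)"
    by (rule nn_integral_real_affine) (use l in \<open>auto simp: g_def\<close>)
  also have "\<dots> = (\<integral>\<^sup>+r. ennreal l * g (l * r) \<partial>lborel)"
    using l by (subst nn_integral_cmult) (auto simp: g_def)
  also have "\<dots> = (\<integral>\<^sup>+r. ennreal (l powr s) * ?k r \<partial>lborel)"
  proof (rule nn_integral_cong)
    fix r :: real
    have "l * (l * r) powr (s - 1) = l powr s * r powr (s - 1)"
    proof -
      have "l * l powr (s - 1) = l powr s" using l by (simp add: powr_diff)
      then show ?thesis by (simp add: powr_mult flip: mult.assoc)
    qed
    then show "ennreal l * g (l * r) = ennreal (l powr s) * ?k r"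
      using l by (auto simp: g_def indicator_def zero_less_mult_iff mult.assoc simp flip: ennreal_mult')
  qed
  also have "\<dots> = ennreal (l powr s) * (\<integral>\<^sup>+r. ?k r \<partial>lborel)"
    by (rule nn_integral_cmult) auto
  finally have *: "ennreal (Gamma s) = ennreal (l powr s) * (\<integral>\<^sup>+r. ?k r \<partial>lborel)" .
  have "ennreal (Gamma s * l powr (- s)) = ennreal (l powr (- s)) * ennreal (Gamma s)"
    using s by (simp add: mult.commute flip: ennreal_mult')
  also have "\<dots> = ennreal (l powr (- s)) * ennreal (l powr s) * (\<integral>\<^sup>+r. ?k r \<partial>lborel)"
    unfolding * by (simp only: mult.assoc)
  also have "ennreal (l powr (- s)) * ennreal (l powr s) = 1"
    using l by (simp flip: ennreal_mult' powr_add)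
  finally show ?thesis by simp
qed

text \<open>The weight of Euler's integral for Kummer's function with parameters \<open>a\<close>
  and 3/2, rescaled and reflected to \<open>0 < v < x\<close>. Nonnegative extended values with the
  support built in make transforms and convolutions integrals over the whole line that are always
  defined.\<close>

definition kummer_weight :: "real \<Rightarrow> real \<Rightarrow> real \<Rightarrow> ennreal" where
  "kummer_weight a x v = ennreal (indicator {0<..<x} v * ((x - v) powr (a - 1) * v powr (1/2 - a)))"

text \<open>Its Laplace transform is \<open>Gamma b / sqrt y\<close> times Tricomi's confluent
  function \<open>U(b, 1/2, y * p)\<close>.\<close>

definition tricomi_weight :: "real \<Rightarrow> real \<Rightarrow> real \<Rightarrow> ennreal" where
  "tricomi_weight b y u = ennreal (indicator {0<..} u * (u powr (b - 1) * (y + u) powr (- b - 1/2)))"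

definition kummer_phi_real :: "real \<Rightarrow> real \<Rightarrow> real \<Rightarrow> real" where
  "kummer_phi_real a c w = (\<Sum>n. kummer_term a c w n)"

section \<open>Laplace transforms of the two weights\<close>

lemma kummer_phi_real:
  assumes "c > 0"
  shows "(\<lambda>n. kummer_term a c w n) sums kummer_phi_real a c w"
    and "kummer_phi (of_real a) (of_real c) (of_real w) = of_real (kummer_phi_real a c w)"
proof -
  have "(\<lambda>n. kummer_term (of_real a) (of_real c) (of_real w) n)
      sums kummer_phi (of_real a) (of_real c) (of_real w)"
    by (rule kummer_phi_sums) (use assms in simp)
  moreover have "kummer_term (of_real a) (of_real c) (of_real w) n =
      complex_of_real (kummer_term a c w n)" for n
    by (simp add: pochhammer_of_real)
  ultimately have s: "(\<lambda>n. complex_of_real (kummer_term a c w n))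
      sums kummer_phi (of_real a) (of_real c) (of_real w)" by simp
  from sums_Re[OF s] have "(\<lambda>n. kummer_term a c w n) sums
      Re (kummer_phi (of_real a) (of_real c) (of_real w))" by (simp only: Re_complex_of_real)
  then show s1: "(\<lambda>n. kummer_term a c w n) sums kummer_phi_real a c w"
    unfolding kummer_phi_real_def by (rule sums_summable[THEN summable_sums])
  from sums_of_real[OF s1, where ?'a=complex] s
  show "kummer_phi (of_real a) (of_real c) (of_real w) = of_real (kummer_phi_real a c w)"
    by (rule sums_unique2[symmetric])
qed

lemma Gamma_add_nat_real: "(b::real) > 0 \<Longrightarrow> Gamma (b + real k) = Gamma b * pochhammer b k"
proof -
  assume b: "b > 0"
  then have "b \<notin> \<int>\<^sub>\<le>\<^sub>0" by (auto elim!: nonpos_Ints_cases)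
  from pochhammer_Gamma[OF this, of k] Gamma_real_pos[OF b]
  show "Gamma (b + real k) = Gamma b * pochhammer b k" by simp
qed

text \<open>Uses \<open>(2 k)! = 4^k (1/2)_k k!\<close>: the powers of 4 go into the argument
  \<open>m^2 / 4\<close>, and 1/2 becomes the denominator parameter.\<close>

lemma gamma_series_even:
  fixes b m :: real
  assumes "b > 0"
  shows "(\<lambda>k. m ^ (2 * k) / fact (2 * k) * Gamma (b + real k)) sums (Gamma b * kummer_phi_real b (1/2) (m\<^sup>2 / 4))"
proof -
  have "m ^ (2 * k) / fact (2 * k) * Gamma (b + real k) =
      Gamma b * (pochhammer b k / pochhammer (1/2) k * (m\<^sup>2 / 4) ^ k / fact k)" for k
  proof -
    have e: "m ^ (2 * k) = (m\<^sup>2) ^ k" "(2::real) ^ (2 * k) = 4 ^ k" by (simp_all add: power_mult)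
    show ?thesis
      unfolding fact_double[of k] Gamma_add_nat_real[OF assms] e power_divide by (simp add: mult_ac)
  qed
  then show ?thesis using sums_mult[OF kummer_phi_real(1)[of "1/2" b "m\<^sup>2/4"], of "Gamma b"] by simp
qed

text \<open>Here \<open>(2 k + 1)! = 4^k (3/2)_k k!\<close> produces the denominator parameter
  3/2.\<close>

lemma gamma_series_odd:
  fixes b m :: real
  assumes "b > 0"
  shows "(\<lambda>k. m ^ (2 * k + 1) / fact (2 * k + 1) * Gamma (b + 1/2 + real k)) sums
     (m * Gamma (b + 1/2) * kummer_phi_real (b + 1/2) (3/2) (m\<^sup>2 / 4))"
proof -
  have "m ^ (2 * k + 1) / fact (2 * k + 1) * Gamma (b + 1/2 + real k) =
      m * Gamma (b + 1/2) * (pochhammer (b + 1/2) k / pochhammer (3/2) k * (m\<^sup>2 / 4) ^ k / fact k)" for k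
  proof -
    have "pochhammer (1/2) (Suc k) = 1/2 * pochhammer (1/2 + 1 :: real) k" by (rule pochhammer_rec)
    then have p: "pochhammer (1/2 :: real) k * (2 * real k + 1) = pochhammer (3/2) k"
      by (simp add: pochhammer_Suc field_simps)
    have "fact (2 * k + 1) = (2 * real k + 1) * (fact (2 * k) :: real)" by (simp add: algebra_simps)
    also have "\<dots> = 2 ^ (2 * k) * (pochhammer (1/2) k * (2 * real k + 1)) * fact k"
      unfolding fact_double[of k] by (simp add: mult_ac)
    finally have f: "fact (2 * k + 1) = (2 ^ (2 * k) * pochhammer (3/2) k * fact k :: real)" unfolding p .
    have g: "Gamma (b + 1/2 + real k) = Gamma (b + 1/2) * pochhammer (b + 1/2) k"
      by (rule Gamma_add_nat_real) (use assms in simp)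
    have e: "m ^ (2 * k) = (m\<^sup>2) ^ k" "(2::real) ^ (2 * k) = 4 ^ k" by (simp_all add: power_mult)
    show ?thesis unfolding f g e power_divide power_add power_one_right by (simp add: mult_ac)
  qed
  then show ?thesis
    using sums_mult[OF kummer_phi_real(1)[of "3/2" "b + 1/2" "m\<^sup>2/4"], of "m * Gamma (b + 1/2)"] by simp
qed

lemma gamma_kernel_integral:
  fixes s :: real
  assumes "s > 0"
  shows "has_bochner_integral lborel (\<lambda>r. indicator {0<..} r * (r powr (s - 1) * exp (- r))) (Gamma s)"
  by (rule has_bochner_integral_nn_integral)
    (use gamma_integral_scaled[OF assms zero_less_one] Gamma_real_pos[OF assms] in auto)

text \<open>Expanding \<open>exp (- (m * sqrt r))\<close> in powers leads to the Gamma values at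
  \<open>b + n / 2\<close>; even and odd \<open>n\<close> collect into the two Kummer functions
  occurring in \<open>parabolic_D\<close>. With \<open>r\<close> a square this is the Gaussian
  integral for the parabolic cylinder function.\<close>

lemma gamma_exp_sqrt_integral:
  fixes b m :: real
  assumes b: "b > 0" and m: "m \<ge> 0"
  shows "(\<integral>\<^sup>+r. ennreal (indicator {0<..} r * (r powr (b - 1) * exp (- r) * exp (- (m * sqrt r)))) \<partial>lborel) =
     ennreal (Gamma b * kummer_phi_real b (1/2) (m\<^sup>2 / 4) - m * Gamma (b + 1/2) * kummer_phi_real (b + 1/2) (3/2) (m\<^sup>2 / 4))"
    (is "_ = ennreal (?e - ?o)")
    and "Gamma b * kummer_phi_real b (1/2) (m\<^sup>2 / 4) - m * Gamma (b + 1/2) * kummer_phi_real (b + 1/2) (3/2) (m\<^sup>2 / 4) \<ge> 0"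
proof -
  define f where "f = (\<lambda>n r. (- m) ^ n / fact n * (indicator {0<..} r * (r powr (b + real n / 2 - 1) * exp (- r))))"
  have hb: "has_bochner_integral lborel (f n) ((- m) ^ n / fact n * Gamma (b + real n / 2))" for n
    unfolding f_def by (intro has_bochner_integral_mult_right gamma_kernel_integral) (use b in \<open>simp add: add_pos_nonneg\<close>)
  have nf: "norm (f n r) = m ^ n / fact n * (indicator {0<..} r * (r powr (b + real n / 2 - 1) * exp (- r)))" for n r
    using m by (simp add: f_def abs_mult power_abs)
  have hn: "(\<integral>r. norm (f n r) \<partial>lborel) = m ^ n / fact n * Gamma (b + real n / 2)" for n
    unfolding nf by (intro has_bochner_integral_integral_eq has_bochner_integral_mult_right gamma_kernel_integral)
      (use b in \<open>simp add: add_pos_nonneg\<close>)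
  have half: "b + real (2 * k) / 2 = b + real k" "b + real (2 * k + 1) / 2 = b + 1/2 + real k" for k by simp_all
  \<comment> \<open>Stated for both square roots of \<open>m^2\<close>: \<open>u = m\<close> sums
    the integrals of absolute values and so justifies termwise integration, \<open>u = - m\<close>
    gives the value.\<close>
  have comb: "(\<lambda>n. u ^ n / fact n * Gamma (b + real n / 2)) sums
     (Gamma b * kummer_phi_real b (1/2) (m\<^sup>2 / 4) + u * Gamma (b + 1/2) * kummer_phi_real (b + 1/2) (3/2) (m\<^sup>2 / 4))"
    if u: "u\<^sup>2 = m\<^sup>2" for u :: real
  proof -
    have "(\<lambda>n. if even n then u ^ (2 * (n div 2)) / fact (2 * (n div 2)) * Gamma (b + real (n div 2))
           else u ^ (2 * ((n - 1) div 2) + 1) / fact (2 * ((n - 1) div 2) + 1) * Gamma (b + 1/2 + real ((n - 1) div 2)))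
       sums (u * Gamma (b + 1/2) * kummer_phi_real (b + 1/2) (3/2) (u\<^sup>2 / 4) + Gamma b * kummer_phi_real b (1/2) (u\<^sup>2 / 4))"
      using sums_if[OF gamma_series_odd[OF b, of u] gamma_series_even[OF b, of u]] by simp
    moreover have "(if even n then u ^ (2 * (n div 2)) / fact (2 * (n div 2)) * Gamma (b + real (n div 2))
           else u ^ (2 * ((n - 1) div 2) + 1) / fact (2 * ((n - 1) div 2) + 1) * Gamma (b + 1/2 + real ((n - 1) div 2))) =
        u ^ n / fact n * Gamma (b + real n / 2)" for n
    proof (cases "even n")
      case True
      then obtain k where "n = 2 * k" by blast
      then show ?thesis by simp
    next
      case False
      then obtain k where "n = 2 * k + 1" by (metis oddE)
      then have *: "b + real n / 2 = b + 1/2 + real k" using half(2)[of k] by simp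
      show ?thesis unfolding * using \<open>n = 2 * k + 1\<close> by simp
    qed
    ultimately show ?thesis by (simp add: u add.commute)
  qed
  have s: "(\<lambda>n. integral\<^sup>L lborel (f n)) sums (\<integral>r. (\<Sum>n. f n r) \<partial>lborel)"
    and i: "integrable lborel (\<lambda>r. \<Sum>n. f n r)"
  proof -
    have 1: "integrable lborel (f n)" for n using hb by (simp add: has_bochner_integral_iff)
    have 2: "AE r in lborel. summable (\<lambda>n. norm (f n r))"
    proof (rule AE_I2)
      fix r :: real
      have "m ^ n / fact n * (indicator {0<..} r * (r powr (b + real n / 2 - 1) * exp (- r))) =
         (m * sqrt r) ^ n / fact n * (indicator {0<..} r * (r powr (b - 1) * exp (- r)))" for n
      proof (cases "r > 0")
        case True
        then have "r powr (b + real n / 2 - 1) = r powr (b - 1) * sqrt r ^ n"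
          by (simp add: powr_half_sqrt[symmetric] powr_powr powr_realpow[symmetric] algebra_simps flip: powr_add)
        then show ?thesis by (simp add: power_mult_distrib)
      qed simp
      then show "summable (\<lambda>n. norm (f n r))"
        unfolding nf by (simp only:) (intro summable_mult2 summable_power_over_fact)
    qed
    have 3: "summable (\<lambda>n. \<integral>r. norm (f n r) \<partial>lborel)"
      unfolding hn using comb[OF refl] by (auto simp: sums_iff)
    show "(\<lambda>n. integral\<^sup>L lborel (f n)) sums (\<integral>r. (\<Sum>n. f n r) \<partial>lborel)" by (rule sums_integral[OF 1 2 3])
    show "integrable lborel (\<lambda>r. \<Sum>n. f n r)" by (rule integrable_suminf[OF 1 2 3])
  qed
  have fs: "(\<Sum>n. f n r) = indicator {0<..} r * (r powr (b - 1) * exp (- r) * exp (- (m * sqrt r)))" for r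
  proof (cases "r > 0")
    case True
    have t: "f n r = ((- (m * sqrt r)) ^ n / fact n) * (r powr (b - 1) * exp (- r))" for n
    proof -
      have "r powr (b + real n / 2 - 1) = r powr (b - 1) * sqrt r ^ n"
        using True by (simp add: powr_half_sqrt[symmetric] powr_powr powr_realpow[symmetric] algebra_simps flip: powr_add)
      moreover have "(- (m * sqrt r)) ^ n = (- m) ^ n * sqrt r ^ n" by (simp flip: power_mult_distrib)
      ultimately show ?thesis using True by (simp add: f_def)
    qed
    have "(\<lambda>n. (- (m * sqrt r)) ^ n / fact n) sums exp (- (m * sqrt r))"
      using exp_converges[of "- (m * sqrt r)"] by (simp add: scaleR_conv_of_real field_simps)
    from sums_mult2[OF this, of "r powr (b - 1) * exp (- r)"] show ?thesis
      using True unfolding t by (simp add: sums_iff)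
  qed (simp add: f_def)
  have "integral\<^sup>L lborel (f n) = (- m) ^ n / fact n * Gamma (b + real n / 2)" for n
    using hb by (simp add: has_bochner_integral_iff)
  with s comb[of "- m"] have v: "(\<integral>r. (\<Sum>n. f n r) \<partial>lborel) = ?e - ?o"
    by (simp add: sums_iff)
  have nn: "(\<Sum>n. f n r) \<ge> 0" for r unfolding fs by simp
  show "?e - ?o \<ge> 0" unfolding v[symmetric] by (rule Bochner_Integration.integral_nonneg) (rule nn)
  show "(\<integral>\<^sup>+r. ennreal (indicator {0<..} r * (r powr (b - 1) * exp (- r) * exp (- (m * sqrt r)))) \<partial>lborel) = ennreal (?e - ?o)"
    using nn_integral_eq_integral[OF i] nn v unfolding fs by simp
qed

text \<open>\<open>exp (- (m * sqrt r))\<close> is replaced by Levy's integral with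
  \<open>s = sqrt p\<close> and \<open>k = sqrt (y * r)\<close>. After the exchange of integrals,
  the one over \<open>r\<close> is a Gamma integral with rate \<open>1 + y / w\<close>, which
  produces \<open>(y + w) powr (- b - 1/2)\<close>. The outcome is the connection formula between
  Tricomi's function and the two Kummer functions.\<close>

lemma tricomi_laplace:
  fixes b p y :: real
  assumes b: "b > 0" and p: "p > 0" and y: "y > 0"
  obtains U where "U \<ge> 0"
    "(\<integral>\<^sup>+w. ennreal (indicator {0<..} w * (w powr (b - 1) * (y + w) powr (- b - 1/2))) * ennreal (exp (- p * w)) \<partial>lborel) = ennreal U"
    "sqrt y * U = Gamma b * (sqrt pi / Gamma (b + 1/2) * kummer_phi_real b (1/2) (y * p)
        - 2 * sqrt pi * sqrt (y * p) / Gamma b * kummer_phi_real (b + 1/2) (3/2) (y * p))"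
proof -
  let ?H = "\<lambda>w. ennreal (indicator {0<..} w * (w powr (b - 1) * (y + w) powr (- b - 1/2))) * ennreal (exp (- p * w))"
  let ?G = "\<lambda>r w. ennreal (indicator {0<..} r * (r powr (b - 1) * exp (- r) * (sqrt (y *
      r) / sqrt pi))) * ennreal (indicator {0<..} w * (w powr (-3/2) * exp (- (p * w) - y * r / w)))"
  define m where "m = 2 * sqrt (y * p)"
  have m: "m \<ge> 0" "m\<^sup>2 / 4 = y * p" using y p by (auto simp: m_def power_mult_distrib)
  define V where "V = Gamma b * kummer_phi_real b (1/2) (y * p) - m * Gamma (b + 1/2) * kummer_phi_real (b + 1/2) (3/2) (y * p)"
  define I where "I = (\<integral>\<^sup>+w. ?H w \<partial>lborel)"
  \<comment> \<open>\<open>sqrt (y / pi)\<close> stems from the reciprocal of the prefactor in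
    Levy's formula, the Gamma value from the integral over \<open>r\<close>.\<close>
  define c where "c = sqrt (y / pi) * Gamma (b + 1/2)"
  have g: "Gamma (b + 1/2) > 0" "Gamma b > 0" using b by (auto intro: Gamma_real_pos)
  have c: "c > 0" using y g by (simp add: c_def)
  have V: "V \<ge> 0" using gamma_exp_sqrt_integral(2)[OF b m(1)] by (simp add: V_def m)
  have "ennreal V = (\<integral>\<^sup>+r. ennreal (indicator {0<..} r * (r powr (b - 1) * exp (- r) * exp (- (m * sqrt r)))) \<partial>lborel)"
    using gamma_exp_sqrt_integral(1)[OF b m(1)] by (simp add: V_def m)
  also have "\<dots> = (\<integral>\<^sup>+r. (\<integral>\<^sup>+w. ?G r w \<partial>lborel) \<partial>lborel)"
  proof (rule nn_integral_cong)
    fix r :: real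
    show "ennreal (indicator {0<..} r * (r powr (b - 1) * exp (- r) * exp (- (m * sqrt r)))) =
      (\<integral>\<^sup>+w. ?G r w \<partial>lborel)"
    proof (cases "r > 0")
      case True
      have k: "sqrt (y * r) > 0" "sqrt p > 0" using True y p by auto
      have "(\<integral>\<^sup>+w. ennreal (indicator {0<..} w * (w powr (-3/2) * exp (- (p * w) - y * r / w))) \<partial>lborel) =
          ennreal (sqrt pi / sqrt (y * r) * exp (- 2 * sqrt p * sqrt (y * r)))"
        using levy_integral[OF k(2,1)] p y True by simp
      moreover have "2 * sqrt p * sqrt (y * r) = m * sqrt r" by (simp add: m_def real_sqrt_mult)
      ultimately have "(\<integral>\<^sup>+w. ennreal (indicator {0<..} w * (w powr (-3/2) * exp (- (p * w) - y * r / w))) \<partial>lborel) =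
          ennreal (sqrt pi / sqrt (y * r) * exp (- (m * sqrt r)))" by simp
      then show ?thesis using True k
        by (subst nn_integral_cmult) (auto simp flip: ennreal_mult')
    qed simp
  qed
  also have "\<dots> = (\<integral>\<^sup>+w. (\<integral>\<^sup>+r. ?G r w \<partial>lborel) \<partial>lborel)"
    by (rule lborel_pair.Fubini') simp
  also have "\<dots> = (\<integral>\<^sup>+w. ennreal c * (?H w) \<partial>lborel)"
  proof (rule nn_integral_cong)
    fix w :: real
    show "(\<integral>\<^sup>+r. ?G r w \<partial>lborel) =
      ennreal c * (?H w)"
    proof (cases "w > 0")
      case w: True
      have l: "1 + y / w > 0" using w y by (simp add: add_pos_pos)
      have "(\<integral>\<^sup>+r. ?G r w \<partial>lborel) =
        (\<integral>\<^sup>+r. ennreal (sqrt (y / pi) * w powr (-3/2) * exp (- p * w)) *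
          ennreal (indicator {0<..} r * (r powr ((b + 1/2) - 1) * exp (- ((1 + y / w) * r)))) \<partial>lborel)"
      proof (rule nn_integral_cong)
        fix r :: real
        show "?G r w =
          ennreal (sqrt (y / pi) * w powr (-3/2) * exp (- p * w)) *
          ennreal (indicator {0<..} r * (r powr ((b + 1/2) - 1) * exp (- ((1 + y / w) * r))))"
        proof (cases "r > 0")
          case r: True
          have e1: "r powr ((b + 1/2) - 1) = r powr (b - 1) * sqrt r"
          proof -
            have "r powr ((b + 1/2) - 1) = r powr ((b - 1) + 1/2)" by (simp add: algebra_simps)
            also have "\<dots> = r powr (b - 1) * sqrt r" using r by (simp only: powr_add powr_half_sqrt less_imp_le)
            finally show ?thesis .
          qed
          have e2: "exp (- r) * exp (- (p * w) - y * r / w) = exp (- p * w) * exp (- ((1 + y / w) * r))"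
            by (simp add: algebra_simps flip: exp_add)
          have "r powr (b - 1) * exp (- r) * (sqrt (y * r) / sqrt pi) * (w powr (-3/2) * exp (- (p * w) - y * r / w)) =
             sqrt (y / pi) * w powr (-3/2) * (r powr (b - 1) * sqrt r) * (exp (- r) * exp (- (p * w) - y * r / w))"
            by (simp add: real_sqrt_mult real_sqrt_divide mult_ac)
          also have "\<dots> = sqrt (y / pi) * w powr (-3/2) * exp (- p * w) * (r powr ((b + 1/2) - 1) * exp (- ((1 + y / w) * r)))"
            unfolding e1 e2 by (simp only: mult_ac)
          finally show ?thesis using r w y by (simp flip: ennreal_mult')
        qed simp
      qed
      also have "\<dots> = ennreal (sqrt (y / pi) * w powr (-3/2) * exp (- p * w)) * ennreal (Gamma (b + 1/2) * (1 + y / w) powr (- (b + 1/2)))"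
        using gamma_integral_scaled[of "b + 1/2" "1 + y / w"] b l by (subst nn_integral_cmult) auto
      also have "\<dots> = ennreal (c * (w powr (b - 1) * (y + w) powr (- b - 1/2) * exp (- p * w)))"
      proof -
        have "1 + y / w = (y + w) / w" using w by (simp add: field_simps)
        then have "(1 + y / w) powr (- (b + 1/2)) = (y + w) powr (- (b + 1/2)) / w powr (- (b + 1/2))"
          using w y by (simp only: powr_divide)
        also have "w powr (- (b + 1/2)) = 1 / w powr (b + 1/2)" by (rule powr_minus_divide)
        finally have A: "(1 + y / w) powr (- (b + 1/2)) = (y + w) powr (- (b + 1/2)) * w powr (b + 1/2)"
          by (simp only: divide_divide_eq_right div_by_1)
        have B: "w powr (-3/2) * w powr (b + 1/2) = w powr (b - 1)"
          by (simp add: algebra_simps flip: powr_add)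
        have C: "- (b + 1/2) = - b - 1/2" by simp
        have "sqrt (y / pi) * w powr (-3/2) * exp (- p * w) * (Gamma (b + 1/2) * (1 + y / w) powr (- (b + 1/2))) =
            c * ((w powr (-3/2) * w powr (b + 1/2)) * (y + w) powr (- (b + 1/2)) * exp (- p * w))"
          unfolding A c_def by (simp only: mult_ac)
        then have R: "sqrt (y / pi) * w powr (-3/2) * exp (- p * w) * (Gamma (b + 1/2) * (1 + y / w) powr (- (b + 1/2))) =
            c * (w powr (b - 1) * (y + w) powr (- b - 1/2) * exp (- p * w))"
          unfolding B C .
        show ?thesis by (subst ennreal_mult'[symmetric], use y in simp, simp only: R)
      qed
      finally show ?thesis using w c by (simp flip: ennreal_mult')
    qed simp
  qed
  also have "\<dots> = ennreal c * I" unfolding I_def by (rule nn_integral_cmult) simp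
  finally have VI: "ennreal V = ennreal c * I" .
  have "ennreal (V / c) = ennreal (1 / c) * ennreal V" using c V by (simp flip: ennreal_mult')
  also have "\<dots> = ennreal (1 / c) * ennreal c * I" unfolding VI by (simp only: mult.assoc)
  also have "ennreal (1 / c) * ennreal c = 1" using c by (simp flip: ennreal_mult')
  finally have I: "I = ennreal (V / c)" by simp
  show thesis
  proof (rule that[of "V / c"])
    show "V / c \<ge> 0" using V c by simp
    show "(\<integral>\<^sup>+w. ?H w \<partial>lborel) = ennreal (V / c)"
      using I by (simp add: I_def)
    have sy: "sqrt y > 0" using y by simp
    have "sqrt y * (V / c) = V * sqrt pi / Gamma (b + 1/2)"
      using sy g by (simp add: c_def real_sqrt_divide)
    also have "\<dots> = Gamma b * (sqrt pi / Gamma (b + 1/2) * kummer_phi_real b (1/2) (y * p)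
        - 2 * sqrt pi * sqrt (y * p) / Gamma b * kummer_phi_real (b + 1/2) (3/2) (y * p))"
      using g by (simp add: V_def m_def field_simps)
    finally show "sqrt y * (V / c) = Gamma b * (sqrt pi / Gamma (b + 1/2) * kummer_phi_real b (1/2) (y * p)
        - 2 * sqrt pi * sqrt (y * p) / Gamma b * kummer_phi_real (b + 1/2) (3/2) (y * p))" .
  qed
qed

text \<open>With \<open>v = x * (1 - s)\<close> the exponential becomes
  \<open>exp (- p * x) * exp (p * x * s)\<close>, whose series integrates to the values
  \<open>Beta (a + n) (3/2 - a)\<close>. All terms are nonnegative, so termwise integration is
  monotone convergence.\<close>

lemma kummer_laplace:
  fixes a p x :: real
  assumes a: "0 < a" "a < 3/2" and p: "p > 0" and x: "x > 0"
  shows "(\<integral>\<^sup>+v. ennreal (indicator {0<..<x} v * ((x - v) powr (a - 1) * v powr (1/2 - a))) * ennreal (exp (- p * v)) \<partial>lborel) =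
     ennreal (exp (- p * x) * sqrt x * Beta a (3/2 - a) * kummer_phi_real a (3/2) (p * x))"
    and "kummer_phi_real a (3/2) (p * x) \<ge> 0"
proof -
  let ?K = "\<lambda>s. (ennreal (indicator {0<..<x} (x + - x * s) * ((x - (x + - x * s)) powr (a - 1) *
      (x + - x * s) powr (1/2 - a))) * ennreal (exp (- p * (x + - x * s))))"
  define d where "d = 3/2 - a"
  have d: "d > 0" using a by (simp add: d_def)
  have g: "Beta a d > 0" using a d by (simp add: Beta_def Gamma_real_pos)
  define w where "w = p * x"
  have w: "w > 0" using p x by (simp add: w_def)
  have nn: "kummer_term a (3/2) w n \<ge> 0" for n
    using a w by (intro divide_nonneg_nonneg mult_nonneg_nonneg pochhammer_nonneg) auto
  have ks: "(\<lambda>n. kummer_term a (3/2) w n) sums kummer_phi_real a (3/2) w"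
    by (rule kummer_phi_real(1)) simp
  show "kummer_phi_real a (3/2) (p * x) \<ge> 0"
    using sums_le[OF nn sums_zero ks] by (simp add: w_def)
  have beta: "(\<integral>\<^sup>+s. ennreal (indicator {0<..<1} s * (s powr (u - 1) * (1 - s) powr (d - 1))) \<partial>lborel) = ennreal (Beta u d)"
    if "u > 0" for u
  proof -
    have "integrable lborel (\<lambda>s. indicator {0<..<1} s * (s powr (u - 1) * (1 - s) powr (d - 1)))"
      using beta_kernel_integrable_real[OF that d] by (simp add: set_integrable_def)
    then show ?thesis
      using nn_integral_eq_integral[of lborel "\<lambda>s. indicator {0<..<1} s * (s powr (u - 1) * (1 - s) powr (d - 1))"]
        beta_kernel_integral_real[OF that d] by (simp add: set_lebesgue_integral_def)
  qed
  have "(\<integral>\<^sup>+v. ennreal (indicator {0<..<x} v * ((x - v) powr (a - 1) * v powr (1/2 - a))) * ennreal (exp (- p * v)) \<partial>lborel) =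
     \<bar>- x\<bar> * (\<integral>\<^sup>+s. ennreal (indicator {0<..<x} (x + - x * s) * ((x - (x + - x * s)) powr (a - 1) * (x + - x * s) powr (1/2 - a))) *
         ennreal (exp (- p * (x + - x * s))) \<partial>lborel)"
    by (rule nn_integral_real_affine) (use x in auto)
  also have "\<dots> = (\<integral>\<^sup>+s. ennreal \<bar>- x\<bar> * ?K s \<partial>lborel)"
    by (rule nn_integral_cmult[symmetric]) simp
  also have "\<dots> = (\<integral>\<^sup>+s. ennreal (exp (- p * x) * sqrt x) * (\<Sum>n. ennreal (w ^ n / fact n) *
       ennreal (indicator {0<..<1} s * (s powr ((a + real n) - 1) * (1 - s) powr (d - 1)))) \<partial>lborel)"
  proof (rule nn_integral_cong)
    fix s :: real
    have ind: "indicat_real {0<..<x} (x + - x * s) = indicat_real {0<..<1} s"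
      using x by (auto simp: indicator_def zero_less_mult_iff)
    show "ennreal \<bar>- x\<bar> * ?K s = ennreal (exp (- p * x) * sqrt x) * (\<Sum>n. ennreal (w ^ n / fact n) *
       ennreal (indicator {0<..<1} s * (s powr ((a + real n) - 1) * (1 - s) powr (d - 1))))"
    proof (cases "s \<in> {0<..<1}")
      case True
      have e: "x * ((x - (x + - x * s)) powr (a - 1) * (x + - x * s) powr (1/2 - a)) = sqrt x * (s powr (a - 1) * (1 - s) powr (d - 1))"
      proof -
        have q1: "x - (x + - x * s) = x * s" and q2: "x + - x * s = x * (1 - s)" by (simp_all add: algebra_simps)
        have "x * ((x - (x + - x * s)) powr (a - 1) * (x + - x * s) powr (1/2 - a)) =
            (x powr 1 * x powr (a - 1) * x powr (1/2 - a)) * (s powr (a - 1) * (1 - s) powr (1/2 - a))"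
          unfolding q1 unfolding q2 using x by (simp add: powr_mult)
        also have "x powr 1 * x powr (a - 1) * x powr (1/2 - a) = x powr (1/2)" unfolding powr_add[symmetric] by simp
        also have "\<dots> = sqrt x" using x by (simp add: powr_half_sqrt)
        finally show ?thesis by (simp add: d_def)
      qed
      have e2: "exp (- p * (x + - x * s)) = exp (- p * x) * exp (w * s)"
        by (simp add: w_def algebra_simps flip: exp_add)
      have "(\<lambda>n. (w * s) ^ n / fact n) sums exp (w * s)"
        using exp_converges[of "w * s"] by (simp add: scaleR_conv_of_real field_simps)
      from sums_mult2[OF this, of "s powr (a - 1) * (1 - s) powr (d - 1)"]
      have "(\<lambda>n. (w * s) ^ n / fact n * (s powr (a - 1) * (1 - s) powr (d - 1))) sums (exp (w * s) * (s powr (a - 1) * (1 - s) powr (d - 1)))" .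
      moreover have "(w * s) ^ n / fact n * (s powr (a - 1) * (1 - s) powr (d - 1)) =
          w ^ n / fact n * (s powr ((a + real n) - 1) * (1 - s) powr (d - 1))" for n
      proof -
        have "s powr ((a + real n) - 1) = s powr (a - 1) * s ^ n"
          using True by (simp add: powr_realpow[symmetric] algebra_simps flip: powr_add)
        then show ?thesis by (simp add: power_mult_distrib)
      qed
      ultimately have sm: "(\<lambda>n. w ^ n / fact n * (s powr ((a + real n) - 1) * (1 - s) powr (d - 1))) sums (exp (w * s) * (s powr (a - 1) * (1 - s) powr (d - 1)))"
        by (simp only:)
      have "(\<Sum>n. ennreal (w ^ n / fact n) * ennreal (indicator {0<..<1} s * (s powr ((a + real n) - 1) * (1 - s) powr (d - 1)))) =
          (\<Sum>n. ennreal (w ^ n / fact n * (s powr ((a + real n) - 1) * (1 - s) powr (d - 1))))"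
        using True w by (simp flip: ennreal_mult')
      also have "\<dots> = ennreal (exp (w * s) * (s powr (a - 1) * (1 - s) powr (d - 1)))"
        using sm w by (subst suminf_ennreal2) (auto simp: sums_iff)
      finally have R: "(\<Sum>n. ennreal (w ^ n / fact n) * ennreal (indicator {0<..<1} s * (s powr ((a + real n) - 1) * (1 - s) powr (d - 1)))) =
         ennreal (exp (w * s) * (s powr (a - 1) * (1 - s) powr (d - 1)))" .
      have "ennreal \<bar>- x\<bar> * ?K s = ennreal (x * ((x - (x + - x * s)) powr (a - 1) * (x + - x * s) powr (1/2 - a)) * exp (- p * (x + - x * s)))"
        unfolding ind using True x by (simp add: mult.assoc flip: ennreal_mult')
      then show ?thesis unfolding R e e2 using x by (simp add: mult_ac flip: ennreal_mult')
    next
      case False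
      then have "indicat_real {0<..<1} s = 0" by (simp add: indicator_def)
      then show ?thesis unfolding ind by simp
    qed
  qed
  also have "\<dots> = ennreal (exp (- p * x) * sqrt x) * (\<Sum>n. ennreal (w ^ n / fact n) * ennreal (Beta (a + real n) d))"
    using a by (subst nn_integral_cmult, simp) (simp add: nn_integral_suminf nn_integral_cmult beta add_pos_nonneg)
  also have "(\<Sum>n. ennreal (w ^ n / fact n) * ennreal (Beta (a + real n) d)) = (\<Sum>n. ennreal (Beta a d * (kummer_term a (3/2) w n)))"
  proof (rule suminf_cong)
    fix n
    have "Beta (a + real n) d = Beta a d * pochhammer a n / pochhammer (3/2) n"
      using a d Gamma_add_nat_real[of a n] Gamma_add_nat_real[of "a + d" n]
      by (simp add: Beta_def d_def add_ac)
    then show "ennreal (w ^ n / fact n) * ennreal (Beta (a + real n) d) = ennreal (Beta a d * (kummer_term a (3/2) w n))"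
      using w by (simp add: mult_ac flip: ennreal_mult')
  qed
  also have "\<dots> = ennreal (Beta a d * kummer_phi_real a (3/2) w)"
  proof -
    note sm = sums_mult[OF ks, of "Beta a d"]
    have "0 \<le> Beta a d * (kummer_term a (3/2) w n)" for n
      by (rule mult_nonneg_nonneg[OF less_imp_le[OF g] nn])
    from suminf_ennreal2[OF this sums_summable[OF sm]] show ?thesis
      by (simp only: sums_unique[OF sm, symmetric])
  qed
  finally show "(\<integral>\<^sup>+v. ennreal (indicator {0<..<x} v * ((x - v) powr (a - 1) * v powr (1/2 - a))) * ennreal (exp (- p * v)) \<partial>lborel) =
     ennreal (exp (- p * x) * sqrt x * Beta a (3/2 - a) * kummer_phi_real a (3/2) (p * x))"
    using x by (simp add: w_def d_def mult.assoc flip: ennreal_mult')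
qed

section \<open>The convolution for real parameters\<close>

lemma hyp2F1_commute: "hyp2F1 a b c = hyp2F1 b a c"
  by (simp add: hyp2F1_def mult.commute)

text \<open>For nonnegative extended functions Tonelli's theorem asks for measurability only, and
  the shift \<open>u = t - v\<close> is the entire computation.\<close>

lemma laplace_convolution:
  fixes A B :: "real \<Rightarrow> ennreal" and p :: real
  assumes [measurable]: "A \<in> borel_measurable borel" "B \<in> borel_measurable borel"
  shows "(\<integral>\<^sup>+v. A v * ennreal (exp (- p * v)) \<partial>lborel) * (\<integral>\<^sup>+u. B u * ennreal (exp (- p * u)) \<partial>lborel) =
     (\<integral>\<^sup>+t. ennreal (exp (- p * t)) * (\<integral>\<^sup>+v. A v * B (t - v) \<partial>lborel) \<partial>lborel)"
proof -
  have "(\<integral>\<^sup>+v. A v * ennreal (exp (- p * v)) \<partial>lborel) * (\<integral>\<^sup>+u. B u * ennreal (exp (- p * u)) \<partial>lborel) =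
      (\<integral>\<^sup>+v. A v * ennreal (exp (- p * v)) * (\<integral>\<^sup>+u. B u * ennreal (exp (- p * u)) \<partial>lborel) \<partial>lborel)"
    by (rule nn_integral_multc[symmetric]) simp
  also have "\<dots> = (\<integral>\<^sup>+v. (\<integral>\<^sup>+t. ennreal (exp (- p * t)) * (A v * B (t - v)) \<partial>lborel) \<partial>lborel)"
  proof (rule nn_integral_cong)
    fix v
    have "(\<integral>\<^sup>+u. B u * ennreal (exp (- p * u)) \<partial>lborel) = (\<integral>\<^sup>+t. B (t - v) * ennreal (exp (- p * (t - v))) \<partial>lborel)"
      using nn_integral_real_affine[of "\<lambda>u. B u * ennreal (exp (- p * u))" 1 "- v"] by simp
    then have "A v * ennreal (exp (- p * v)) * (\<integral>\<^sup>+u. B u * ennreal (exp (- p * u)) \<partial>lborel) =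
       (\<integral>\<^sup>+t. A v * ennreal (exp (- p * v)) * (B (t - v) * ennreal (exp (- p * (t - v)))) \<partial>lborel)"
      by (simp add: nn_integral_cmult)
    also have "\<dots> = (\<integral>\<^sup>+t. ennreal (exp (- p * t)) * (A v * B (t - v)) \<partial>lborel)"
    proof (rule nn_integral_cong)
      fix t
      have "ennreal (exp (- p * v)) * ennreal (exp (- p * (t - v))) = ennreal (exp (- p * t))"
        by (simp add: algebra_simps flip: ennreal_mult' exp_add)
      then show "A v * ennreal (exp (- p * v)) * (B (t - v) * ennreal (exp (- p * (t - v)))) = ennreal (exp (- p * t)) * (A v * B (t - v))"
        by (metis (no_types, lifting) mult.assoc mult.commute)
    qed
    finally show "A v * ennreal (exp (- p * v)) * (\<integral>\<^sup>+u. B u * ennreal (exp (- p * u)) \<partial>lborel) =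
       (\<integral>\<^sup>+t. ennreal (exp (- p * t)) * (A v * B (t - v)) \<partial>lborel)" .
  qed
  also have "\<dots> = (\<integral>\<^sup>+t. (\<integral>\<^sup>+v. ennreal (exp (- p * t)) * (A v * B (t - v)) \<partial>lborel) \<partial>lborel)"
    by (rule lborel_pair.Fubini') simp
  also have "\<dots> = (\<integral>\<^sup>+t. ennreal (exp (- p * t)) * (\<integral>\<^sup>+v. A v * B (t - v) \<partial>lborel) \<partial>lborel)"
    by (intro nn_integral_cong nn_integral_cmult) simp
  finally show ?thesis .
qed

text \<open>The series form is confined to the unit disc, while the inner kernel has arbitrarily
  negative arguments; both sides are holomorphic on the half-plane \<open>Re z < 1\<close>.\<close>

lemma euler_integral_hyp2F1:
  assumes b: "Re b > 0" and d: "Re d > 0" and z: "Re z < 1"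
  shows "(LINT s:{0<..<1}|lborel. euler_kernel a b d z s) = Beta b d * hyp2F1 a b (b + d) z"
proof -
  define S where "S = {z. Re z < 1}"
  define D where "D = (\<lambda>z. (LINT s:{0<..<1}|lborel. euler_kernel a b d z s) - Beta b d * hyp2F1 a b (b + d) z)"
  have S: "open S" "connected S" unfolding S_def
    by (rule open_halfspace_Re_lt, rule convex_connected[OF convex_halfspace_Re_lt])
  have sub: "S \<subseteq> cut_plane" by (auto simp: S_def cut_plane_def)
  have bd: "Re (b + d) > 0" using b d by simp
  have "D z = 0"
  proof (rule analytic_continuation[of D, OF _ S])
    show "D holomorphic_on S" unfolding D_def
      by (intro holomorphic_intros holomorphic_on_subset[OF holomorphic_on_euler_integral[OF b d] sub]
          holomorphic_on_subset[OF holomorphic_on_hyp2F1[OF bd] sub])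
    show "ball 0 1 \<subseteq> S"
    proof
      fix w :: complex assume "w \<in> ball 0 1"
      then show "w \<in> S" using complex_Re_le_cmod[of w] by (simp add: S_def)
    qed
    show "D w = 0" if "w \<in> ball 0 1" for w
      using that euler_integral_series[OF b d, of w a] hyp2F1_eq_gauss[OF bd, of w a b] by (simp add: D_def)
    show "(0::complex) islimpt ball 0 1" by (simp add: islimpt_ball)
  qed (use z in \<open>auto simp: S_def\<close>)
  then show ?thesis by (simp add: D_def)
qed

text \<open>Euler's integrand is reflected by \<open>s\<close> to \<open>1 - s\<close>, the
  orientation in which the later substitutions increase from 0 to 1. The value of 2F1 is handed over
  as a real \<open>F \<ge> 0\<close>, fit for comparison in \<open>ennreal\<close>.\<close>

lemma euler_integral_nn:
  fixes \<alpha> \<beta> \<delta> z :: real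
  assumes \<beta>: "\<beta> > 0" and \<delta>: "\<delta> > 0" and z: "z < 1"
  obtains F where "F \<ge> 0"
    "hyp2F1 (of_real \<alpha>) (of_real \<beta>) (of_real (\<beta> + \<delta>)) (of_real z) = of_real F"
    "(\<integral>\<^sup>+s. ennreal (indicator {0<..<1} s * (s powr (\<delta> - 1) * (1 - s) powr (\<beta> - 1) * (1 - z * (1 - s)) powr (- \<alpha>))) \<partial>lborel)
       = ennreal (Beta \<beta> \<delta> * F)"
proof -
  define k where "k = (\<lambda>s. s powr (\<delta> - 1) * (1 - s) powr (\<beta> - 1) * (1 - z * (1 - s)) powr (- \<alpha>))"
  have base: "1 - z * (1 - s) > 0" if "0 \<le> s" "s \<le> 1" for s :: real
  proof (cases "z \<le> 0")
    case True
    then have "z * (1 - s) \<le> 0" using that by (intro mult_nonpos_nonneg) auto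
    then show ?thesis by linarith
  next
    case False
    then have "z * (1 - s) \<le> z * 1" using that by (intro mult_left_mono) auto
    then show ?thesis using z by linarith
  qed
  have cont: "continuous_on {0..1} (\<lambda>s. (1 - z * (1 - s)) powr (- \<alpha>))"
    by (intro continuous_intros) (use base in force)+
  then have "bounded ((\<lambda>s. (1 - z * (1 - s)) powr (- \<alpha>)) ` {0..1})"
    by (intro compact_imp_bounded compact_continuous_image) auto
  then obtain M where M: "\<And>s. s \<in> {0..1} \<Longrightarrow> \<bar>(1 - z * (1 - s)) powr (- \<alpha>)\<bar> \<le> M"
    unfolding bounded_iff by force
  have kint: "set_integrable lborel {0<..<1} k"
  proof (rule set_integrable_bound)
    show "set_integrable lborel {0<..<1} (\<lambda>s. M * (s powr (\<delta> - 1) * (1 - s) powr (\<beta> - 1)))"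
      by (intro set_integrable_mult_right beta_kernel_integrable_real assms)
    show "set_borel_measurable lborel {0<..<1} k"
      unfolding k_def set_borel_measurable_def by simp
    have "norm (k s) \<le> norm (M * (s powr (\<delta> - 1) * (1 - s) powr (\<beta> - 1)))" if "s \<in> {0<..<1}" for s
    proof -
      have "norm (k s) = s powr (\<delta> - 1) * (1 - s) powr (\<beta> - 1) * \<bar>(1 - z * (1 - s)) powr (- \<alpha>)\<bar>"
        by (simp add: k_def abs_mult)
      also have "\<dots> \<le> s powr (\<delta> - 1) * (1 - s) powr (\<beta> - 1) * M"
        by (intro mult_left_mono M) (use that in auto)
      also have "\<dots> \<le> norm (M * (s powr (\<delta> - 1) * (1 - s) powr (\<beta> - 1)))" by (simp add: mult.commute)
      finally show ?thesis .
    qed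
    then show "AE s in lborel. s \<in> {0<..<1} \<longrightarrow> norm (k s) \<le> norm (M * (s powr (\<delta> - 1) * (1 - s) powr (\<beta> - 1)))" by simp
  qed
  define r where "r = (LINT s:{0<..<1}|lborel. k s)"
  have k0: "k s \<ge> 0" for s by (simp add: k_def)
  have r0: "r \<ge> 0" unfolding r_def set_lebesgue_integral_def
    by (rule Bochner_Integration.integral_nonneg) (simp add: k0)
  have "(\<integral>\<^sup>+s. ennreal (indicator {0<..<1} s * k s) \<partial>lborel) = ennreal r"
    using nn_integral_eq_integral[of lborel "\<lambda>s. indicator {0<..<1} s * k s"] kint k0
    by (simp add: set_integrable_def r_def set_lebesgue_integral_def)
  moreover have "of_real r = (Beta (of_real \<beta>) (of_real \<delta>) * hyp2F1 (of_real \<alpha>) (of_real \<beta>) (of_real \<beta> + of_real \<delta>) (of_real z) :: complex)"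
  proof -
    have "complex_of_real r = (LINT s:{0<..<1}|lborel. complex_of_real (k s))"
      unfolding r_def by (rule set_integral_complex_of_real[symmetric])
    also have "\<dots> = (LINT s:{0<..<1}|lborel. complex_of_real (k (1 - s)))"
      by (rule set_integral_reflect_unit)
    also have "\<dots> = (LINT s:{0<..<1}|lborel. of_real s powr (of_real \<beta> - 1) * of_real (1 - s) powr (of_real \<delta> - 1) *
            (1 - of_real z * of_real s) powr (- of_real \<alpha>))"
    proof (rule set_lebesgue_integral_cong, simp, intro allI impI)
      fix s :: real assume s: "s \<in> {0<..<1}"
      have p: "complex_of_real (u powr e) = of_real u powr of_real e" if "u \<ge> 0" for u e
        using that by (simp add: powr_of_real)
      have "1 - z * s \<ge> 0" using base[of "1 - s"] s by simp
      then have "complex_of_real (k (1 - s)) = of_real (1 - s) powr of_real (\<delta> - 1) * of_real s powr of_real (\<beta> - 1) *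
          of_real (1 - z * s) powr of_real (- \<alpha>)"
        using s by (simp add: k_def p del: of_real_diff of_real_minus)
      then show "complex_of_real (k (1 - s)) = of_real s powr (of_real \<beta> - 1) * of_real (1 - s) powr (of_real \<delta> - 1) *
            (1 - of_real z * of_real s) powr (- of_real \<alpha>)" by (simp add: mult_ac)
    qed
    also have "\<dots> = Beta (of_real \<beta>) (of_real \<delta>) * hyp2F1 (of_real \<alpha>) (of_real \<beta>) (of_real \<beta> + of_real \<delta>) (of_real z)"
      by (rule euler_integral_hyp2F1) (use assms in auto)
    finally show ?thesis .
  qed
  moreover have B: "Beta \<beta> \<delta> > 0" using assms by (simp add: Beta_def Gamma_real_pos)
  moreover have "Beta (of_real \<beta>) (of_real \<delta>) = complex_of_real (Beta \<beta> \<delta>)"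
    by (simp add: Beta_def Gamma_complex_of_real flip: of_real_add)
  ultimately show thesis
    using r0 by (intro that[of "r / Beta \<beta> \<delta>"]) (auto simp: k_def)
qed

text \<open>
  In the next two identities the left-hand side is Euler's integrand after the substitution, with its
  Jacobian as last factor, and the second line of the right-hand side is the convolution integrand.
\<close>

lemma moebius_identity_inner:
  fixes a b y v t D s r m k :: real
  assumes "y > 0" "v > 0" "t > 0" "D > 0" "s > 0" "r > 0" "m > 0" "k > 0"
  shows "(y * v / (t * D)) powr (1/2-a) * (s * r / (t * D)) powr (b-1) * (y * m / (k * D)) powr (a-1) * (y * s / (t * D^2)) =
    (y powr (1/2) * t powr (-(1/2-a+b)) * s powr b * k powr (1-a)) *
    ((m powr (a-1) * v powr (1/2-a)) * (r powr (b-1) * D powr (-b-1/2)))"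
proof -
  \<comment> \<open>All bases are positive; written as exponentials they turn the identity of powers
    into a linear one between logarithms.\<close>
  obtain Y V T DD S R M K where e: "y = exp Y" "v = exp V" "t = exp T" "D = exp DD" "s = exp S" "r = exp R" "m = exp M" "k = exp K"
    using assms by (metis exp_ln)
  show ?thesis
    unfolding e by (simp add: exp_powr_real power2_eq_square flip: exp_add exp_diff) (simp add: field_simps)
qed

lemma moebius_identity_outer:
  fixes a b v k x g t m D h :: real
  assumes "v > 0" "k > 0" "x > 0" "g > 0" "t > 0" "m > 0" "D > 0" "h > 0"
  shows "(v * k / (x * g)) powr (1/2-a) * (t * m / (x * g)) powr (a-1) * (k * D / (h * g)) powr (-(b+1/2)) * (t * k / (x * g^2)) =
    (k powr (1-a-b) * x powr (-(1/2)) * t powr a * h powr (b+1/2)) *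
    ((m powr (a-1) * v powr (1/2-a)) * (g powr (b-1) * D powr (-b-1/2)))"
proof -
  obtain V K X G T M DD H where e: "v = exp V" "k = exp K" "x = exp X" "g = exp G" "t = exp T" "m = exp M" "D = exp DD" "h = exp H"
    using assms by (metis exp_ln)
  show ?thesis
    unfolding e by (simp add: exp_powr_real power2_eq_square flip: exp_add exp_diff) (simp add: field_simps)
qed

section \<open>The convolution as Euler's integral, for \<open>t < x\<close> and for
  \<open>t > x\<close>\<close>

abbreviation weight_convolution :: "real \<Rightarrow> real \<Rightarrow> real \<Rightarrow> real \<Rightarrow> real \<Rightarrow> ennreal" where
  "weight_convolution a b x y t \<equiv> \<integral>\<^sup>+v. kummer_weight a x v * tricomi_weight b y (t - v) \<partial>lborel"

lemma ennreal_eq_divide: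
  assumes "ennreal u = ennreal k * I" "k > 0" "u \<ge> 0"
  shows "I = ennreal (u / k)"
proof -
  have "ennreal (u / k) = ennreal (1 / k * u)" by simp
  also have "\<dots> = ennreal (1 / k) * ennreal u" by (rule ennreal_mult') (use assms in simp)
  also have "\<dots> = ennreal (1 / k) * ennreal k * I" unfolding assms(1) by (simp only: mult.assoc)
  also have "ennreal (1 / k) * ennreal k = 1" using assms by (simp flip: ennreal_mult')
  finally show ?thesis by simp
qed

text \<open>What the two ranges of \<open>t\<close> share: an increasing substitution
  \<open>q\<close> under which Euler's integrand times the Jacobian is a constant multiple
  \<open>K\<close> of the convolution integrand \<open>A\<close>.\<close>

lemma euler_substitution:
  fixes \<alpha> \<beta> \<delta> z T K :: real and q q' A :: "real \<Rightarrow> real"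
  assumes \<beta>: "\<beta> > 0" and \<delta>: "\<delta> > 0" and z: "z < 1" and T: "T > 0" and K: "K > 0"
    and q01: "q 0 = 0" "q T = 1"
    and der: "\<And>v. v \<in> {0..T} \<Longrightarrow> (q has_real_derivative q' v) (at v)"
    and q': "continuous_on {0..T} q'" "\<And>v. v \<in> {0..T} \<Longrightarrow> q' v \<ge> 0"
    and qin: "\<And>v. 0 < v \<Longrightarrow> v < T \<Longrightarrow> q v \<in> {0<..<1}"
    and pt: "\<And>v. 0 < v \<Longrightarrow> v < T \<Longrightarrow>
       q v powr (\<delta> - 1) * (1 - q v) powr (\<beta> - 1) * (1 - z * (1 - q v)) powr (- \<alpha>) * q' v = K * A v"
    and meas: "A \<in> borel_measurable borel"
  obtains F where "F \<ge> 0"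
    "hyp2F1 (of_real \<alpha>) (of_real \<beta>) (of_real (\<beta> + \<delta>)) (of_real z) = of_real F"
    "(\<integral>\<^sup>+v. ennreal (indicator {0<..<T} v * A v) \<partial>lborel) = ennreal (Beta \<beta> \<delta> * F / K)"
proof -
  define f where "f = (\<lambda>s. ennreal (indicator {0<..<1} s * (s powr (\<delta> - 1) * (1 - s) powr (\<beta> - 1) * (1 - z * (1 - s)) powr (- \<alpha>))))"
  obtain F where F: "F \<ge> 0"
    "hyp2F1 (of_real \<alpha>) (of_real \<beta>) (of_real (\<beta> + \<delta>)) (of_real z) = of_real F"
    "(\<integral>\<^sup>+s. f s \<partial>lborel) = ennreal (Beta \<beta> \<delta> * F)"
    using euler_integral_nn[OF \<beta> \<delta> z, of \<alpha>] unfolding f_def by blast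
  have f_eq: "f (q v) * ennreal (q' v) * indicator {0..T} v = ennreal K * ennreal (indicator {0<..<T} v * A v)" for v
  proof (cases "0 < v \<and> v < T")
    case True
    then have v: "0 < v" "v < T" by auto
    have "f (q v) = ennreal (q v powr (\<delta> - 1) * (1 - q v) powr (\<beta> - 1) * (1 - z * (1 - q v)) powr (- \<alpha>))"
      using qin[OF v] by (simp add: f_def)
    then have "f (q v) * ennreal (q' v) = ennreal (K * A v)"
      unfolding pt[OF v, symmetric] by (simp add: ennreal_mult'[symmetric])
    then show ?thesis using v K by (simp add: ennreal_mult')
  next
    case False
    then consider "v < 0" | "v = 0" | "v = T" | "v > T" by linarith
    then show ?thesis by cases (use q01 in \<open>auto simp: f_def\<close>)
  qed
  have "ennreal (Beta \<beta> \<delta> * F) = (\<integral>\<^sup>+s. f s * indicator {q 0..q T} s \<partial>lborel)"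
    unfolding q01 F(3)[symmetric] by (rule nn_integral_cong) (auto simp: f_def indicator_def)
  also have "\<dots> = (\<integral>\<^sup>+v. f (q v) * ennreal (q' v) * indicator {0..T} v \<partial>lborel)"
    by (rule nn_integral_substitution_aux) (use der q' T in \<open>auto simp: f_def\<close>)
  also have "\<dots> = ennreal K * (\<integral>\<^sup>+v. ennreal (indicator {0<..<T} v * A v) \<partial>lborel)"
    unfolding f_eq by (rule nn_integral_cmult) (use meas in simp)
  finally have "ennreal (Beta \<beta> \<delta> * F) = ennreal K * (\<integral>\<^sup>+v. ennreal (indicator {0<..<T} v * A v) \<partial>lborel)" .
  moreover have "Beta \<beta> \<delta> \<ge> 0" using \<beta> \<delta> by (simp add: Beta_def Gamma_real_pos less_imp_le)
  ultimately have "(\<integral>\<^sup>+v. ennreal (indicator {0<..<T} v * A v) \<partial>lborel) = ennreal (Beta \<beta> \<delta> * F / K)"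
    using K F(1) by (intro ennreal_eq_divide) auto
  with F(1,2) show thesis by (rule that)
qed

text \<open>For \<open>t < x\<close> the convolution runs over \<open>0 < v < t\<close>. The map
  \<open>q\<close> sends the branch points \<open>0\<close>, \<open>t\<close>, \<open>y + t\<close>
  to \<open>0\<close>, \<open>1\<close>, \<open>\<infinity>\<close>; the fourth one,
  \<open>x\<close>, becomes the zero of \<open>1 - z * (1 - q)\<close>, which determines the
  argument \<open>z\<close>.\<close>

lemma inner_convolution:
  fixes a b x y t :: real
  assumes a: "0 < a" "a < 1" and b: "b > 0" and t: "0 < t" "t < x" and y: "y > 0"
  obtains F where "F \<ge> 0"
    "hyp2F1 (of_real b) (1 - of_real a) (3 / 2 - of_real a + of_real b)
       (of_real (t * (x - y - t) / ((x - t) * (y + t)))) = of_real F"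
    "weight_convolution a b x y t =
       ennreal (Beta b (3/2 - a) / sqrt y * (t powr (1/2 - a + b) * (x - t) powr (a - 1) * (y + t) powr (- b) * F))"
proof -
  define z where "z = t * (x - y - t) / ((x - t) * (y + t))"
  define A where "A = (\<lambda>v. ((x - v) powr (a-1) * v powr (1/2-a)) * ((t - v) powr (b-1) * (y + t - v) powr (-b-1/2)))"
  define q where "q = (\<lambda>v. y * v / (t * (y + t - v)))"
  define q' where "q' = (\<lambda>v. y * (y + t) / (t * (y + t - v)^2))"
  define K where "K = y powr (1/2) * t powr (-(1/2-a+b)) * (y + t) powr b * (x - t) powr (1-a)"
  have z1: "1 - z = x * y / ((x - t) * (y + t))" unfolding z_def by (rule inner_arg[OF t y])
  have "x * y / ((x - t) * (y + t)) > 0" using t y by simp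
  with z1 have z: "z < 1" by linarith
  have d: "3/2 - a > 0" using a by simp
  have K: "K > 0" using t y by (simp add: K_def)
  have q1: "1 - q v = (y + t) * (t - v) / (t * (y + t - v))" if "v < t" for v
  proof -
    have "1 - q v = (t * (y + t - v) - y * v) / (t * (y + t - v))"
      unfolding q_def by (rule one_minus_divide) (use t y that in simp)
    also have "t * (y + t - v) - y * v = (y + t) * (t - v)" by (simp add: algebra_simps)
    finally show ?thesis .
  qed
  obtain F where F: "F \<ge> 0"
    "hyp2F1 (of_real (1 - a)) (of_real b) (of_real (b + (3/2 - a))) (of_real z) = of_real F"
    "(\<integral>\<^sup>+v. ennreal (indicator {0<..<t} v * A v) \<partial>lborel) = ennreal (Beta b (3/2 - a) * F / K)"
  proof (rule euler_substitution[OF b d z t(1) K, where q=q and q'=q' and A=A and \<alpha>="1 - a"])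
    show "q 0 = 0" "q t = 1" using t y by (auto simp: q_def)
    show "(q has_real_derivative q' v) (at v)" if "v \<in> {0..t}" for v
    proof -
      have D: "y + t - v \<noteq> 0" using that y by auto
      then have "(q has_real_derivative (y * (t * (y + t - v)) - y * v * (t * - 1)) / ((t * (y + t - v)) * (t * (y + t - v)))) (at v)"
        unfolding q_def by (auto intro!: derivative_eq_intros simp: t(1)[THEN less_imp_neq, symmetric] less_imp_neq[OF t(1)])
      moreover have "y * (t * (y + t - v)) - y * v * (t * - 1) = t * (y * (y + t))" by (simp add: algebra_simps)
      ultimately show ?thesis using t D by (simp add: q'_def power2_eq_square mult_ac)
    qed
    show "continuous_on {0..t} q'"
      unfolding q'_def by (intro continuous_intros) (use t y in auto)
    show "A \<in> borel_measurable borel" unfolding A_def by simp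
    fix v assume v: "0 < v" "v < t"
    have D: "y + t - v > 0" using v y by simp
    have "0 < q v" "0 < 1 - q v" unfolding q1[OF v(2)] using v t y D by (simp_all add: q_def)
    then show "q v \<in> {0<..<1}" by simp
    have q2: "1 - z * (1 - q v) = y * (x - v) / ((x - t) * (y + t - v))"
    proof -
      have ne: "x - t \<noteq> 0" "y + t \<noteq> 0" "t \<noteq> 0" "y + t - v \<noteq> 0" using t y D by auto
      have "z * (1 - q v) = (x - y - t) * (t - v) / ((x - t) * (y + t - v))"
        unfolding z_def q1[OF v(2)] using ne by simp
      then have "1 - z * (1 - q v) = ((x - t) * (y + t - v) - (x - y - t) * (t - v)) / ((x - t) * (y + t - v))"
        using ne by (simp add: one_minus_divide)
      also have "(x - t) * (y + t - v) - (x - y - t) * (t - v) = y * (x - v)" by (simp add: algebra_simps)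
      finally show ?thesis .
    qed
    have e: "(3/2 - a) - 1 = 1/2 - a" "- (1 - a) = a - 1" by simp_all
    show "q v powr ((3/2 - a) - 1) * (1 - q v) powr (b - 1) * (1 - z * (1 - q v)) powr (- (1 - a)) * q' v = K * A v"
      unfolding e unfolding q2 unfolding q1[OF v(2)] unfolding q_def q'_def K_def A_def
      by (rule moebius_identity_inner) (use v t y D in auto)
  qed (use y t in \<open>auto simp: q'_def\<close>)
  have "kummer_weight a x v * tricomi_weight b y (t - v) = ennreal (indicator {0<..<t} v * A v)" for v
    using t by (auto simp: kummer_weight_def tricomi_weight_def A_def indicator_def add_diff_eq simp flip: ennreal_mult')
  with F(3) have I: "weight_convolution a b x y t = ennreal (Beta b (3/2 - a) * F / K)" by simp
  have "inverse K = y powr (- (1/2)) * t powr (1/2-a+b) * (y + t) powr (- b) * (x - t) powr (a - 1)"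
    unfolding K_def inverse_mult_distrib powr_minus[symmetric] minus_minus by simp
  also have "y powr (- (1/2)) = 1 / sqrt y" by (rule powr_neg_half[OF y])
  finally have "Beta b (3/2 - a) * F / K = Beta b (3/2 - a) / sqrt y * (t powr (1/2 - a + b) * (x - t) powr (a - 1) * (y + t) powr (- b) * F)"
    unfolding divide_inverse[of _ K] by (simp add: mult_ac)
  with I F(1,2) show thesis
    by (intro that[of F]) (auto simp: z_def hyp2F1_commute[of "of_real b"] add_ac diff_add_eq)
qed

text \<open>For \<open>t > x\<close> the range is \<open>0 < v < x\<close>, and \<open>q\<close>
  sends \<open>0\<close>, \<open>x\<close>, \<open>t\<close> to \<open>0\<close>, \<open>1\<close>,
  \<open>\<infinity>\<close>; now \<open>y + t\<close> is the branch point that determines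
  \<open>z\<close>.\<close>

lemma outer_convolution:
  fixes a b x y t :: real
  assumes a: "0 < a" "a < 1" and t: "x < t" and x: "x > 0" and y: "y > 0"
  obtains F where "F \<ge> 0"
    "hyp2F1 (1 / 2 + of_real b) (of_real a) (3 / 2) (of_real (x * y / (t * (y - x + t)))) = of_real F"
    "weight_convolution a b x y t =
       ennreal (Beta a (3/2 - a) * sqrt x * (t powr (- a) * (t - x) powr (a + b - 1) * (y - x + t) powr (- b - 1/2) * F))"
proof -
  define z where "z = x * y / (t * (y - x + t))"
  define A where "A = (\<lambda>v. ((x - v) powr (a-1) * v powr (1/2-a)) * ((t - v) powr (b-1) * (y + t - v) powr (-b-1/2)))"
  define q where "q = (\<lambda>v. v * (t - x) / (x * (t - v)))"
  define q' where "q' = (\<lambda>v. t * (t - x) / (x * (t - v)^2))"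
  define K where "K = (t - x) powr (1-a-b) * x powr (-(1/2)) * t powr a * (y - x + t) powr (b+1/2)"
  have z: "z < 1" unfolding z_def by (rule outer_arg_bounds[OF x t y])
  have d: "3/2 - a > 0" using a by simp
  have t0: "t > 0" using t x by simp
  have K: "K > 0" using t t0 x y by (simp add: K_def)
  have q1: "1 - q v = t * (x - v) / (x * (t - v))" if "v < x" for v
  proof -
    have "1 - q v = (x * (t - v) - v * (t - x)) / (x * (t - v))"
      unfolding q_def by (rule one_minus_divide) (use x t that in simp)
    also have "x * (t - v) - v * (t - x) = t * (x - v)" by (simp add: algebra_simps)
    finally show ?thesis .
  qed
  obtain F where F: "F \<ge> 0"
    "hyp2F1 (of_real (b + 1/2)) (of_real a) (of_real (a + (3/2 - a))) (of_real z) = of_real F"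
    "(\<integral>\<^sup>+v. ennreal (indicator {0<..<x} v * A v) \<partial>lborel) = ennreal (Beta a (3/2 - a) * F / K)"
  proof (rule euler_substitution[OF a(1) d z x K, where q=q and q'=q' and A=A and \<alpha>="b + 1/2"])
    show "q 0 = 0" "q x = 1" using t x by (auto simp: q_def)
    show "(q has_real_derivative q' v) (at v)" if "v \<in> {0..x}" for v
    proof -
      have g: "t - v \<noteq> 0" using that t by auto
      then have "(q has_real_derivative ((t - x) * (x * (t - v)) - v * (t - x) * (x * - 1)) / ((x * (t - v)) * (x * (t - v)))) (at v)"
        unfolding q_def using x by (auto intro!: derivative_eq_intros)
      moreover have "(t - x) * (x * (t - v)) - v * (t - x) * (x * - 1) = x * (t * (t - x))" by (simp add: algebra_simps)
      ultimately show ?thesis using x g by (simp add: q'_def power2_eq_square mult_ac)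
    qed
    show "continuous_on {0..x} q'"
      unfolding q'_def by (intro continuous_intros) (use t x in auto)
    show "A \<in> borel_measurable borel" unfolding A_def by simp
    fix v assume v: "0 < v" "v < x"
    have g: "t - v > 0" using v t by simp
    have "0 < q v" "0 < 1 - q v" unfolding q1[OF v(2)] using v t t0 x g by (simp_all add: q_def)
    then show "q v \<in> {0<..<1}" by simp
    have q2: "1 - z * (1 - q v) = (t - x) * (y + t - v) / ((y - x + t) * (t - v))"
    proof -
      have ne: "x \<noteq> 0" "t \<noteq> 0" "t - v \<noteq> 0" "y - x + t \<noteq> 0" using t t0 x y g by auto
      have "z * (1 - q v) = y * (x - v) / ((y - x + t) * (t - v))"
        unfolding z_def q1[OF v(2)] using ne by simp
      then have "1 - z * (1 - q v) = ((y - x + t) * (t - v) - y * (x - v)) / ((y - x + t) * (t - v))"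
        using ne by (simp add: one_minus_divide)
      also have "(y - x + t) * (t - v) - y * (x - v) = (t - x) * (y + t - v)" by (simp add: algebra_simps)
      finally show ?thesis .
    qed
    have e: "(3/2 - a) - 1 = 1/2 - a" by simp
    show "q v powr ((3/2 - a) - 1) * (1 - q v) powr (a - 1) * (1 - z * (1 - q v)) powr (- (b + 1/2)) * q' v = K * A v"
      unfolding e unfolding q2 unfolding q1[OF v(2)] unfolding q_def q'_def K_def A_def
      by (rule moebius_identity_outer) (use v t t0 x y g in auto)
  qed (use t t0 x in \<open>auto simp: q'_def\<close>)
  have "kummer_weight a x v * tricomi_weight b y (t - v) = ennreal (indicator {0<..<x} v * A v)" for v
    using t by (auto simp: kummer_weight_def tricomi_weight_def A_def indicator_def add_diff_eq simp flip: ennreal_mult')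
  with F(3) have I: "weight_convolution a b x y t = ennreal (Beta a (3/2 - a) * F / K)" by simp
  have "inverse K = (t - x) powr (a + b - 1) * x powr (1/2) * t powr (- a) * (y - x + t) powr (- b - 1/2)"
    unfolding K_def inverse_mult_distrib powr_minus[symmetric] by (simp add: algebra_simps)
  also have "x powr (1/2) = sqrt x" using x by (simp add: powr_half_sqrt)
  finally have "Beta a (3/2 - a) * F / K = Beta a (3/2 - a) * sqrt x * (t powr (- a) * (t - x) powr (a + b - 1) * (y - x + t) powr (- b - 1/2) * F)"
    unfolding divide_inverse[of _ K] by (simp add: mult_ac)
  with I F(1,2) show thesis
    by (intro that[of F]) (auto simp: z_def add_ac)
qed

section \<open>Analytic continuation in the parameters\<close>


text \<open>Tricomi's \<open>U(b, 1/2, y * p)\<close> through its connection formula. Multiplied by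
  \<open>2 powr (\<mu> / 2) * exp (- y * p / 2)\<close> it is the value of \<open>D_\<mu>\<close> in
  the theorem.\<close>

abbreviation tricomi_combination :: "complex \<Rightarrow> complex \<Rightarrow> real \<Rightarrow> complex" where
  "tricomi_combination b p y \<equiv>
     of_real (sqrt pi) * rGamma (b + 1 / 2) * kummer_phi b (1 / 2) (of_real y * p)
     - 2 * of_real (sqrt pi) * of_real (sqrt y) * p powr (1 / 2) * rGamma b * kummer_phi (b + 1 / 2) (3 / 2) (of_real y * p)"

text \<open>Each side of the theorem is a common factor times the normalised expressions here. The
  factor contains \<open>rGamma (- (\<nu> / 2))\<close>, which vanishes at \<open>\<nu> = 0\<close>,
  so the normalised identity is the stronger one.\<close>

definition transform_lhs :: "complex \<Rightarrow> complex \<Rightarrow> complex \<Rightarrow> real \<Rightarrow> real \<Rightarrow> complex" where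
  "transform_lhs a b p x y =
     of_real (sqrt x) * exp (- p * of_real x) *
     tricomi_combination b p y *
     kummer_phi a (3 / 2) (of_real x * p)"

text \<open>\<open>sqrt pi / 2\<close> is \<open>Gamma (3/2)\<close>, left over when the beta factor
  of the inner convolution is divided by that of Kummer's transform.\<close>

definition transform_rhs :: "complex \<Rightarrow> complex \<Rightarrow> complex \<Rightarrow> real \<Rightarrow> real \<Rightarrow> complex" where
  "transform_rhs a b p x y =
     of_real (sqrt pi) / 2 * rGamma (3 / 2 - a + b) * rGamma a * (LINT t:{0<..<x}|lborel. inner_kernel a b p x y t)
     + of_real (sqrt x) * of_real (sqrt y) * rGamma b * (LINT t:{x<..}|lborel. outer_kernel a b p x y t)"

section \<open>The identity for real parameters\<close>

lemma inner_kernel_of_real: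
  fixes a b p x y t :: real
  assumes a: "0 < a" "a < 1" and b: "b > 0" and t: "0 < t" "t < x" and y: "y > 0"
  shows "inner_kernel a b p x y t = of_real (Re (inner_kernel a b p x y t))"
    and "Re (inner_kernel a b p x y t) \<ge> 0"
    and "ennreal (exp (- p * t)) * weight_convolution a b x y t =
         ennreal (Beta b (3/2 - a) / sqrt y * Re (inner_kernel a b p x y t))"
proof -
  obtain F where F: "F \<ge> 0"
    "hyp2F1 (of_real b) (1 - of_real a) (3 / 2 - of_real a + of_real b)
       (of_real (t * (x - y - t) / ((x - t) * (y + t)))) = of_real F"
    "weight_convolution a b x y t =
       ennreal (Beta b (3/2 - a) / sqrt y * (t powr (1/2 - a + b) * (x - t) powr (a - 1) * (y + t) powr (- b) * F))"
    using inner_convolution[OF a b t y] by blast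
  have e: "complex_of_real t powr (1 / 2 - of_real a + of_real b) = of_real (t powr (1/2 - a + b))"
    "complex_of_real (x - t) powr (of_real a - 1) = of_real ((x - t) powr (a - 1))"
    "complex_of_real (y + t) powr (- of_real b) = of_real ((y + t) powr (- b))"
    "exp (- complex_of_real p * of_real t) = of_real (exp (- p * t))"
    using powr_of_real[of t "1/2 - a + b"] powr_of_real[of "x - t" "a - 1"] powr_of_real[of "y + t" "- b"] t y
    by (simp_all flip: exp_of_real)
  have k: "inner_kernel a b p x y t =
      of_real (exp (- p * t) * (t powr (1/2 - a + b) * (x - t) powr (a - 1) * (y + t) powr (- b) * F))"
    unfolding inner_kernel_def F(2) e by (simp only: of_real_mult mult.assoc)
  then show "inner_kernel a b p x y t = of_real (Re (inner_kernel a b p x y t))"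
    by (simp only: Re_complex_of_real)
  show "Re (inner_kernel a b p x y t) \<ge> 0" unfolding k using F(1) by simp
  show "ennreal (exp (- p * t)) * weight_convolution a b x y t =
         ennreal (Beta b (3/2 - a) / sqrt y * Re (inner_kernel a b p x y t))"
    unfolding k F(3) Re_complex_of_real by (subst ennreal_mult'[symmetric]) (simp_all add: mult_ac)
qed

lemma outer_kernel_of_real:
  fixes a b p x y t :: real
  assumes a: "0 < a" "a < 1" and b: "b > 0" and t: "x < t" and x: "x > 0" and y: "y > 0"
  shows "outer_kernel a b p x y t = of_real (Re (outer_kernel a b p x y t))"
    and "Re (outer_kernel a b p x y t) \<ge> 0"
    and "ennreal (exp (- p * t)) * weight_convolution a b x y t =
         ennreal (Beta a (3/2 - a) * sqrt x * Re (outer_kernel a b p x y t))"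
proof -
  obtain F where F: "F \<ge> 0"
    "hyp2F1 (1 / 2 + of_real b) (of_real a) (3 / 2) (of_real (x * y / (t * (y - x + t)))) = of_real F"
    "weight_convolution a b x y t =
       ennreal (Beta a (3/2 - a) * sqrt x * (t powr (- a) * (t - x) powr (a + b - 1) * (y - x + t) powr (- b - 1/2) * F))"
    using outer_convolution[OF a t x y] by blast
  have e: "complex_of_real t powr (- of_real a) = of_real (t powr (- a))"
    "complex_of_real (t - x) powr (of_real a + of_real b - 1) = of_real ((t - x) powr (a + b - 1))"
    "complex_of_real (y - x + t) powr (- of_real b - 1 / 2) = of_real ((y - x + t) powr (- b - 1/2))"
    "exp (- complex_of_real p * of_real t) = of_real (exp (- p * t))"
    using powr_of_real[of t "- a"] powr_of_real[of "t - x" "a + b - 1"] powr_of_real[of "y - x + t" "- b - 1/2"] t x y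
    by (simp_all flip: exp_of_real)
  have k: "outer_kernel a b p x y t =
      of_real (exp (- p * t) * (t powr (- a) * (t - x) powr (a + b - 1) * (y - x + t) powr (- b - 1/2) * F))"
    unfolding outer_kernel_def F(2) e by (simp only: of_real_mult mult.assoc)
  then show "outer_kernel a b p x y t = of_real (Re (outer_kernel a b p x y t))"
    by (simp only: Re_complex_of_real)
  show "Re (outer_kernel a b p x y t) \<ge> 0" unfolding k using F(1) by simp
  show "ennreal (exp (- p * t)) * weight_convolution a b x y t =
         ennreal (Beta a (3/2 - a) * sqrt x * Re (outer_kernel a b p x y t))"
    unfolding k F(3) Re_complex_of_real by (subst ennreal_mult'[symmetric]) (simp_all add: mult_ac)
qed

lemma real_part_set_integral:
  fixes f :: "real \<Rightarrow> complex"
  assumes i: "set_integrable lborel T f" and T: "T \<in> sets lborel"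
    and re: "\<And>t. t \<in> T \<Longrightarrow> f t = of_real (Re (f t))" and nn: "\<And>t. t \<in> T \<Longrightarrow> Re (f t) \<ge> 0" and k: "k \<ge> 0"
  obtains r where "r \<ge> 0" "(LINT t:T|lborel. f t) = of_real r"
    "(\<integral>\<^sup>+t. ennreal (k * (indicator T t * Re (f t))) \<partial>lborel) = ennreal (k * r)"
proof -
  define r where "r = (LINT t:T|lborel. Re (f t))"
  have "integrable lborel (\<lambda>t. Re (indicator T t *\<^sub>R f t))"
    using i by (intro integrable_Re) (simp add: set_integrable_def)
  then have ri: "integrable lborel (\<lambda>t. indicator T t * Re (f t))" by simp
  have n: "indicator T t * Re (f t) \<ge> 0" for t using nn by (simp add: indicator_def)
  have r: "r = (\<integral>t. indicator T t * Re (f t) \<partial>lborel)" by (simp add: r_def set_lebesgue_integral_def)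
  have "(LINT t:T|lborel. f t) = (LINT t:T|lborel. complex_of_real (Re (f t)))"
    using re by (intro set_lebesgue_integral_cong T) blast
  also have "\<dots> = of_real r" unfolding r_def by (rule set_integral_complex_of_real)
  finally have 1: "(LINT t:T|lborel. f t) = of_real r" .
  have 2: "(\<integral>\<^sup>+t. ennreal (k * (indicator T t * Re (f t))) \<partial>lborel) = ennreal (k * r)"
    unfolding r using nn_integral_eq_integral[OF integrable_mult_right[OF ri, of k]] n k by simp
  have "r \<ge> 0" unfolding r by (rule Bochner_Integration.integral_nonneg) (rule n)
  from that[OF this 1 2] show thesis .
qed

lemma transform_identity_real:
  fixes a b p x y :: real
  assumes a: "0 < a" "a < 1" and b: "b > 0" and p: "p > 0" and x: "x > 0" and y: "y > 0"
  shows "transform_lhs a b p x y = transform_rhs a b p x y"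
proof -
  have adm: "admissible a b p" using a b p by (simp add: admissible_def)
  define k1 where "k1 = Beta b (3/2 - a) / sqrt y"
  define k2 where "k2 = Beta a (3/2 - a) * sqrt x"
  have g: "Gamma a > 0" "Gamma b > 0" "Gamma (3/2 - a) > 0" "Gamma (3/2 - a + b) > 0" "Gamma (b + 1/2) > 0"
    using a b by (auto intro!: Gamma_real_pos)
  have g32: "Gamma (3/2 :: real) = sqrt pi / 2"
  proof -
    have "(1/2 :: real) \<notin> \<int>\<^sub>\<le>\<^sub>0" by (auto elim!: nonpos_Ints_cases')
    from Gamma_plus1[OF this] show ?thesis by (simp add: Gamma_one_half_real)
  qed
  have Bpos: "Beta b (3/2 - a) > 0" "Beta a (3/2 - a) > 0"
    using g g32 by (simp_all add: Beta_def add.commute[of b])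
  have k: "k1 \<ge> 0" "k2 \<ge> 0" using Bpos x y by (auto simp: k1_def k2_def)
  obtain I1 where I1: "I1 \<ge> 0" "(LINT t:{0<..<x}|lborel. inner_kernel a b p x y t) = of_real I1"
    "(\<integral>\<^sup>+t. ennreal (k1 * (indicator {0<..<x} t * Re (inner_kernel a b p x y t))) \<partial>lborel) = ennreal (k1 * I1)"
    by (rule real_part_set_integral[OF inner_kernel_integrable[OF adm x y] _ _ _ k(1)])
      (use inner_kernel_of_real[OF a b _ _ y] in auto)
  obtain I2 where I2: "I2 \<ge> 0" "(LINT t:{x<..}|lborel. outer_kernel a b p x y t) = of_real I2"
    "(\<integral>\<^sup>+t. ennreal (k2 * (indicator {x<..} t * Re (outer_kernel a b p x y t))) \<partial>lborel) = ennreal (k2 * I2)"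
    by (rule real_part_set_integral[OF outer_kernel_integrable[OF adm x y] _ _ _ k(2)])
      (use outer_kernel_of_real[OF a b _ x y] in auto)
  obtain U where U: "U \<ge> 0"
    "(\<integral>\<^sup>+w. tricomi_weight b y w * ennreal (exp (- p * w)) \<partial>lborel) = ennreal U"
    "sqrt y * U = Gamma b * (sqrt pi / Gamma (b + 1/2) * kummer_phi_real b (1/2) (y * p)
        - 2 * sqrt pi * sqrt (y * p) / Gamma b * kummer_phi_real (b + 1/2) (3/2) (y * p))"
    using tricomi_laplace[OF b p y] unfolding tricomi_weight_def by blast
  define W where "W = sqrt pi / Gamma (b + 1/2) * kummer_phi_real b (1/2) (y * p)
        - 2 * sqrt pi * sqrt (y * p) / Gamma b * kummer_phi_real (b + 1/2) (3/2) (y * p)"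
  define P where "P = kummer_phi_real a (3/2) (p * x)"
  have a': "a < 3/2" using a by simp
  have P: "P \<ge> 0" unfolding P_def by (rule kummer_laplace(2)[OF a(1) a' p x])
  have KL: "(\<integral>\<^sup>+v. kummer_weight a x v * ennreal (exp (- p * v)) \<partial>lborel) = ennreal (exp (- p * x) * sqrt x * Beta a (3/2 - a) * P)"
    unfolding kummer_weight_def P_def by (rule kummer_laplace(1)[OF a(1) a' p x])
  have nk: "exp (- p * x) * sqrt x * Beta a (3/2 - a) * P \<ge> 0" using Bpos P x by simp
  have "ennreal (exp (- p * x) * sqrt x * Beta a (3/2 - a) * P * U) =
      ennreal (exp (- p * x) * sqrt x * Beta a (3/2 - a) * P) * ennreal U"
    by (rule ennreal_mult'[OF nk])
  also have "\<dots> = (\<integral>\<^sup>+t. ennreal (exp (- p * t)) * weight_convolution a b x y t \<partial>lborel)"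
    unfolding KL[symmetric] U(2)[symmetric]
    by (rule laplace_convolution) (simp_all add: kummer_weight_def[abs_def] tricomi_weight_def[abs_def])
  also have "\<dots> = (\<integral>\<^sup>+t. ennreal (k1 * (indicator {0<..<x} t * Re (inner_kernel a b p x y t))) +
       ennreal (k2 * (indicator {x<..} t * Re (outer_kernel a b p x y t))) \<partial>lborel)"
  \<comment> \<open>The two evaluations of the convolution leave out \<open>t = x\<close>, a null
    set.\<close>
  proof (rule nn_integral_cong_AE, rule AE_mp[OF AE_lborel_singleton[of x]], intro AE_I2 impI)
    fix t assume "t \<noteq> x"
    then consider "t \<le> 0" | "0 < t" "t < x" | "x < t" by linarith
    then show "ennreal (exp (- p * t)) * weight_convolution a b x y t =
       ennreal (k1 * (indicator {0<..<x} t * Re (inner_kernel a b p x y t))) +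
       ennreal (k2 * (indicator {x<..} t * Re (outer_kernel a b p x y t)))"
    proof cases
      case 1
      have z: "kummer_weight a x v * tricomi_weight b y (t - v) = 0" for v
        using 1 by (cases "v > 0") (auto simp: kummer_weight_def tricomi_weight_def)
      show ?thesis unfolding z using 1 x by simp
    next
      case 2
      then show ?thesis using inner_kernel_of_real(3)[OF a b 2 y, of p] by (simp add: k1_def)
    next
      case 3
      then show ?thesis using outer_kernel_of_real(3)[OF a b 3 x y, of p] x by (simp add: k2_def)
    qed
  qed
  also have "\<dots> = ennreal (k1 * I1) + ennreal (k2 * I2)"
  proof (subst nn_integral_add)
    have m: "(\<lambda>t. indicator T t * Re (f t)) \<in> borel_measurable lborel"
      if "set_integrable lborel T f" for T and f :: "real \<Rightarrow> complex"
    proof -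
      have "(\<lambda>t. Re (indicator T t *\<^sub>R f t)) \<in> borel_measurable lborel"
        by (rule borel_measurable_integrable[OF integrable_Re[OF that[unfolded set_integrable_def]]])
      then show ?thesis by simp
    qed
    show "(\<lambda>t. ennreal (k1 * (indicator {0<..<x} t * Re (inner_kernel a b p x y t)))) \<in> borel_measurable lborel"
      by (rule measurable_compose[OF borel_measurable_times[OF borel_measurable_const m[OF inner_kernel_integrable[OF adm x y]]] measurable_ennreal])
    show "(\<lambda>t. ennreal (k2 * (indicator {x<..} t * Re (outer_kernel a b p x y t)))) \<in> borel_measurable lborel"
      by (rule measurable_compose[OF borel_measurable_times[OF borel_measurable_const m[OF outer_kernel_integrable[OF adm x y]]] measurable_ennreal])
  qed (simp add: I1 I2)
  also have "\<dots> = ennreal (k1 * I1 + k2 * I2)" using k I1(1) I2(1) by (simp add: ennreal_plus)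
  finally have eq: "exp (- p * x) * sqrt x * Beta a (3/2 - a) * P * U = k1 * I1 + k2 * I2"
    using nk U(1) k I1(1) I2(1) by (subst (asm) ennreal_inj) auto
  have UW: "sqrt y * U = Gamma b * W" using U(3) by (simp add: W_def)
  have sy: "sqrt y > 0" using y by simp
  have "exp (- p * x) * sqrt x * Beta a (3/2 - a) * P * (Gamma b * W) = sqrt y * (exp (- p * x) * sqrt x * Beta a (3/2 - a) * P * U)"
    unfolding UW[symmetric] by (simp add: mult_ac)
  also have "\<dots> = Beta b (3/2 - a) * I1 + sqrt y * Beta a (3/2 - a) * sqrt x * I2"
    unfolding eq using sy by (simp add: k1_def k2_def field_simps)
  finally have "(sqrt x * exp (- p * x) * W * P) * (Beta a (3/2 - a) * Gamma b) =
      Beta b (3/2 - a) * I1 + sqrt y * Beta a (3/2 - a) * sqrt x * I2" by (simp add: mult_ac)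
  then have "sqrt x * exp (- p * x) * W * P = (Beta b (3/2 - a) * I1 + sqrt y * Beta a (3/2 - a) * sqrt x * I2) / (Beta a (3/2 - a) * Gamma b)"
    using Bpos g by (simp add: eq_divide_eq)
  also have "\<dots> = Beta b (3/2 - a) / (Beta a (3/2 - a) * Gamma b) * I1 + sqrt x * sqrt y / Gamma b * I2"
    using Bpos g by (simp add: add_divide_distrib)
  also have "Beta b (3/2 - a) / (Beta a (3/2 - a) * Gamma b) = sqrt pi / 2 / Gamma (3/2 - a + b) / Gamma a"
    using g by (simp add: Beta_def add.commute[of b] flip: g32)
  finally have R: "sqrt x * exp (- p * x) * W * P = sqrt pi / 2 / Gamma (3/2 - a + b) / Gamma a * I1 + sqrt x * sqrt y / Gamma b * I2" .
  have rG: "rGamma (complex_of_real u) = of_real (1 / Gamma u)" for u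
    by (simp add: rGamma_inverse_Gamma Gamma_complex_of_real inverse_eq_divide)
  have rG1: "rGamma (complex_of_real b + 1 / 2) = of_real (1 / Gamma (b + 1/2))" using rG[of "b + 1/2"] by simp
  have rG2: "rGamma (3 / 2 - complex_of_real a + of_real b) = of_real (1 / Gamma (3/2 - a + b))"
    using rG[of "3/2 - a + b"] by simp
  have K1: "kummer_phi (of_real b) (1 / 2) (of_real y * of_real p) = of_real (kummer_phi_real b (1/2) (y * p))"
    using kummer_phi_real(2)[of "1/2" b "y * p"] by simp
  have K2: "kummer_phi (of_real b + 1 / 2) (3 / 2) (of_real y * of_real p) = of_real (kummer_phi_real (b + 1/2) (3/2) (y * p))"
    using kummer_phi_real(2)[of "3/2" "b + 1/2" "y * p"] by simp
  have K3: "kummer_phi (of_real a) (3 / 2) (of_real x * of_real p) = of_real P"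
    using kummer_phi_real(2)[of "3/2" a "p * x"] by (simp add: P_def mult.commute)
  have sp: "complex_of_real p powr (1 / 2) = of_real (sqrt p)"
    using powr_of_real[of p "1/2"] p by (simp add: powr_half_sqrt)
  have ex: "exp (- complex_of_real p * of_real x) = of_real (exp (- p * x))" by (simp flip: exp_of_real)
  have "transform_lhs a b p x y = of_real (sqrt x * exp (- p * x) * W * P)"
    unfolding transform_lhs_def rG rG1 K1 K2 K3 sp ex W_def by (simp add: real_sqrt_mult mult_ac)
  also have "\<dots> = transform_rhs a b p x y"
    unfolding transform_rhs_def rG rG2 I1(2) I2(2) R by (simp add: mult_ac)
  finally show ?thesis .
qed

section \<open>Continuation in \<open>a\<close>, \<open>b\<close> and \<open>p\<close>\<close>

lemma holomorphic_on_transform: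
  assumes S: "open S" and h: "a holomorphic_on S" "b holomorphic_on S" "p holomorphic_on S"
    and adm: "\<And>s. s \<in> S \<Longrightarrow> admissible (a s) (b s) (p s)" and x: "x > 0" and y: "y > 0"
  shows "(\<lambda>s. transform_lhs (a s) (b s) (p s) x y - transform_rhs (a s) (b s) (p s) x y) holomorphic_on S"
proof -
  have "p s \<notin> \<real>\<^sub>\<le>\<^sub>0" if "s \<in> S" for s
    using adm[OF that] by (auto simp: admissible_def complex_nonpos_Reals_iff)
  then show ?thesis
    unfolding transform_lhs_def transform_rhs_def
    by (intro holomorphic_intros holomorphic_on_kummer_phi holomorphic_on_inner_integral
        holomorphic_on_outer_integral S h adm x y) auto
qed

text \<open>The identity theorem works in one complex variable, so the three parameters are given as
  holomorphic functions of one \<open>s\<close>; each use varies one of them and keeps the others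
  constant.\<close>

lemma transform_identity_continue:
  assumes S: "open S" "connected S" and h: "a holomorphic_on S" "b holomorphic_on S" "p holomorphic_on S"
    and adm: "\<And>s. s \<in> S \<Longrightarrow> admissible (a s) (b s) (p s)" and xy: "x > 0" "y > 0"
    and sub: "\<And>r. l < r \<Longrightarrow> r < u \<Longrightarrow> of_real r \<in> S" and lu: "l < u"
    and base: "\<And>r. l < r \<Longrightarrow> r < u \<Longrightarrow>
      transform_lhs (a (of_real r)) (b (of_real r)) (p (of_real r)) x y =
      transform_rhs (a (of_real r)) (b (of_real r)) (p (of_real r)) x y"
    and s: "s \<in> S"
  shows "transform_lhs (a s) (b s) (p s) x y = transform_rhs (a s) (b s) (p s) x y"
proof -
  define D where "D = (\<lambda>s. transform_lhs (a s) (b s) (p s) x y - transform_rhs (a s) (b s) (p s) x y)"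
  have m: "l < (l + u) / 2" "(l + u) / 2 < u" using lu by auto
  have "D s = 0"
  proof (rule analytic_continuation[of D, OF _ S _ _ of_real_islimpt_interval[OF m]])
    show "D holomorphic_on S" unfolding D_def by (rule holomorphic_on_transform[OF S(1) h adm xy])
    show "D z = 0" if "z \<in> of_real ` {l<..<u}" for z using that base by (auto simp: D_def)
    show "of_real ` {l<..<u} \<subseteq> S" using sub by auto
    show "of_real ((l + u) / 2) \<in> S" by (rule sub[OF m])
  qed (rule s)
  then show ?thesis by (simp add: D_def)
qed

lemma open_connected_strip: "open {z. l < Re z \<and> Re z < u}" "connected {z. l < Re z \<and> Re z < u}"
proof -
  have e: "{z. l < Re z \<and> Re z < u} = {z. Re z > l} \<inter> {z. Re z < u}" by auto
  show "open {z. l < Re z \<and> Re z < u}"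
    unfolding e by (intro open_Int open_halfspace_Re_gt open_halfspace_Re_lt)
  show "connected {z. l < Re z \<and> Re z < u}"
    unfolding e by (intro convex_connected convex_Int convex_halfspace_Re_gt convex_halfspace_Re_lt)
qed

lemma transform_identity:
  assumes adm: "admissible a b p" and xy: "x > 0" "y > 0"
  shows "transform_lhs a b p x y = transform_rhs a b p x y"
proof -
  \<comment> \<open>For real \<open>b' > 0\<close> and \<open>p' > 0\<close>, admissibility confines
    \<open>a\<close> to the strip \<open>0 < Re a < 3/2 + b'\<close>, which contains the segment of
    the real case.\<close>
  have step1: "transform_lhs a (of_real b') (of_real p') x y = transform_rhs a (of_real b') (of_real p') x y"
    if h: "b' > 0" "p' > 0" "0 < Re a" "Re a < 3/2 + b'" for a b' p'
    by (rule transform_identity_continue[OF open_connected_strip[of 0 "3/2 + b'"], where a="\<lambda>s. s" and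
          b="\<lambda>_. of_real b'" and p="\<lambda>_. of_real p'" and l=0 and u=1])
      (use h xy transform_identity_real in \<open>auto simp: admissible_def intro!: holomorphic_intros\<close>)
  have a: "Re a > 0" using adm by (simp add: admissible_def)
  \<comment> \<open>For fixed \<open>a\<close>, \<open>m\<close> below is the bound that
    admissibility puts on \<open>Re b\<close>; real \<open>b > l\<close> satisfy in addition the
    hypotheses of the first continuation, namely \<open>b > 0\<close> and
    \<open>Re a < 3/2 + b\<close>.\<close>
  define l where "l = max 0 (Re a - 3/2)"
  define m where "m = max (- Re a) (Re a - 3/2)"
  have step2: "transform_lhs a b (of_real p') x y = transform_rhs a b (of_real p') x y" if p': "p' > 0" for p'
  proof (rule transform_identity_continue[OF open_halfspace_Re_gt[of m] convex_connected[OF convex_halfspace_Re_gt[of m]],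
        where a="\<lambda>_. a" and b="\<lambda>s. s" and p="\<lambda>_. of_real p'" and l=l and u="l + 1"])
    show "admissible a s (of_real p')" if "s \<in> {z. Re z > m}" for s
      using that a p' by (auto simp: admissible_def m_def)
    show "of_real r \<in> {z. Re z > m}" if "l < r" for r using that a by (auto simp: l_def m_def)
    show "transform_lhs a (of_real r) (of_real p') x y = transform_rhs a (of_real r) (of_real p') x y" if "l < r" for r
      by (rule step1) (use that p' a in \<open>auto simp: l_def\<close>)
    show "b \<in> {z. Re z > m}" using adm by (auto simp: admissible_def m_def)
  qed (use xy in \<open>auto intro!: holomorphic_intros\<close>)
  show ?thesis
  proof (rule transform_identity_continue[OF open_Re_gt_0 connected_Re_gt_0,
        where a="\<lambda>_. a" and b="\<lambda>_. b" and p="\<lambda>s. s" and l=0 and u=1])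
    show "p \<in> {z. Re z > 0}" using adm by (simp add: admissible_def)
  qed (use xy step2 adm in \<open>auto simp: admissible_def intro!: holomorphic_intros\<close>)
qed

section \<open>Return to parabolic cylinder functions\<close>

lemma rGamma_duplication:
  fixes z :: complex
  assumes "z + 1 / 2 \<notin> \<int>\<^sub>\<le>\<^sub>0"
  shows "rGamma (2 * z) = 2 powr (1 - 2 * z) * of_real (sqrt pi) * rGamma z * rGamma (z + 1 / 2)"
proof (cases "z \<in> \<int>\<^sub>\<le>\<^sub>0")
  \<comment> \<open>At a pole of \<open>Gamma z\<close> both sides are zero. With
    \<open>z = - \<nu> / 2\<close> this covers \<open>\<nu> = 0\<close>.\<close>
  case True
  then obtain n where "z = - of_nat n" by (auto elim: nonpos_Ints_cases')
  then have "2 * z = - of_nat (2 * n)" by simp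
  then have "2 * z \<in> \<int>\<^sub>\<le>\<^sub>0" by (metis minus_of_nat_in_nonpos_Ints)
  with True have "rGamma (2 * z) = 0" "rGamma z = 0" by (simp_all only: rGamma_eq_zero_iff)
  then show ?thesis by simp
next
  case False
  have "Ln (of_real 2) = of_real (ln 2)" by (rule Ln_of_real) simp
  then have p: "exp ((1 - 2 * z) * of_real (ln 2)) = 2 powr (1 - 2 * z)" by (simp add: powr_def)
  have nz: "Gamma z \<noteq> 0" "Gamma (z + 1/2) \<noteq> 0" using assms False by (auto simp: Gamma_eq_zero_iff)
  note d = Gamma_legendre_duplication[OF False assms, unfolded p]
  with nz have "Gamma (2 * z) \<noteq> 0" by auto
  then show ?thesis using nz d by (simp add: rGamma_inverse_Gamma field_simps)
qed

lemma Gamma_minus_half_complex: "Gamma (- (1 / 2) :: complex) = - 2 * of_real (sqrt pi)"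
proof -
  have "(- (1 / 2) :: complex) \<notin> \<int>\<^sub>\<le>\<^sub>0"
  proof
    assume "(- (1 / 2) :: complex) \<in> \<int>\<^sub>\<le>\<^sub>0"
    then obtain n :: nat where "(- (1 / 2) :: complex) = - of_nat n" by (auto elim: nonpos_Ints_cases')
    then have "(of_nat 1 :: complex) = of_nat (2 * n)" by (simp add: field_simps)
    then have "1 = 2 * n" by (rule of_nat_eq_iff[THEN iffD1])
    then show False by presburger
  qed
  from Gamma_plus1[of "- (1 / 2) :: complex"] this
  have "Gamma (1 / 2 :: complex) = - (1 / 2) * Gamma (- (1 / 2))" by (auto elim: nonpos_Ints_cases)
  then show ?thesis by (simp add: Gamma_one_half_complex)
qed

text \<open>The sign \<open>e\<close> treats both arguments at once: as \<open>e^2 = 1\<close>, it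
  leaves the square of the argument alone and only changes the sign of the second term. In the
  difference of the two cases the first term cancels.\<close>

lemma parabolic_D_eq:
  fixes \<nu> p :: complex and x :: real
  assumes x: "x > 0" and e: "e = 1 \<or> e = - 1"
  shows "parabolic_D \<nu> (e * of_real (sqrt 2) * of_real (sqrt x) * csqrt p) =
    2 powr (\<nu> / 2) * exp (- (of_real x * p / 2)) *
      (of_real (sqrt pi) * rGamma ((1 - \<nu>) / 2) * kummer_phi (- (\<nu> / 2)) (1 / 2) (of_real x * p)
       - e * (2 * of_real (sqrt pi) * of_real (sqrt x) * csqrt p * rGamma (- (\<nu> / 2)) * kummer_phi ((1 - \<nu>) / 2) (3 / 2) (of_real x * p)))"
proof -
  define z where "z = e * of_real (sqrt 2) * of_real (sqrt x) * csqrt p"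
  have e2: "e\<^sup>2 = 1" using e by auto
  have r: "(complex_of_real (sqrt 2))\<^sup>2 = 2" "(complex_of_real (sqrt x))\<^sup>2 = of_real x"
    using x by (simp_all flip: of_real_power)
  have "z\<^sup>2 = 2 * of_real x * p" unfolding z_def power_mult_distrib e2 r by simp
  then have zz: "z\<^sup>2 / 4 = of_real x * p / 2" "z\<^sup>2 / 2 = of_real x * p" by simp_all
  have zd: "z / of_real (sqrt 2) = e * of_real (sqrt x) * csqrt p"
  proof -
    have "complex_of_real (sqrt 2) \<noteq> 0" by simp
    then show ?thesis unfolding z_def by (simp only: divide_eq_eq) (simp only: mult_ac simp_thms if_True if_False not_False_eq_True)
  qed
  show ?thesis
    unfolding z_def[symmetric] parabolic_D_def zz zd Gamma_one_half_complex Gamma_minus_half_complex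
    by (simp add: algebra_simps)
qed

theorem theorem3p1:
  fixes \<nu> \<mu> p :: complex and x y :: real
  assumes "Re \<nu> < 1"
    and "Re \<mu> < min (1 - Re \<nu>) (2 + Re \<nu>)"
    and "x > 0" and "y > 0" and "Re p > 0"
  shows
    "let f = (\<lambda>t::real.
           exp (- p * of_real t)
           * of_real t powr ((\<nu> - \<mu>) / 2)
           * of_real (x - t) powr (- (1 + \<nu>) / 2)
           * of_real (y + t) powr (\<mu> / 2)
           * hyp2F1 (- \<mu> / 2) ((1 + \<nu>) / 2) (1 + (\<nu> - \<mu>) / 2)
               (of_real (t * (x - y - t) / ((x - t) * (y + t)))));
         g = (\<lambda>t::real.
           exp (- p * of_real t)
           * of_real t powr ((\<nu> - 1) / 2)
           * of_real (t - x) powr (- (1 + \<mu> + \<nu>) / 2)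
           * of_real (y - x + t) powr ((\<mu> - 1) / 2)
           * hyp2F1 ((1 - \<mu>) / 2) ((1 - \<nu>) / 2) (3 / 2)
               (of_real (x * y / (t * (y - x + t)))))
     in set_integrable lborel {0<..<x} f \<and>
        set_integrable lborel {x<..} g \<and>
        p powr (- 1 / 2) * exp (1 / 2 * p * of_real (y - x))
          * parabolic_D \<mu> (of_real (sqrt 2) * of_real (sqrt y) * csqrt p)
          * (parabolic_D \<nu> (- of_real (sqrt 2) * of_real (sqrt x) * csqrt p)
             - parabolic_D \<nu> (of_real (sqrt 2) * of_real (sqrt x) * csqrt p))
        = 2 powr ((\<mu> - \<nu>) / 2) * of_real (sqrt pi)
            * rGamma (1 + (\<nu> - \<mu>) / 2) * rGamma (- \<nu>)
            * (LINT t:{0<..<x}|lborel. f t)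
          + 2 powr (2 + (\<mu> + \<nu>) / 2) * of_real (sqrt pi) * of_real (sqrt y) * of_real (sqrt x)
            * rGamma (- \<mu> / 2) * rGamma (- \<nu> / 2)
            * (LINT t:{x<..}|lborel. g t)"
proof -
  let ?L = "p powr (- 1 / 2) * exp (1 / 2 * p * of_real (y - x)) * parabolic_D \<mu> (of_real (sqrt 2) *
      of_real (sqrt y) * csqrt p) * (parabolic_D \<nu> (- of_real (sqrt 2) * of_real (sqrt x) *
      csqrt p) - parabolic_D \<nu> (of_real (sqrt 2) * of_real (sqrt x) * csqrt p))"
  define a where "a = (1 - \<nu>) / 2"
  define b where "b = - \<mu> / 2"
  have "Re a = (1 - Re \<nu>) / 2" "Re b = - Re \<mu> / 2" by (simp_all add: a_def b_def)
  then have adm: "admissible a b p" using assms by (simp add: admissible_def)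
  have sub: "\<nu> = 1 - 2 * a" "\<mu> = - 2 * b" by (simp_all add: a_def b_def field_simps)
  have f: "inner_kernel a b p x y = (\<lambda>t::real.
           exp (- p * of_real t)
           * of_real t powr ((\<nu> - \<mu>) / 2)
           * of_real (x - t) powr (- (1 + \<nu>) / 2)
           * of_real (y + t) powr (\<mu> / 2)
           * hyp2F1 (- \<mu> / 2) ((1 + \<nu>) / 2) (1 + (\<nu> - \<mu>) / 2)
               (of_real (t * (x - y - t) / ((x - t) * (y + t)))))"
  proof -
    have e: "(\<nu> - \<mu>) / 2 = 1 / 2 - a + b" "- (1 + \<nu>) / 2 = a - 1" "\<mu> / 2 = - b" "- \<mu> / 2 = b"
      "(1 + \<nu>) / 2 = 1 - a" "1 + (1 / 2 - a + b) = 3 / 2 - a + b"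
      by (simp_all add: sub field_simps)
    show ?thesis unfolding e by (rule ext) (simp only: inner_kernel_def)
  qed
  have g: "outer_kernel a b p x y = (\<lambda>t::real.
           exp (- p * of_real t)
           * of_real t powr ((\<nu> - 1) / 2)
           * of_real (t - x) powr (- (1 + \<mu> + \<nu>) / 2)
           * of_real (y - x + t) powr ((\<mu> - 1) / 2)
           * hyp2F1 ((1 - \<mu>) / 2) ((1 - \<nu>) / 2) (3 / 2)
               (of_real (x * y / (t * (y - x + t)))))"
  proof -
    have e: "(\<nu> - 1) / 2 = - a" "- (1 + \<mu> + \<nu>) / 2 = a + b - 1" "(\<mu> - 1) / 2 = - b - 1 / 2"
      "(1 - \<mu>) / 2 = 1 / 2 + b" "(1 - \<nu>) / 2 = a"
      by (simp_all add: sub field_simps)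
    show ?thesis unfolding e by (rule ext) (simp only: outer_kernel_def)
  qed
  have p0: "p \<noteq> 0" using assms(5) by auto
  have cs: "csqrt p = p powr (1 / 2)" by (rule csqrt_conv_powr)
  \<comment> \<open>The odd term of \<open>D_\<nu>\<close> brings the factor \<open>csqrt p\<close>,
    which the prefactor of the theorem removes.\<close>
  have pp: "p powr (- 1 / 2) * csqrt p = 1"
    unfolding cs using p0 by (simp flip: powr_add)
  \<comment> \<open>The 4 combines the 2 in \<open>Gamma (- (1/2)) = - 2 * sqrt pi\<close> with the
    doubling of the odd part in the difference.\<close>
  define c where "c = 2 powr (\<mu> / 2) * 2 powr (\<nu> / 2) * (4 * of_real (sqrt pi)) * rGamma (- (\<nu> / 2))"
  have ex: "exp (1 / 2 * p * of_real (y - x)) * exp (- (of_real y * p / 2)) * exp (- (of_real x * p / 2)) = exp (- p * of_real x)"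
    unfolding exp_add[symmetric] by (rule arg_cong[of _ _ exp]) (simp add: field_simps)
  have "?L =
     c * transform_lhs a b p x y"
  proof -
    have D1: "parabolic_D \<mu> (of_real (sqrt 2) * of_real (sqrt y) * csqrt p) =
        2 powr (\<mu> / 2) * exp (- (of_real y * p / 2)) *
      tricomi_combination b p y"
      using parabolic_D_eq[OF assms(4), of 1 \<mu> p] by (simp add: b_def cs[symmetric] diff_divide_distrib)
    have "parabolic_D \<nu> (- of_real (sqrt 2) * of_real (sqrt x) * csqrt p)
             - parabolic_D \<nu> (of_real (sqrt 2) * of_real (sqrt x) * csqrt p) =
       2 powr (\<nu> / 2) * exp (- (of_real x * p / 2)) * (4 * of_real (sqrt pi) * of_real (sqrt x) * csqrt p * rGamma (- (\<nu> / 2)) * kummer_phi a (3 / 2) (of_real x * p))"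
      using parabolic_D_eq[OF assms(3), of 1 \<nu> p] parabolic_D_eq[OF assms(3), of "-1" \<nu> p]
      by (simp add: a_def algebra_simps)
    note D2 = this
    have "?L =
       (p powr (- 1 / 2) * csqrt p) * c * (of_real (sqrt x) *
         (exp (1 / 2 * p * of_real (y - x)) * exp (- (of_real y * p / 2)) * exp (- (of_real x * p / 2))) *
      tricomi_combination b p y *
       kummer_phi a (3 / 2) (of_real x * p))"
      unfolding D1 D2 c_def by (simp only: mult_ac)
    then show ?thesis unfolding pp ex transform_lhs_def by (simp only: mult_1)
  qed
  also have "\<dots> = c * transform_rhs a b p x y"
    by (simp only: transform_identity[OF adm assms(3,4)])
  also have "\<dots> = 2 powr ((\<mu> - \<nu>) / 2) * of_real (sqrt pi)
            * rGamma (1 + (\<nu> - \<mu>) / 2) * rGamma (- \<nu>)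
            * (LINT t:{0<..<x}|lborel. inner_kernel a b p x y t)
          + 2 powr (2 + (\<mu> + \<nu>) / 2) * of_real (sqrt pi) * of_real (sqrt y) * of_real (sqrt x)
            * rGamma (- \<mu> / 2) * rGamma (- \<nu> / 2)
            * (LINT t:{x<..}|lborel. outer_kernel a b p x y t)"
  proof -
    have sq: "complex_of_real (sqrt pi) * of_real (sqrt pi) = of_real pi" by (simp flip: of_real_mult)
    \<comment> \<open>\<open>Re \<nu> < 1\<close> keeps this point off the poles, so duplication at
      \<open>- \<nu> / 2\<close> splits \<open>rGamma (- \<nu>)\<close> into the reciprocal Gamma
      factor of \<open>c\<close> and \<open>rGamma a\<close>.\<close>
    have "(1 - \<nu>) / 2 \<notin> \<int>\<^sub>\<le>\<^sub>0" by (rule Re_pos_not_nonpos_Int) (use assms(1) in simp)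
    then have "- \<nu> / 2 + 1 / 2 \<notin> \<int>\<^sub>\<le>\<^sub>0" by (simp add: diff_divide_distrib)
    from rGamma_duplication[OF this]
    have d: "rGamma (- \<nu>) = 2 powr (1 + \<nu>) * of_real (sqrt pi) * rGamma (- (\<nu> / 2)) * rGamma a"
      by (simp add: a_def diff_divide_distrib)
    have w1: "2 powr ((\<mu> - \<nu>) / 2) * 2 powr (1 + \<nu>) = (2 powr (\<mu> / 2) * 2 powr (\<nu> / 2)) * (2 :: complex)"
    proof -
      have "2 powr ((\<mu> - \<nu>) / 2) * 2 powr (1 + \<nu>) = (2 :: complex) powr ((\<mu> / 2 + \<nu> / 2) + 1)"
        unfolding powr_add[symmetric] by (rule arg_cong) (simp add: field_simps)
      also have "\<dots> = (2 powr (\<mu> / 2) * 2 powr (\<nu> / 2)) * (2 :: complex)" by (simp add: powr_add)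
      finally show ?thesis .
    qed
    have w2: "2 powr (2 + (\<mu> + \<nu>) / 2) = (2 powr (\<mu> / 2) * 2 powr (\<nu> / 2)) * (4 :: complex)"
    proof -
      have "2 powr (2 + (\<mu> + \<nu>) / 2) = (2 :: complex) powr ((\<mu> / 2 + \<nu> / 2) + of_nat 2)"
        by (rule arg_cong) (simp add: field_simps)
      also have "\<dots> = (2 powr (\<mu> / 2) * 2 powr (\<nu> / 2)) * (2 :: complex) powr of_nat 2" by (simp only: powr_add)
      also have "(2 :: complex) powr of_nat 2 = 4" by (subst powr_nat) simp
      finally show ?thesis .
    qed
    have cc: "1 + (\<nu> - \<mu>) / 2 = 3 / 2 - a + b" by (simp add: sub field_simps)
    have "2 powr ((\<mu> - \<nu>) / 2) * of_real (sqrt pi) * rGamma (3 / 2 - a + b) * rGamma (- \<nu>) =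
       (2 powr ((\<mu> - \<nu>) / 2) * 2 powr (1 + \<nu>)) * (of_real (sqrt pi) * of_real (sqrt pi)) * rGamma (- (\<nu> / 2)) * (rGamma (3 / 2 - a + b) * rGamma a)"
      unfolding d by (simp only: mult_ac)
    also have "\<dots> = c * (of_real (sqrt pi) / 2 * rGamma (3 / 2 - a + b) * rGamma a)"
      unfolding w1 c_def sq[symmetric] by (simp add: mult_ac)
    finally have t1: "2 powr ((\<mu> - \<nu>) / 2) * of_real (sqrt pi) * rGamma (3 / 2 - a + b) * rGamma (- \<nu>) =
       c * (of_real (sqrt pi) / 2 * rGamma (3 / 2 - a + b) * rGamma a)" .
    have t2: "2 powr (2 + (\<mu> + \<nu>) / 2) * of_real (sqrt pi) * of_real (sqrt y) * of_real (sqrt x)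
            * rGamma (- \<mu> / 2) * rGamma (- \<nu> / 2) = c * (of_real (sqrt x) * of_real (sqrt y) * rGamma b)"
      unfolding w2 c_def b_def by (simp add: mult_ac)
    show ?thesis unfolding cc t1 t2 transform_rhs_def by (simp only: ring_distribs mult_ac)
  qed
  finally show ?thesis
    using inner_kernel_integrable[OF adm assms(3,4)] outer_kernel_integrable[OF adm assms(3,4)]
    unfolding Let_def f[symmetric] g[symmetric] by blast
qed

end
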